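(* Let $G$ be an undirected graph with $n$ vertices. Then, for generic games $X$, the Spohn CI variety $\mathcal V_{X,G}$ is smooth away from the hyperplanes of the form $\{p_{j_1\cdots j_n}=0\}$ and $\{p_{+\cdots+}=0\}$. In particular, the set of totally mixed conditional independence equilibria is either empty for generic games or a smooth manifold of codimension $d_1+\cdots+d_n-n$ in $\mathcal M_G$ for generic games.
   Context: Write $[d]=\{1,\dots,d\}$ and $\mathcal R_C=\prod_{i\in C}[d_i]$ for $C\subseteq[n]$. The vertices of $G$ are identified with $n$ players; player $i$ has $d_i$ pure strategies. A $d_1\times\cdots\times d_n$ game is a tuple $X=(X^{(1)},\dots,X^{(n)})$ of real tensors $X^{(k)}=(X^{(k)}_{j_1\cdots j_n})\in\mathbb R^{d_1\times\cdots\times d_n}$ (payoff tensor of player $k$). A statement holds for generic games if it holds for all $X$ in a nonempty Zariski open subset of $(\mathbb R^{d_1\times\cdots\times d_n})^n$. Let $\mathbb P^{d_1\cdots d_n-1}$ be complex projective space with coordinates $p_{j_1\cdots j_n}$, $(j_1,\dots,j_n)\in\mathcal R_{[n]}$. An index replaced by $+$ means summation over that index; thus $p_{+\cdots+i+\cdots+}$, with $i$ in position $k$, is the sum of all $p_{j_1\cdots j_n}$ with $j_k=i$, and $p_{+\cdots+}$ is the sum of all coordinates. $\Delta_{d_1\cdots d_n-1}$ is the open probability simplex (all $p_j>0$, $p_{+\cdots+}=1$), viewed inside $\mathbb P^{d_1\cdots d_n-1}$. Spohn variety: $\mathcal V_X\subseteq\mathbb P^{d_1\cdots d_n-1}$ is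 the common vanishing set, over all $k\in[n]$, of the $2\times2$ minors of the $d_k\times 2$ matrix $M^{(k)}$ whose $i$-th row ($i\in[d_k]$) is $\big(p_{+\cdots+i+\cdots+},\ \sum_{j:\,j_k=i}X^{(k)}_{j_1\cdots j_n}p_{j_1\cdots j_n}\big)$, with $i$ in position $k$. Parametrized undirected graphical model: let $\mathcal C(G)$ be the set of maximal cliques of $G$. $\mathcal M_G\subseteq\mathbb P^{d_1\cdots d_n-1}$ is the projective toric variety that is the Zariski closure of the image of the monomial parametrization $p_{j_1\cdots j_n}=\prod_{C\in\mathcal C(G)}\sigma^{(C)}_{j_C}$, with parameters $\sigma^{(C)}\in\mathbb C^{\mathcal R_C}$ and $j_C=(j_i)_{i\in C}$. Spohn CI variety: $\mathcal V_{X,G}$ is the Zariski closure of $(\mathcal V_X\cap\mathcal M_G)\setminus\mathcal W$, where $\mathcal W$ is the union of the hyperplanes $\{p_j=0\}$ for $j\in\mathcal R_{[n]}$ and the hyperplane $\{p_{+\cdots+}=0\}$. A totally mixed conditional independence (CI) equilibrium is a point of $\mathcal V_{X,G}\cap\Delta_{d_1\cdots d_n-1}$. *)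

theory Defs
  imports
    "HOL-Analysis.Analysis"
    "HOL-Library.Ramsey"
    "HOL-Library.Poly_Mapping"
    "HOL-Library.Function_Algebras"
begin

section \<open>Coordinate spaces and polynomials\<close>

text \<open>The coordinate space over a field with coordinates indexed by the set \<open>I\<close>, as functions
  vanishing off \<open>I\<close> (the same encoding as \<open>Euclidean_space\<close>).\<close>

definition coord_space :: "'i set \<Rightarrow> ('i \<Rightarrow> 'k::zero) set" where
  "coord_space I = {x. \<forall>i. i \<notin> I \<longrightarrow> x i = 0}"

text \<open>Multivariate polynomials: a monomial is a finitely supported exponent function, a polynomial
  a finitely supported coefficient function on monomials.\<close>

type_synonym ('i, 'k) mpoly = "('i \<Rightarrow>\<^sub>0 nat) \<Rightarrow>\<^sub>0 'k"

definition mpoly_eval :: "('i, 'k::comm_semiring_1) mpoly \<Rightarrow> ('i \<Rightarrow> 'k) \<Rightarrow> 'k" where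
  "mpoly_eval f x =
     (\<Sum>m\<in>Poly_Mapping.keys f. Poly_Mapping.lookup f m *
        (\<Prod>i\<in>Poly_Mapping.keys m. x i ^ Poly_Mapping.lookup m i))"

definition polys_in :: "'i set \<Rightarrow> ('i, 'k::zero) mpoly set" where
  "polys_in I = {f. \<forall>m\<in>Poly_Mapping.keys f. Poly_Mapping.keys m \<subseteq> I}"

definition homogeneous :: "('i, 'k::zero) mpoly \<Rightarrow> bool" where
  "homogeneous f \<longleftrightarrow> (\<exists>D. \<forall>m\<in>Poly_Mapping.keys f.
     (\<Sum>i\<in>Poly_Mapping.keys m. Poly_Mapping.lookup m i) = D)"

definition partial :: "'i \<Rightarrow> (('i \<Rightarrow> 'k) \<Rightarrow> 'k) \<Rightarrow> ('i \<Rightarrow> 'k) \<Rightarrow> 'k::real_normed_field" where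
  "partial i f x = deriv (\<lambda>t. f (x(i := t))) (x i)"


section \<open>Zariski topologies, dimension and smoothness\<close>

text \<open>Both Zariski topologies are given by their bases of principal open sets \<open>{f \<noteq> 0}\<close>.\<close>

definition zariski_affine :: "'i set \<Rightarrow> ('i \<Rightarrow> 'k::field) topology" where
  "zariski_affine I =
     topology_generated_by {{x \<in> coord_space I. mpoly_eval f x \<noteq> 0} |f. f \<in> polys_in I}"

definition proj_pt :: "('i \<Rightarrow> complex) \<Rightarrow> ('i \<Rightarrow> complex) set" where
  "proj_pt p = {\<lambda>i. c * p i |c. c \<noteq> 0}"

text \<open>Complex projective space: its points are the classes of nonzero coordinate vectors up to
  nonzero scalars, so \<open>p \<in> x\<close> says that \<open>p\<close> is a vector of homogeneous coordinates of \<open>x\<close>.\<close>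

definition proj_space :: "'i set \<Rightarrow> ('i \<Rightarrow> complex) set set" where
  "proj_space I = {proj_pt p |p. p \<in> coord_space I \<and> (\<exists>i. p i \<noteq> 0)}"

definition zariski_proj :: "'i set \<Rightarrow> ('i \<Rightarrow> complex) set topology" where
  "zariski_proj I = topology_generated_by
     {{x \<in> proj_space I. \<forall>p\<in>x. mpoly_eval f p \<noteq> 0} |f. f \<in> polys_in I \<and> homogeneous f}"

definition irreducible_in :: "'a topology \<Rightarrow> 'a set \<Rightarrow> bool" where
  "irreducible_in T Z \<longleftrightarrow> Z \<subseteq> topspace T \<and> Z \<noteq> {} \<and>
     (\<forall>A B. closedin T A \<and> closedin T B \<and> Z \<subseteq> A \<union> B \<longrightarrow> Z \<subseteq> A \<or> Z \<subseteq> B)"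

text \<open>\<open>Z 0 \<subset> Z 1 \<subset> \<dots> \<subset> Z m\<close> is a chain of irreducible closed subsets of \<open>V\<close>.\<close>

definition irreducible_chain :: "'a topology \<Rightarrow> 'a set \<Rightarrow> nat \<Rightarrow> (nat \<Rightarrow> 'a set) \<Rightarrow> bool" where
  "irreducible_chain T V m Z \<longleftrightarrow>
     (\<forall>i\<le>m. closedin T (Z i) \<and> irreducible_in T (Z i) \<and> Z i \<subseteq> V) \<and>
     (\<forall>i<m. Z i \<subset> Z (Suc i))"

text \<open>Krull dimension. As a supremum in \<open>enat\<close> it is \<open>0\<close> for the empty set.\<close>

definition krull_dim :: "'a topology \<Rightarrow> 'a set \<Rightarrow> enat" where
  "krull_dim T V = Sup {enat m |m. \<exists>Z. irreducible_chain T V m Z}"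

text \<open>Local dimension at a point \<open>x\<close>, i.e. the Krull dimension of the local ring at \<open>x\<close>: only
  chains of irreducible closed sets through \<open>x\<close> count.\<close>

definition local_krull_dim :: "'a topology \<Rightarrow> 'a set \<Rightarrow> 'a \<Rightarrow> enat" where
  "local_krull_dim T V x = Sup {enat m |m. \<exists>Z. irreducible_chain T V m Z \<and> x \<in> Z 0}"

definition vanishing_ideal :: "'i set \<Rightarrow> ('i \<Rightarrow> complex) set set \<Rightarrow> ('i, complex) mpoly set" where
  "vanishing_ideal I V =
     {f \<in> polys_in I. homogeneous f \<and> (\<forall>x\<in>V. \<forall>p\<in>x. mpoly_eval f p = 0)}"

text \<open>Zariski tangent space at \<open>p\<close> of the affine cone over the projective variety \<open>V\<close>. It contains
  the line through \<open>p\<close>, so its dimension exceeds that of the tangent space of \<open>V\<close> by one.\<close>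

definition cone_tangent_space ::
    "'i set \<Rightarrow> ('i \<Rightarrow> complex) set set \<Rightarrow> ('i \<Rightarrow> complex) \<Rightarrow> ('i \<Rightarrow> complex) set" where
  "cone_tangent_space I V p =
     {v \<in> coord_space I. \<forall>f\<in>vanishing_ideal I V. (\<Sum>i\<in>I. partial i (mpoly_eval f) p * v i) = 0}"

abbreviation fun_scale :: "'k::field \<Rightarrow> ('i \<Rightarrow> 'k) \<Rightarrow> 'i \<Rightarrow> 'k" where
  "fun_scale \<equiv> \<lambda>c v i. c * v i"

lemma vector_space_fun_scale: "vector_space fun_scale"
  by unfold_locales (auto simp: algebra_simps)

text \<open>\<open>V\<close> is smooth at \<open>x\<close> if the Zariski tangent space of \<open>V\<close> at \<open>x\<close> has the dimension of \<open>V\<close>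
  at \<open>x\<close> (Jacobian criterion).\<close>

definition smooth_at :: "'i set \<Rightarrow> ('i \<Rightarrow> complex) set set \<Rightarrow> ('i \<Rightarrow> complex) set \<Rightarrow> bool" where
  "smooth_at I V x \<longleftrightarrow> x \<in> V \<and>
     (\<forall>p\<in>x. enat (vector_space.dim fun_scale (cone_tangent_space I V p)) =
             local_krull_dim (zariski_proj I) V x + 1)"


section \<open>Smooth submanifolds of real coordinate spaces\<close>

fun C_k_on :: "nat \<Rightarrow> 'i set \<Rightarrow> ('i \<Rightarrow> real) set \<Rightarrow> (('i \<Rightarrow> real) \<Rightarrow> real) \<Rightarrow> bool" where
  "C_k_on 0 I U f \<longleftrightarrow> continuous_on U f"
| "C_k_on (Suc k) I U f \<longleftrightarrow> continuous_on U f \<and>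
     (\<forall>i\<in>I. (\<forall>x\<in>U. (\<lambda>t. f (x(i := t))) differentiable (at (x i))) \<and> C_k_on k I U (partial i f))"

definition C_infinity_on :: "'i set \<Rightarrow> ('i \<Rightarrow> real) set \<Rightarrow> (('i \<Rightarrow> real) \<Rightarrow> real) \<Rightarrow> bool" where
  "C_infinity_on I U f \<longleftrightarrow> (\<forall>k. C_k_on k I U f)"

text \<open>\<open>S\<close> is an embedded \<open>k\<close>-dimensional smooth submanifold of the space with coordinates indexed by
  the finite set \<open>I\<close>: it is locally diffeomorphic to open subsets of \<open>k\<close>-dimensional space, with
  \<open>\<psi>\<close> the local parametrization and \<open>\<phi>\<close> a smooth ambient extension of its inverse. The empty set
  counts as a manifold of every dimension.\<close>

definition smooth_submanifold :: "'i set \<Rightarrow> nat \<Rightarrow> ('i \<Rightarrow> real) set \<Rightarrow> bool" where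
  "smooth_submanifold I k S \<longleftrightarrow> S \<subseteq> coord_space I \<and>
     (\<forall>p\<in>S. \<exists>U T (\<phi> :: ('i \<Rightarrow> real) \<Rightarrow> nat \<Rightarrow> real) \<psi>.
        openin (top_of_set (coord_space I)) U \<and> p \<in> U \<and>
        openin (top_of_set (coord_space {..<k})) T \<and>
        (\<forall>a<k. C_infinity_on I U (\<lambda>x. \<phi> x a)) \<and>
        (\<forall>i\<in>I. C_infinity_on {..<k} T (\<lambda>t. \<psi> t i)) \<and>
        \<psi> ` T = S \<inter> U \<and> (\<forall>t\<in>T. \<phi> (\<psi> t) = t))"


section \<open>Games, Spohn varieties and graphical models\<close>

definition profiles_on :: "(nat \<Rightarrow> nat) \<Rightarrow> nat set \<Rightarrow> (nat \<Rightarrow> nat) set" where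
  "profiles_on d C = (\<Pi>\<^sub>E i\<in>C. {1..d i})"

abbreviation profiles :: "nat \<Rightarrow> (nat \<Rightarrow> nat) \<Rightarrow> (nat \<Rightarrow> nat) set" where
  "profiles n d \<equiv> profiles_on d {1..n}"

text \<open>A game is a point of the space with coordinates \<open>game_index n d\<close>: \<open>X (k, j)\<close> is the entry at
  \<open>j\<close> of the payoff tensor of player \<open>k\<close>.\<close>

type_synonym game = "nat \<times> (nat \<Rightarrow> nat) \<Rightarrow> real"

definition game_index :: "nat \<Rightarrow> (nat \<Rightarrow> nat) \<Rightarrow> (nat \<times> (nat \<Rightarrow> nat)) set" where
  "game_index n d = {1..n} \<times> profiles n d"

definition for_generic_games :: "nat \<Rightarrow> (nat \<Rightarrow> nat) \<Rightarrow> (game \<Rightarrow> bool) \<Rightarrow> bool" where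
  "for_generic_games n d P \<longleftrightarrow>
     (\<exists>U. openin (zariski_affine (game_index n d)) U \<and> U \<noteq> {} \<and> (\<forall>X\<in>U. P X))"

definition marginal :: "nat \<Rightarrow> (nat \<Rightarrow> nat) \<Rightarrow> nat \<Rightarrow> nat \<Rightarrow> ((nat \<Rightarrow> nat) \<Rightarrow> complex) \<Rightarrow> complex" where
  "marginal n d k i p = (\<Sum>j\<in>{j \<in> profiles n d. j k = i}. p j)"

definition payoff_sum ::
    "nat \<Rightarrow> (nat \<Rightarrow> nat) \<Rightarrow> game \<Rightarrow> nat \<Rightarrow> nat \<Rightarrow> ((nat \<Rightarrow> nat) \<Rightarrow> complex) \<Rightarrow> complex" where
  "payoff_sum n d X k i p = (\<Sum>j\<in>{j \<in> profiles n d. j k = i}. complex_of_real (X (k, j)) * p j)"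

definition spohn_variety ::
    "nat \<Rightarrow> (nat \<Rightarrow> nat) \<Rightarrow> game \<Rightarrow> ((nat \<Rightarrow> nat) \<Rightarrow> complex) set set" where
  "spohn_variety n d X =
     {x \<in> proj_space (profiles n d). \<forall>p\<in>x. \<forall>k\<in>{1..n}. \<forall>i\<in>{1..d k}. \<forall>i'\<in>{1..d k}.
        marginal n d k i p * payoff_sum n d X k i' p
          - marginal n d k i' p * payoff_sum n d X k i p = 0}"

text \<open>Graphs on the vertex set \<open>{1..n}\<close> are given by their set \<open>E\<close> of edges, which are
  two-element sets of vertices.\<close>

definition max_cliques :: "nat \<Rightarrow> nat set set \<Rightarrow> nat set set" where
  "max_cliques n E = {C. C \<subseteq> {1..n} \<and> clique C E \<and>
     (\<forall>C'. C' \<subseteq> {1..n} \<and> clique C' E \<and> C \<subseteq> C' \<longrightarrow> C' = C)}"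

definition clique_param ::
    "nat \<Rightarrow> (nat \<Rightarrow> nat) \<Rightarrow> nat set set \<Rightarrow> (nat set \<Rightarrow> (nat \<Rightarrow> nat) \<Rightarrow> complex)
      \<Rightarrow> (nat \<Rightarrow> nat) \<Rightarrow> complex" where
  "clique_param n d E \<sigma> =
     (\<lambda>j. if j \<in> profiles n d then \<Prod>C\<in>max_cliques n E. \<sigma> C (restrict j C) else 0)"

text \<open>The parametrization is only a rational map to projective space: parameters for which all
  coordinates vanish have no image.\<close>

definition graphical_model ::
    "nat \<Rightarrow> (nat \<Rightarrow> nat) \<Rightarrow> nat set set \<Rightarrow> ((nat \<Rightarrow> nat) \<Rightarrow> complex) set set" where
  "graphical_model n d E = zariski_proj (profiles n d) closure_of
     {proj_pt (clique_param n d E \<sigma>) |\<sigma>. \<exists>j. clique_param n d E \<sigma> j \<noteq> 0}"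

definition special_hyperplanes ::
    "nat \<Rightarrow> (nat \<Rightarrow> nat) \<Rightarrow> ((nat \<Rightarrow> nat) \<Rightarrow> complex) set set" where
  "special_hyperplanes n d =
     (\<Union>j\<in>profiles n d. {x \<in> proj_space (profiles n d). \<forall>p\<in>x. p j = 0}) \<union>
     {x \<in> proj_space (profiles n d). \<forall>p\<in>x. (\<Sum>j\<in>profiles n d. p j) = 0}"

definition spohn_CI_variety ::
    "nat \<Rightarrow> (nat \<Rightarrow> nat) \<Rightarrow> nat set set \<Rightarrow> game \<Rightarrow> ((nat \<Rightarrow> nat) \<Rightarrow> complex) set set" where
  "spohn_CI_variety n d E X = zariski_proj (profiles n d) closure_of
     ((spohn_variety n d X \<inter> graphical_model n d E) - special_hyperplanes n d)"

definition open_simplex :: "nat \<Rightarrow> (nat \<Rightarrow> nat) \<Rightarrow> ((nat \<Rightarrow> nat) \<Rightarrow> real) set" where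
  "open_simplex n d = {p \<in> coord_space (profiles n d).
     (\<forall>j\<in>profiles n d. p j > 0) \<and> (\<Sum>j\<in>profiles n d. p j) = 1}"

text \<open>The open simplex embeds into projective space by \<open>p \<mapsto> proj_pt (\<lambda>j. complex_of_real (p j))\<close>;
  equilibria are kept as real probability vectors.\<close>

definition totally_mixed_CI_equilibria ::
    "nat \<Rightarrow> (nat \<Rightarrow> nat) \<Rightarrow> nat set set \<Rightarrow> game \<Rightarrow> ((nat \<Rightarrow> nat) \<Rightarrow> real) set" where
  "totally_mixed_CI_equilibria n d E X =
     {p \<in> open_simplex n d. proj_pt (\<lambda>j. complex_of_real (p j)) \<in> spohn_CI_variety n d E X}"

end

theory Submission
  imports Defs "HOL-Complex_Analysis.Complex_Analysis"
begin

text \<open>Inside the torus, \<open>\<M>\<^sub>G\<close> is cut out by one pairwise Markov binomial for each profile whose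
  support (the players not using strategy 1) is not a clique. Ordered by the size of the supports,
  these binomials have triangular Jacobian. Off the special hyperplanes the Spohn variety is cut out
  by the \<open>\<Sum>\<^sub>k (d\<^sub>k - 1)\<close> equations saying that each strategy \<open>i \<ge> 2\<close> of a player \<open>k\<close> has the expected
  payoff of that player. Call a solution regular if the gradients of all these equations are
  independent.

  At a regular solution the implicit function theorem provides holomorphic charts, which are real at
  real points. Coordinate slices of a chart give chains of irreducible sets, and no chain is longer
  than the tangent space permits; this yields local dimension, smoothness and the manifold structure,
  and, applied to the Markov binomials alone, the dimension of \<open>\<M>\<^sub>G\<close>.

  Generic games have only regular solutions. Otherwise the games with an irregular solution would be
  Zariski dense, and there would be a prime ideal of polynomials in \<open>(p, X)\<close>, vanishing generically on
  the irregular pairs, modulo which the payoffs are algebraically independent. The derivation moving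
  a single payoff \<open>X\<^sub>k\<^sub>j\<close> then extends to the quotient. Evaluated at a generic irregular pair it preserves
  all equations, and only the equations of player \<open>k\<close> depend on that payoff, so its \<open>p\<close>-component is
  a direction tangent to \<open>\<M>\<^sub>G\<close> along which these equations have a prescribed derivative. Two such
  directions for each equation contradict irregularity.\<close>

section \<open>Polynomial functions\<close>

text \<open>The local count needs exactly as many equations as the codimension, while for three or
  more strategies the \<open>2 x 2\<close> minors of a player outnumber \<open>d k - 1\<close>;
  hence the passage to equations that describe the variety only off the hyperplanes. All equations
  are homogeneous, so the total mass is fixed in order to turn a cone into a chart of the projective
  variety; this explains the shifts by one. Why two directions per equation suffice: moving
  \<open>X (k, j)\<close> changes the equation of strategy \<open>i\<close> in proportion to
  \<open>p j\<close> times (mass if \<open>j k = i\<close>, else 0) minus the marginal of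
  \<open>i\<close>. The marginal does not depend on \<open>j\<close>, so it cancels in the
  difference of two normalized directions. Games are real and the varieties complex; density is
  carried across by real and imaginary parts of polynomials. The ideal from Zorn's lemma is realized
  by actual pairs only for finitely many of its elements at a time, which is enough since finitely
  many derivations of finitely many equations occur. Which alternative holds for the equilibria is
  settled by comparing the dimension of the model with the number of Spohn equations; the empty set
  is allowed as a manifold.\<close>

inductive pfun :: "'i set \<Rightarrow> (('i \<Rightarrow> 'k::comm_semiring_1) \<Rightarrow> 'k) \<Rightarrow> bool" for I where
  const: "pfun I (\<lambda>x. c)"
| coord: "i \<in> I \<Longrightarrow> pfun I (\<lambda>x. x i)"
| add: "pfun I f \<Longrightarrow> pfun I g \<Longrightarrow> pfun I (\<lambda>x. f x + g x)"
| mult: "pfun I f \<Longrightarrow> pfun I g \<Longrightarrow> pfun I (\<lambda>x. f x * g x)"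

text \<open>The rule \<open>zero\<close> makes the zero function homogeneous of every degree, as
  empty sums and vanishing components require.\<close>

inductive hfun :: "'i set \<Rightarrow> nat \<Rightarrow> (('i \<Rightarrow> 'k::comm_semiring_1) \<Rightarrow> 'k) \<Rightarrow> bool" for I where
  const: "hfun I 0 (\<lambda>x. c)"
| zero: "hfun I D (\<lambda>x. 0)"
| coord: "i \<in> I \<Longrightarrow> hfun I 1 (\<lambda>x. x i)"
| add: "hfun I D f \<Longrightarrow> hfun I D g \<Longrightarrow> hfun I D (\<lambda>x. f x + g x)"
| mult: "hfun I D f \<Longrightarrow> hfun I D' g \<Longrightarrow> hfun I (D + D') (\<lambda>x. f x * g x)"

lemma hfun_imp_pfun: "hfun I D f \<Longrightarrow> pfun I f"
  by (induction rule: hfun.induct) (auto intro: pfun.intros)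

lemma pfun_mono: "pfun I f \<Longrightarrow> I \<subseteq> J \<Longrightarrow> pfun J f"
  by (induction rule: pfun.induct) (auto intro: pfun.intros)

lemma pfun_cong: "pfun I f \<Longrightarrow> (\<And>i. i \<in> I \<Longrightarrow> x i = y i) \<Longrightarrow> f x = f y"
  by (induction rule: pfun.induct) auto

lemma pfun_sum:
  assumes "\<And>a. a \<in> A \<Longrightarrow> pfun I (f a)"
  shows "pfun I (\<lambda>x. \<Sum>a\<in>A. f a x)"
  using assms by (induction A rule: infinite_finite_induct) (auto intro: pfun.intros)

lemma pfun_prod:
  assumes "\<And>a. a \<in> A \<Longrightarrow> pfun I (f a)"
  shows "pfun I (\<lambda>x. \<Prod>a\<in>A. f a x)"
  using assms by (induction A rule: infinite_finite_induct) (auto intro: pfun.intros)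

lemma pfun_power: "pfun I f \<Longrightarrow> pfun I (\<lambda>x. f x ^ n)"
  by (induction n) (auto intro: pfun.intros)

lemma pfun_uminus: "pfun I f \<Longrightarrow> pfun I (\<lambda>x. - f x)" for f :: "('i \<Rightarrow> 'k::comm_ring_1) \<Rightarrow> 'k"
  using pfun.mult[OF pfun.const[of I "-1"]] by force

lemma pfun_diff: "pfun I f \<Longrightarrow> pfun I g \<Longrightarrow> pfun I (\<lambda>x. f x - g x)"
  for f :: "('i \<Rightarrow> 'k::comm_ring_1) \<Rightarrow> 'k"
  using pfun.add[OF _ pfun_uminus] by force

lemma hfun_sum:
  assumes "\<And>a. a \<in> A \<Longrightarrow> hfun I D (f a)"
  shows "hfun I D (\<lambda>x. \<Sum>a\<in>A. f a x)"
  using assms by (induction A rule: infinite_finite_induct) (auto intro: hfun.intros)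

lemma hfun_cmult: "hfun I D f \<Longrightarrow> hfun I D (\<lambda>x. c * f x)"
  using hfun.mult[OF hfun.const[of I c]] by force

lemma hfun_diff: "hfun I D f \<Longrightarrow> hfun I D g \<Longrightarrow> hfun I D (\<lambda>x. f x - g x)"
  for f :: "('i \<Rightarrow> 'k::comm_ring_1) \<Rightarrow> 'k"
  using hfun.add[OF _ hfun_cmult[of I D g "-1"]] by force

lemma hfun_power_coord: "i \<in> I \<Longrightarrow> hfun I n (\<lambda>x. x i ^ n)"
proof (induction n)
  case 0
  then show ?case by (auto intro: hfun.const)
next
  case (Suc n)
  then show ?case using hfun.mult[OF hfun.coord[of i I] Suc.IH] by simp
qed

lemma hfun_prod:
  assumes "\<And>a. a \<in> A \<Longrightarrow> hfun I (D a) (f a)"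
  shows "hfun I (sum D A) (\<lambda>x. \<Prod>a\<in>A. f a x)"
  using assms by (induction A rule: infinite_finite_induct) (auto intro: hfun.intros)

lemma hfun_scale: "hfun I D f \<Longrightarrow> f (\<lambda>i. c * x i) = c ^ D * f x"
  by (induction rule: hfun.induct) (auto simp: algebra_simps power_add)

text \<open>A polynomial function as a polynomial in one coordinate, or in a homogenizing parameter, is
  written as a univariate polynomial over the ring of all functions.\<close>

lemma pfun_0: "pfun I 0" and pfun_1: "pfun I 1"
  by (simp_all add: zero_fun_def one_fun_def pfun.const)

lemma pfun_plus: "pfun I f \<Longrightarrow> pfun I g \<Longrightarrow> pfun I (f + g)"
  by (simp add: plus_fun_def pfun.add)

lemma pfun_times: "pfun I f \<Longrightarrow> pfun I g \<Longrightarrow> pfun I (f * g)"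
  by (simp add: times_fun_def pfun.mult)

lemma pfun_neg: "pfun I f \<Longrightarrow> pfun I (- f)" for f :: "('i \<Rightarrow> 'k::comm_ring_1) \<Rightarrow> 'k"
  by (simp add: fun_Compl_def pfun_uminus)

lemma pfun_minus: "pfun I f \<Longrightarrow> pfun I g \<Longrightarrow> pfun I (f - g)"
  for f :: "('i \<Rightarrow> 'k::comm_ring_1) \<Rightarrow> 'k"
  by (simp add: fun_diff_def pfun_diff)

lemma pfun_Sum: "(\<And>a. a \<in> A \<Longrightarrow> pfun I (f a)) \<Longrightarrow> pfun I (sum f A)"
  by (induction A rule: infinite_finite_induct) (auto intro: pfun_plus pfun_0)

definition coeffs_in :: "'i set \<Rightarrow> (('i \<Rightarrow> 'k::comm_ring_1) \<Rightarrow> 'k) poly \<Rightarrow> bool" where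
  "coeffs_in K Q \<longleftrightarrow> (\<forall>k. pfun K (coeff Q k))"

lemma coeffs_in_intros:
  "coeffs_in K 0"
  "pfun K c \<Longrightarrow> coeffs_in K (monom c k)"
  "coeffs_in K P \<Longrightarrow> coeffs_in K Q \<Longrightarrow> coeffs_in K (P + Q)"
  "coeffs_in K P \<Longrightarrow> coeffs_in K Q \<Longrightarrow> coeffs_in K (P - Q)"
  "coeffs_in K P \<Longrightarrow> coeffs_in K Q \<Longrightarrow> coeffs_in K (P * Q)"
  "pfun K c \<Longrightarrow> coeffs_in K Q \<Longrightarrow> coeffs_in K (smult c Q)"
  by (auto simp: coeffs_in_def coeff_mult intro: pfun_plus pfun_times pfun_minus pfun_Sum pfun_0)

lemma coeffs_in_pCons: "coeffs_in K (pCons a Q) \<longleftrightarrow> pfun K a \<and> coeffs_in K Q"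
  by (auto simp: coeffs_in_def coeff_pCons split: nat.splits)

lemma coeffs_in_poly: "coeffs_in K Q \<Longrightarrow> pfun K u \<Longrightarrow> pfun K (poly Q u)"
  by (induction Q) (auto simp: coeffs_in_pCons intro: pfun_plus pfun_times pfun_0)

lemma fun_power_apply [simp]: "(f ^ n) x = f x ^ n" for f :: "'a \<Rightarrow> 'b::comm_ring_1"
  by (induction n) auto

lemma coeffs_in_mono: "coeffs_in K Q \<Longrightarrow> K \<subseteq> L \<Longrightarrow> coeffs_in L Q"
  by (auto simp: coeffs_in_def intro: pfun_mono)

lemma pfun_insert_as_poly:
  fixes f :: "('i \<Rightarrow> 'k::comm_ring_1) \<Rightarrow> 'k"
  assumes "pfun (insert u K) f"
  shows "\<exists>Q. coeffs_in K Q \<and> f = poly Q (\<lambda>x. x u)"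
  using assms
proof (induction rule: pfun.induct)
  case (const c)
  show ?case by (rule exI[of _ "[:\<lambda>x. c:]"]) (auto simp: coeffs_in_pCons coeffs_in_intros pfun.const)
next
  case (coord i)
  show ?case
  proof (cases "i = u")
    case True
    then show ?thesis
      by (intro exI[of _ "[:0, 1:]"]) (auto simp: coeffs_in_pCons coeffs_in_intros pfun_0 pfun_1)
  next
    case False
    then show ?thesis using coord
      by (intro exI[of _ "[:\<lambda>x. x i:]"]) (auto simp: coeffs_in_pCons coeffs_in_intros pfun.coord)
  qed
next
  case (add f g)
  then obtain P Q where "coeffs_in K P" "f = poly P (\<lambda>x. x u)" "coeffs_in K Q" "g = poly Q (\<lambda>x. x u)"
    by blast
  then show ?case
    by (intro exI[of _ "P + Q"]) (auto simp: coeffs_in_intros plus_fun_def)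
next
  case (mult f g)
  then obtain P Q where "coeffs_in K P" "f = poly P (\<lambda>x. x u)" "coeffs_in K Q" "g = poly Q (\<lambda>x. x u)"
    by blast
  then show ?case
    by (intro exI[of _ "P * Q"]) (auto simp: coeffs_in_intros times_fun_def)
qed

text \<open>The component of degree \<open>D\<close> is stored as the coefficient of index
  \<open>D\<close>, so that multiplying univariate polynomials is the Cauchy product of components;
  evaluation at \<open>1\<close> adds them up.\<close>

lemma pfun_homogeneous_components:
  fixes f :: "('i \<Rightarrow> 'k::comm_ring_1) \<Rightarrow> 'k"
  assumes "pfun I f"
  shows "\<exists>P. (\<forall>D. hfun I D (coeff P D)) \<and> f = poly P 1"
  using assms
proof (induction rule: pfun.induct)
  case (const c)
  show ?case
    by (rule exI[of _ "[:\<lambda>x. c:]"])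
      (auto simp: coeff_pCons hfun.const hfun.zero[folded zero_fun_def] split: nat.splits)
next
  case (coord i)
  show ?case
    by (rule exI[of _ "[:0, \<lambda>x. x i:]"])
      (use coord in \<open>auto simp: coeff_pCons hfun.coord[simplified] hfun.zero[folded zero_fun_def] split: nat.splits\<close>)
next
  case (add f g)
  then obtain P Q where PQ: "\<forall>D. hfun I D (coeff P D)" "f = poly P 1" "\<forall>D. hfun I D (coeff Q D)" "g = poly Q 1"
    by blast
  have "hfun I D (coeff (P + Q) D)" for D
    using PQ hfun.add[of I D "coeff P D" "coeff Q D"] by (simp add: plus_fun_def)
  then show ?case
    by (intro exI[of _ "P + Q"]) (simp only: PQ poly_add plus_fun_def, simp)
next
  case (mult f g)
  then obtain P Q where PQ: "\<forall>D. hfun I D (coeff P D)" "f = poly P 1" "\<forall>D. hfun I D (coeff Q D)" "g = poly Q 1"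
    by blast
  have "hfun I D (coeff (P * Q) D)" for D
  proof -
    have "hfun I D (\<lambda>x. \<Sum>i\<le>D. coeff P i x * coeff Q (D - i) x)"
    proof (rule hfun_sum)
      fix i assume "i \<in> {..D}"
      then show "hfun I D (\<lambda>x. coeff P i x * coeff Q (D - i) x)"
        using PQ hfun.mult[of I i "coeff P i" "D - i" "coeff Q (D - i)"] by simp
    qed
    moreover have "(\<lambda>x. \<Sum>i\<le>D. coeff P i x * coeff Q (D - i) x) = coeff (P * Q) D"
    proof -
      have "sum F A x = (\<Sum>i\<in>A. F i x)" for F :: "nat \<Rightarrow> ('i \<Rightarrow> 'k) \<Rightarrow> 'k" and A x
        by (induction A rule: infinite_finite_induct) auto
      then show ?thesis by (auto simp: coeff_mult fun_eq_iff)
    qed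
    ultimately show ?thesis by simp
  qed
  then show ?case
    by (intro exI[of _ "P * Q"]) (simp only: PQ poly_mult times_fun_def, simp)
qed

subsection \<open>Multivariate polynomials\<close>

lemma mpoly_eval_superset:
  assumes "finite S" "Poly_Mapping.keys f \<subseteq> S"
  shows "mpoly_eval f x = (\<Sum>m\<in>S. Poly_Mapping.lookup f m *
        (\<Prod>i\<in>Poly_Mapping.keys m. x i ^ Poly_Mapping.lookup m i))"
  unfolding mpoly_eval_def
  by (rule sum.mono_neutral_left) (use assms in \<open>auto simp: in_keys_iff\<close>)

lemma mpoly_eval_add: "mpoly_eval (f + g) x = mpoly_eval f x + mpoly_eval g x"
proof -
  let ?S = "Poly_Mapping.keys f \<union> Poly_Mapping.keys g"
  have "Poly_Mapping.keys (f + g) \<subseteq> ?S" by (rule keys_add)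
  then show ?thesis
    by (subst (1 2 3) mpoly_eval_superset[of ?S])
      (auto simp: lookup_add algebra_simps sum.distrib)
qed

definition mon_eval :: "('i \<Rightarrow>\<^sub>0 nat) \<Rightarrow> ('i \<Rightarrow> 'k::comm_semiring_1) \<Rightarrow> 'k" where
  "mon_eval m x = (\<Prod>i\<in>Poly_Mapping.keys m. x i ^ Poly_Mapping.lookup m i)"

lemma mon_eval_add: "mon_eval (a + b) x = mon_eval a x * mon_eval b x"
proof -
  have *: "mon_eval m x = (\<Prod>i\<in>S. x i ^ Poly_Mapping.lookup m i)"
    if "finite S" "Poly_Mapping.keys m \<subseteq> S" for m S
    unfolding mon_eval_def
    by (rule prod.mono_neutral_left) (use that in \<open>auto simp: in_keys_iff\<close>)
  let ?S = "Poly_Mapping.keys a \<union> Poly_Mapping.keys b"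
  have "Poly_Mapping.keys (a + b) \<subseteq> ?S" by (rule keys_add)
  then show ?thesis
    by (subst (1 2 3) *[of ?S]) (auto simp: lookup_add power_add prod.distrib)
qed

lemma mpoly_eval_single: "mpoly_eval (Poly_Mapping.single m c) x = c * mon_eval m x"
  by (subst mpoly_eval_superset[of "{m}"]) (auto simp: mon_eval_def)

lemma mpoly_eval_0 [simp]: "mpoly_eval 0 x = 0"
  by (simp add: mpoly_eval_def)

lemma mpoly_eval_sum: "mpoly_eval (sum f A) x = (\<Sum>a\<in>A. mpoly_eval (f a) x)"
  by (induction A rule: infinite_finite_induct) (auto simp: mpoly_eval_add)

lemma mpoly_as_sum:
  "f = (\<Sum>m\<in>Poly_Mapping.keys f. Poly_Mapping.single m (Poly_Mapping.lookup f m))"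
  by (rule poly_mapping_eqI) (auto simp: lookup_sum lookup_single when_def in_keys_iff)

lemma mpoly_eval_mult: "mpoly_eval (f * g) x = mpoly_eval f x * mpoly_eval g x"
proof -
  have "f * g = (\<Sum>a\<in>Poly_Mapping.keys f. \<Sum>b\<in>Poly_Mapping.keys g.
      Poly_Mapping.single (a + b) (Poly_Mapping.lookup f a * Poly_Mapping.lookup g b))"
    by (subst mpoly_as_sum[of f], subst mpoly_as_sum[of g])
      (simp add: sum_product mult_single)
  then have "mpoly_eval (f * g) x = (\<Sum>a\<in>Poly_Mapping.keys f. \<Sum>b\<in>Poly_Mapping.keys g.
      Poly_Mapping.lookup f a * Poly_Mapping.lookup g b * (mon_eval a x * mon_eval b x))"
    by (simp add: mpoly_eval_sum mpoly_eval_single mon_eval_add)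
  also have "\<dots> = mpoly_eval f x * mpoly_eval g x"
    by (simp add: mpoly_eval_def sum_product mon_eval_def[symmetric] algebra_simps)
  finally show ?thesis .
qed

lemma polys_in_add: "f \<in> polys_in I \<Longrightarrow> g \<in> polys_in I \<Longrightarrow> f + g \<in> polys_in I"
  using keys_add[of f g] by (auto simp: polys_in_def)

lemma polys_in_mult:
  fixes f g :: "('i, 'k::comm_semiring_1) mpoly"
  assumes "f \<in> polys_in I" "g \<in> polys_in I"
  shows "f * g \<in> polys_in I"
proof -
  have "Poly_Mapping.keys m \<subseteq> I" if "m \<in> Poly_Mapping.keys (f * g)" for m
  proof -
    obtain a b where "m = a + b" "a \<in> Poly_Mapping.keys f" "b \<in> Poly_Mapping.keys g"
      using \<open>m \<in> _\<close> keys_mult[of f g] by blast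
    then show ?thesis using assms keys_add[of a b] by (fastforce simp: polys_in_def)
  qed
  then show ?thesis by (auto simp: polys_in_def)
qed

definition mdeg :: "('i \<Rightarrow>\<^sub>0 nat) \<Rightarrow> nat" where
  "mdeg m = (\<Sum>i\<in>Poly_Mapping.keys m. Poly_Mapping.lookup m i)"

lemma mdeg_add: "mdeg (a + b) = mdeg a + mdeg b"
proof -
  have *: "mdeg m = (\<Sum>i\<in>S. Poly_Mapping.lookup m i)"
    if "finite S" "Poly_Mapping.keys m \<subseteq> S" for m :: "'a \<Rightarrow>\<^sub>0 nat" and S
    unfolding mdeg_def
    by (rule sum.mono_neutral_left) (use that in \<open>auto simp: in_keys_iff\<close>)
  let ?S = "Poly_Mapping.keys a \<union> Poly_Mapping.keys b"
  have "Poly_Mapping.keys (a + b) \<subseteq> ?S" by (rule keys_add)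
  then show ?thesis
    by (subst (1 2 3) *[of ?S]) (auto simp: lookup_add sum.distrib)
qed

text \<open>Together with \<open>mpoly_imp_pfun\<close> and the homogeneous versions this lets the
  topologies and tangent spaces, which are defined by formal polynomials, be treated through
  functions.\<close>

lemma pfun_imp_mpoly: "pfun I f \<Longrightarrow> \<exists>F\<in>polys_in I. mpoly_eval F = f"
proof (induction rule: pfun.induct)
  case (const c)
  show ?case
    by (rule bexI[of _ "Poly_Mapping.single 0 c"])
      (auto simp: mpoly_eval_single mon_eval_def polys_in_def fun_eq_iff)
next
  case (coord i)
  then show ?case
    by (intro bexI[of _ "Poly_Mapping.single (Poly_Mapping.single i 1) 1"])
      (auto simp: mpoly_eval_single mon_eval_def polys_in_def fun_eq_iff)
next
  case (add f g)
  then show ?case using polys_in_add mpoly_eval_add by (metis (mono_tags, lifting) ext)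
next
  case (mult f g)
  then show ?case using polys_in_mult mpoly_eval_mult by (metis (mono_tags, lifting) ext)
qed

lemma hfun_imp_mpoly: "hfun I D f \<Longrightarrow> \<exists>F\<in>polys_in I. homogeneous F \<and> mpoly_eval F = f"
proof -
  \<comment> \<open>The induction carries the degree itself: \<open>homogeneous\<close> hides it
    behind an existential, and a sum of forms of unrelated degrees would not be homogeneous.\<close>
  have "hfun I D f \<Longrightarrow> \<exists>F\<in>polys_in I. (\<forall>m\<in>Poly_Mapping.keys F. mdeg m = D) \<and> mpoly_eval F = f"
  proof (induction rule: hfun.induct)
    case (const c)
    show ?case
      by (rule bexI[of _ "Poly_Mapping.single 0 c"])
        (auto simp: mpoly_eval_single mon_eval_def polys_in_def fun_eq_iff mdeg_def)
  next
    case (zero D)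
    show ?case
      by (rule bexI[of _ 0]) (auto simp: polys_in_def fun_eq_iff)
  next
    case (coord i)
    then show ?case
      by (intro bexI[of _ "Poly_Mapping.single (Poly_Mapping.single i 1) 1"])
        (auto simp: mpoly_eval_single mon_eval_def polys_in_def fun_eq_iff mdeg_def)
  next
    case (add D f g)
    then obtain F G where "F \<in> polys_in I" "\<forall>m\<in>Poly_Mapping.keys F. mdeg m = D" "mpoly_eval F = f"
      "G \<in> polys_in I" "\<forall>m\<in>Poly_Mapping.keys G. mdeg m = D" "mpoly_eval G = g" by blast
    then show ?case using keys_add[of F G]
      by (intro bexI[of _ "F + G"]) (auto simp: polys_in_add mpoly_eval_add fun_eq_iff)
  next
    case (mult D f D' g)
    then obtain F G where FG: "F \<in> polys_in I" "\<forall>m\<in>Poly_Mapping.keys F. mdeg m = D" "mpoly_eval F = f"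
      "G \<in> polys_in I" "\<forall>m\<in>Poly_Mapping.keys G. mdeg m = D'" "mpoly_eval G = g" by blast
    then have "mdeg m = D + D'" if "m \<in> Poly_Mapping.keys (F * G)" for m
      using that keys_mult[of F G] by (fastforce simp: mdeg_add)
    then show ?case using FG
      by (intro bexI[of _ "F * G"]) (auto simp: polys_in_mult mpoly_eval_mult fun_eq_iff)
  qed
  then show "hfun I D f \<Longrightarrow> \<exists>F\<in>polys_in I. homogeneous F \<and> mpoly_eval F = f"
    unfolding homogeneous_def mdeg_def by blast
qed

lemma mpoly_imp_pfun: "F \<in> polys_in I \<Longrightarrow> pfun I (mpoly_eval F)"
  unfolding mpoly_eval_def polys_in_def
  by (intro pfun_sum pfun.mult pfun.const pfun_prod pfun_power pfun.coord) auto

lemma mpoly_imp_hfun: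
  assumes "F \<in> polys_in I" "homogeneous F"
  shows "\<exists>D. hfun I D (mpoly_eval F)"
proof -
  obtain D where D: "\<forall>m\<in>Poly_Mapping.keys F. mdeg m = D"
    using assms(2) unfolding homogeneous_def mdeg_def by blast
  have "hfun I D (\<lambda>x. Poly_Mapping.lookup F m *
        (\<Prod>i\<in>Poly_Mapping.keys m. x i ^ Poly_Mapping.lookup m i))" if "m \<in> Poly_Mapping.keys F" for m
  proof -
    have "hfun I (\<Sum>i\<in>Poly_Mapping.keys m. Poly_Mapping.lookup m i)
        (\<lambda>x. \<Prod>i\<in>Poly_Mapping.keys m. x i ^ Poly_Mapping.lookup m i)"
      by (rule hfun_prod, rule hfun_power_coord) (use that assms(1) in \<open>auto simp: polys_in_def\<close>)
    then show ?thesis using D that hfun_cmult unfolding mdeg_def by fastforce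
  qed
  then show ?thesis unfolding mpoly_eval_def by (intro exI[of _ D] hfun_sum) auto
qed

subsection \<open>Partial derivatives\<close>

lemma pfun_field_differentiable:
  fixes f :: "('i \<Rightarrow> 'k::real_normed_field) \<Rightarrow> 'k"
  shows "pfun I f \<Longrightarrow> (\<lambda>t. f (x(i := t))) field_differentiable (at t)"
proof (induction rule: pfun.induct)
  case (coord j)
  then show ?case by (cases "i = j") auto
qed (auto intro: field_differentiable_add field_differentiable_mult)

lemma pfun_has_partial:
  fixes f :: "('i \<Rightarrow> 'k::real_normed_field) \<Rightarrow> 'k"
  assumes "pfun I f"
  shows "((\<lambda>t. f (x(i := t))) has_field_derivative partial i f (x(i := t))) (at t)"
proof -
  have "(\<lambda>t'. f ((x(i := t))(i := t'))) = (\<lambda>t'. f (x(i := t')))" by simp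
  then show ?thesis
    using pfun_field_differentiable[OF assms, of x i t]
    unfolding partial_def by (simp add: field_differentiable_derivI)
qed

lemma partial_const [simp]: "partial i (\<lambda>x. c) x = 0"
  by (simp add: partial_def)

lemma partial_coord: "partial i (\<lambda>x. x j) x = (if i = j then 1 else 0)"
  by (simp add: partial_def)

lemma partial_add:
  assumes "pfun I f" "pfun J g"
  shows "partial i (\<lambda>x. f x + g x) x = partial i f x + partial i g x"
  unfolding partial_def
  by (rule deriv_add; rule pfun_field_differentiable; fact)

lemma partial_diff:
  assumes "pfun I f" "pfun J g"
  shows "partial i (\<lambda>x. f x - g x) x = partial i f x - partial i g x"
  unfolding partial_def
  by (rule deriv_diff; rule pfun_field_differentiable; fact)

lemma partial_mult:
  assumes "pfun I f" "pfun J g"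
  shows "partial i (\<lambda>x. f x * g x) x = f x * partial i g x + partial i f x * g x"
  unfolding partial_def
  by (subst deriv_mult; (rule pfun_field_differentiable, fact)?) simp

lemma partial_outside:
  assumes "pfun I f" "i \<notin> I"
  shows "partial i f x = 0"
proof -
  have "(\<lambda>t. f (x(i := t))) = (\<lambda>t. f x)"
    using assms by (intro ext pfun_cong[OF assms(1)]) auto
  then show ?thesis by (simp add: partial_def)
qed

lemma pfun_partial:
  fixes f :: "('i \<Rightarrow> 'k::real_normed_field) \<Rightarrow> 'k"
  shows "pfun I f \<Longrightarrow> pfun I (partial i f)"
proof (induction rule: pfun.induct)
  case (const c)
   have "partial i (\<lambda>x::'i\<Rightarrow>'k. c) = (\<lambda>x. 0)" by (rule ext) simp
  then show ?case by (simp add: pfun.const)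
next
  case (coord j)
  have "partial i (\<lambda>x::'i\<Rightarrow>'k. x j) = (\<lambda>x. if i = j then 1 else 0)" by (rule ext) (rule partial_coord)
  then show ?case by (simp add: pfun.const)
next
  case (add f g)
  then have "partial i (\<lambda>x. f x + g x) = (\<lambda>x. partial i f x + partial i g x)"
    by (intro ext partial_add)
  then show ?case using add by (simp add: pfun.add)
next
  case (mult f g)
  then have "partial i (\<lambda>x. f x * g x) = (\<lambda>x. f x * partial i g x + partial i f x * g x)"
    by (intro ext partial_mult)
  then show ?case using mult by (simp add: pfun.add pfun.mult)
qed

lemma pfun_continuous_on:
  fixes f :: "('i \<Rightarrow> 'k::real_normed_field) \<Rightarrow> 'k"
  shows "pfun I f \<Longrightarrow> continuous_on S f"
  by (induction rule: pfun.induct) (auto intro!: continuous_intros continuous_on_product_coordinates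
      intro: continuous_on_subset)

text \<open>The boxes in the coordinates \<open>I\<close> generate a filter, and convergence along
  it is preserved by sums and products, so the induction over \<open>pfun\<close> is ordinary limit
  calculus.\<close>

lemma pfun_near:
  fixes f :: "('i \<Rightarrow> 'k::real_normed_field) \<Rightarrow> 'k"
  assumes "pfun I f" "e > 0"
  shows "\<exists>\<delta>>0. \<forall>y. (\<forall>i\<in>I. norm (y i - x i) < \<delta>) \<longrightarrow> norm (f y - f x) < e"
proof -
  define F where "F = (INF \<delta>\<in>{0::real<..}. principal {y. \<forall>i\<in>I. norm (y i - x i) < \<delta>})"
  have ev: "eventually P F \<longleftrightarrow> (\<exists>\<delta>>0. \<forall>y. (\<forall>i\<in>I. norm (y i - x i) < \<delta>) \<longrightarrow> P y)" for P
    unfolding F_def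
  proof (subst eventually_INF_base)
    show "{0::real<..} \<noteq> {}" by auto
    fix a b :: real assume "a \<in> {0<..}" "b \<in> {0<..}"
    then show "\<exists>c\<in>{0<..}. principal {y. \<forall>i\<in>I. norm (y i - x i) < c}
        \<le> inf (principal {y. \<forall>i\<in>I. norm (y i - x i) < a}) (principal {y. \<forall>i\<in>I. norm (y i - x i) < b})"
      by (intro bexI[of _ "min a b"]) auto
  qed (auto simp: eventually_principal)
  have "(f \<longlongrightarrow> f x) F"
    using assms(1)
  proof (induction rule: pfun.induct)
    case (coord i)
    show ?case
      by (rule tendstoI) (use coord in \<open>auto simp: ev dist_norm\<close>)
  qed (auto intro: tendsto_intros)
  then have "eventually (\<lambda>y. dist (f y) (f x) < e) F"
    using assms(2) by (rule tendstoD)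
  then show ?thesis by (simp add: ev dist_norm)
qed

text \<open>The coefficients of the vector field \<open>v\<close> are functions rather than numbers,
  so that derivations of the whole polynomial ring can be applied to ideals; constant coefficients
  give directional derivatives.\<close>

definition der :: "'i set \<Rightarrow> ('i \<Rightarrow> ('i \<Rightarrow> 'k) \<Rightarrow> 'k) \<Rightarrow> (('i \<Rightarrow> 'k::real_normed_field) \<Rightarrow> 'k)
    \<Rightarrow> ('i \<Rightarrow> 'k) \<Rightarrow> 'k" where
  "der I v f x = (\<Sum>i\<in>I. partial i f x * v i x)"

lemma der_const [simp]: "der I v (\<lambda>x. c) x = 0"
  by (simp add: der_def)

lemma der_coord: "finite I \<Longrightarrow> j \<in> I \<Longrightarrow> der I v (\<lambda>x. x j) x = v j x"
  by (simp add: der_def partial_coord if_distrib[of "\<lambda>c. c * _"] cong: if_cong)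

lemma der_add: "pfun A f \<Longrightarrow> pfun B g \<Longrightarrow> der I v (\<lambda>x. f x + g x) x = der I v f x + der I v g x"
  by (simp add: der_def partial_add algebra_simps sum.distrib)

lemma der_diff: "pfun A f \<Longrightarrow> pfun B g \<Longrightarrow> der I v (\<lambda>x. f x - g x) x = der I v f x - der I v g x"
  by (simp add: der_def partial_diff algebra_simps sum_subtractf)

lemma der_mult:
  "pfun A f \<Longrightarrow> pfun B g \<Longrightarrow> der I v (\<lambda>x. f x * g x) x = f x * der I v g x + der I v f x * g x"
  by (simp add: der_def partial_mult algebra_simps sum.distrib sum_distrib_left)

lemma der_sum:
  "(\<And>a. a \<in> A \<Longrightarrow> pfun B (f a)) \<Longrightarrow> der I v (\<lambda>x. \<Sum>a\<in>A. f a x) x = (\<Sum>a\<in>A. der I v (f a) x)"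
proof (induction A rule: infinite_finite_induct)
  case (insert a A)
  then have "der I v (\<lambda>x. f a x + (\<Sum>a\<in>A. f a x)) x = der I v (f a) x + der I v (\<lambda>x. \<Sum>a\<in>A. f a x) x"
    by (intro der_add[of B _ B] pfun_sum) auto
  with insert show ?case by simp
qed auto

lemma pfun_der: "pfun I f \<Longrightarrow> (\<And>i. i \<in> J \<Longrightarrow> pfun I (v i)) \<Longrightarrow> pfun I (der J v f)"
  unfolding der_def[abs_def] by (intro pfun_sum pfun.mult pfun_partial)

lemma fun_power_eq: "f ^ n = (\<lambda>x. f x ^ n)" for f :: "'a \<Rightarrow> 'b::comm_ring_1"
  by (rule ext) simp

section \<open>Prime ideals of polynomial functions\<close>

text \<open>The formal derivative in the univariate variable, for coefficients in the ring of all
  functions, which has zero divisors.\<close>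

definition pder :: "(('i \<Rightarrow> complex) \<Rightarrow> complex) poly \<Rightarrow> (('i \<Rightarrow> complex) \<Rightarrow> complex) poly" where
  "pder Q = (\<Sum>k<degree Q. monom ((\<lambda>x. of_nat (Suc k)) * coeff Q (Suc k)) k)"

lemma coeff_pder: "coeff (pder Q) k = (\<lambda>x. of_nat (Suc k)) * coeff Q (Suc k)"
proof -
  have "coeff (pder Q) k = (\<Sum>j<degree Q. if j = k then (\<lambda>x. of_nat (Suc k)) * coeff Q (Suc k) else 0)"
    unfolding pder_def coeff_sum by (rule sum.cong) auto
  also have "\<dots> = (\<lambda>x. of_nat (Suc k)) * coeff Q (Suc k)"
    by (auto simp: coeff_eq_0)
  finally show ?thesis .
qed

lemma pder_pCons: "pder (pCons a Q) = Q + pCons 0 (pder Q)"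
  by (rule poly_eqI) (auto simp: coeff_pder coeff_pCons fun_eq_iff algebra_simps split: nat.splits)

lemma pder_0 [simp]: "pder 0 = 0"
  by (simp add: pder_def)

lemma degree_pder: "degree Q \<ge> 1 \<Longrightarrow> degree (pder Q) < degree Q"
proof -
  assume "degree Q \<ge> 1"
  have "degree (pder Q) \<le> degree Q - 1"
    by (rule degree_le) (auto simp: coeff_pder coeff_eq_0)
  with \<open>degree Q \<ge> 1\<close> show ?thesis by simp
qed

lemma degree_minus_lead: "degree (Q - monom (lead_coeff Q) (degree Q)) \<le> degree Q - 1"
proof (rule degree_le, intro allI impI)
  fix i assume "i > degree Q - 1"
  then have "i = degree Q \<or> i > degree Q" by auto
  then show "coeff (Q - monom (lead_coeff Q) (degree Q)) i = 0" by (auto simp: coeff_eq_0)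
qed

lemma der_0 [simp]: "der J v 0 = 0"
  by (rule ext) (simp add: zero_fun_def)

lemma der_plus: "pfun A f \<Longrightarrow> pfun B g \<Longrightarrow> der J v (f + g) = der J v f + der J v g"
  by (rule ext) (simp add: plus_fun_def der_add)

lemma der_minus: "pfun A f \<Longrightarrow> pfun B g \<Longrightarrow> der J v (f - g) = der J v f - der J v g"
  by (rule ext) (simp add: fun_diff_def der_diff)

lemma der_times: "pfun A f \<Longrightarrow> pfun B g \<Longrightarrow> der J v (f * g) = f * der J v g + der J v f * g"
  by (rule ext) (simp add: times_fun_def der_mult)

lemma coeffs_in_map_der:
  assumes "coeffs_in K Q" "\<And>a. pfun K (v a)"
  shows "coeffs_in K (map_poly (der J v) Q)"
  using assms by (auto simp: coeffs_in_def coeff_map_poly intro: pfun_der)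

lemma coeffs_in_pder: "coeffs_in K Q \<Longrightarrow> coeffs_in K (pder Q)"
  by (auto simp: coeffs_in_def coeff_pder intro: pfun_times pfun.const)

text \<open>The Leibniz rule separates the action on the coefficients from the action on
  \<open>u\<close>.\<close>

lemma der_poly:
  assumes "finite J" "u \<in> J" "coeffs_in K Q"
  shows "der J v (poly Q (\<lambda>x. x u)) =
    poly (map_poly (der J v) Q) (\<lambda>x. x u) + poly (pder Q) (\<lambda>x. x u) * v u"
  using assms(3)
proof (induction Q)
  case 0
  then show ?case by simp
next
  case (pCons a Q)
  let ?X = "\<lambda>x::'a \<Rightarrow> complex. x u"
  have a: "pfun (insert u K) a" and Q: "coeffs_in K Q"
    using pCons.prems by (auto simp: coeffs_in_pCons intro: pfun_mono)
  have X: "pfun (insert u K) ?X" by (auto intro: pfun.coord)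
  have pQ: "pfun (insert u K) (poly Q ?X)"
    by (rule coeffs_in_poly[OF coeffs_in_mono[OF Q] X]) auto
  have dX: "der J v ?X = v u" by (rule ext) (simp add: der_coord assms)
  have "der J v (poly (pCons a Q) ?X) = der J v a + (?X * der J v (poly Q ?X) + v u * poly Q ?X)"
  proof -
    have "poly (pCons a Q) ?X = a + ?X * poly Q ?X" by simp
    then show ?thesis
      by (simp only: der_plus[OF a pfun_times[OF X pQ]] der_times[OF X pQ] dX)
  qed
  moreover have "poly (map_poly (der J v) (pCons a Q)) ?X = der J v a + ?X * poly (map_poly (der J v) Q) ?X"
    by (simp only: map_poly_pCons[of "der J v", OF der_0] poly_pCons)
  moreover have "poly (pder (pCons a Q)) ?X = poly Q ?X + ?X * poly (pder Q) ?X"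
    by (simp only: pder_pCons poly_add poly_pCons add_0_left)
  ultimately show ?case
    by (intro ext) (simp only: pCons.IH[OF Q] plus_fun_apply times_fun_apply, simp add: algebra_simps)
qed

text \<open>The prime ideal is kept abstract because two kinds occur: vanishing ideals of
  irreducible sets, for the dimension bound, and the ideal of a generic point obtained from Zorn's
  lemma.\<close>

locale prime_pfun =
  fixes J :: "'i set" and P :: "(('i \<Rightarrow> complex) \<Rightarrow> complex) set"
  assumes finJ: "finite J"
    and sub: "f \<in> P \<Longrightarrow> pfun J f"
    and zero: "0 \<in> P"
    and plus: "f \<in> P \<Longrightarrow> g \<in> P \<Longrightarrow> f + g \<in> P"
    and times: "f \<in> P \<Longrightarrow> pfun J g \<Longrightarrow> g * f \<in> P"
    and one: "1 \<notin> P"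
    and prime: "pfun J f \<Longrightarrow> pfun J g \<Longrightarrow> f * g \<in> P \<Longrightarrow> f \<in> P \<or> g \<in> P"
begin

lemma times': "f \<in> P \<Longrightarrow> pfun J g \<Longrightarrow> f * g \<in> P"
  using times by (simp add: mult.commute)

lemma minus: "f \<in> P \<Longrightarrow> g \<in> P \<Longrightarrow> f - g \<in> P"
proof -
  assume f: "f \<in> P" and g: "g \<in> P"
  have "(\<lambda>x. -1) * g \<in> P" by (intro times g pfun.const)
  moreover have "f + (\<lambda>x. -1) * g = f - g" by (simp add: fun_eq_iff)
  ultimately show ?thesis using plus[OF f] by metis
qed

lemma plus_cancel: "f + g \<in> P \<Longrightarrow> f \<in> P \<Longrightarrow> g \<in> P"
  using minus[of "f + g" f] by simp

lemma poly_in_P: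
  assumes "\<And>k. coeff Q k \<in> P" "pfun J X"
  shows "poly Q X \<in> P"
  using assms(1)
proof (induction Q)
  case 0
  then show ?case by (simp add: zero)
next
  case (pCons a Q)
  have "a \<in> P" using pCons.prems[of 0] by simp
  moreover have "coeff Q k \<in> P" for k using pCons.prems[of "Suc k"] by simp
  ultimately show ?case using pCons.IH plus times[OF _ assms(2)] by (simp only: poly_pCons)
qed

text \<open>Algebraicity of \<open>u\<close> over \<open>K\<close> modulo \<open>P\<close>. The
  leading coefficient has to survive in the quotient, since otherwise the degree of the relation
  would mean nothing there.\<close>

definition good :: "'i set \<Rightarrow> 'i \<Rightarrow> (('i \<Rightarrow> complex) \<Rightarrow> complex) poly \<Rightarrow> bool" where
  "good K u M \<longleftrightarrow> coeffs_in K M \<and> poly M (\<lambda>x. x u) \<in> P \<and> lead_coeff M \<notin> P"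

lemma good_degree: "good K u M \<Longrightarrow> degree M \<ge> 1"
proof (rule ccontr)
  assume g: "good K u M" and "\<not> 1 \<le> degree M"
  then obtain c where "M = [:c:]" by (metis degree_eq_zeroE less_one not_less)
  with g show False by (simp add: good_def)
qed

lemma pfun_X_power: "u \<in> J \<Longrightarrow> pfun J ((\<lambda>x. x u :: complex) ^ k)"
  by (subst fun_power_eq) (intro pfun_power pfun.coord)

text \<open>A relation of smaller degree than every good one has its leading coefficient in
  \<open>P\<close>, for otherwise it would be good itself. Its leading term is removed and the
  argument repeated.\<close>

lemma all_coeffs_in:
  assumes "K \<subseteq> J" "u \<in> J" "coeffs_in K Q" "poly Q (\<lambda>x. x u) \<in> P"
    "\<And>M. good K u M \<Longrightarrow> degree Q < degree M"
  shows "coeff Q k \<in> P"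
  using assms(3-)
proof (induction "degree Q" arbitrary: Q k rule: less_induct)
  case less
  have lc: "lead_coeff Q \<in> P" using less.prems unfolding good_def by blast
  let ?Q = "Q - monom (lead_coeff Q) (degree Q)"
  show ?case
  proof (cases "degree Q = 0")
    case True
    then have "coeff Q k = (if k = 0 then lead_coeff Q else 0)" by (simp add: coeff_eq_0)
    then show ?thesis using lc zero by simp
  next
    case False
    have "degree ?Q \<le> degree Q - 1"
      by (rule degree_minus_lead)
    with False have deg: "degree ?Q < degree Q" by simp
    have pl: "pfun K (lead_coeff Q)" using less.prems(1) by (auto simp: coeffs_in_def)
    have "coeff ?Q k \<in> P"
    proof (rule less.hyps[OF deg])
      show "coeffs_in K ?Q" using less.prems(1) pl by (auto intro!: coeffs_in_intros)
      have "pfun J ((\<lambda>x. x u :: complex) ^ degree Q)"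
        by (rule pfun_X_power[OF assms(2)])
      then have "lead_coeff Q * (\<lambda>x. x u) ^ degree Q \<in> P" by (rule times'[OF lc])
      then have "poly Q (\<lambda>x. x u) - lead_coeff Q * (\<lambda>x. x u) ^ degree Q \<in> P"
        by (rule minus[OF less.prems(2)])
      then show "poly ?Q (\<lambda>x. x u) \<in> P"
        by (simp only: poly_diff poly_monom)
      show "degree ?Q < degree M" if "good K u M" for M using less.prems(3)[OF that] deg by simp
    qed
    moreover have "(if k = degree Q then lead_coeff Q else 0) \<in> P" using lc zero by presburger
    ultimately have "coeff ?Q k + (if k = degree Q then lead_coeff Q else 0) \<in> P" by (rule plus)
    also have "coeff ?Q k + (if k = degree Q then lead_coeff Q else 0) = coeff Q k"
    proof (cases "k = degree Q")
      case True
      then show ?thesis by (simp only: coeff_diff coeff_monom if_True diff_add_cancel)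
    next
      case False
      then show ?thesis by (simp only: coeff_diff coeff_monom not_sym[OF False] if_False diff_0_right add_0_right)
    qed
    finally show ?thesis .
  qed
qed

lemma notin_prod: "pfun J f \<Longrightarrow> pfun J g \<Longrightarrow> f \<notin> P \<Longrightarrow> g \<notin> P \<Longrightarrow> f * g \<notin> P"
  using prime by blast

end

text \<open>One step of pseudo-division of \<open>Q\<close> by \<open>A\<close>: multiplying by the
  leading coefficient of \<open>A\<close> replaces dividing by it.\<close>

definition pred :: "'a::comm_ring_1 poly \<Rightarrow> 'a poly \<Rightarrow> 'a poly" where
  "pred A Q = smult (lead_coeff A) Q - monom (lead_coeff Q) (degree Q - degree A) * A"

lemma degree_pred:
  assumes "degree A \<ge> 1" "degree A \<le> degree Q"
  shows "degree (pred A Q) < degree Q"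
proof -
  have "coeff (pred A Q) i = 0" if "i > degree Q - 1" for i
  proof (cases "i = degree Q")
    case True
    have "coeff (monom (lead_coeff Q) (degree Q - degree A) * A) (degree Q) = lead_coeff Q * lead_coeff A"
      using assms by (simp only: coeff_monom_mult) simp
    then show ?thesis unfolding pred_def True by (simp only: coeff_diff coeff_smult) (simp add: mult.commute)
  next
    case False
    then have "i > degree Q" using that by simp
    then show ?thesis using assms
      by (auto simp: pred_def coeff_monom_mult coeff_eq_0)
  qed
  then have "degree (pred A Q) \<le> degree Q - 1" by (intro degree_le) auto
  with assms show ?thesis by simp
qed

lemma coeffs_in_pred: "coeffs_in K A \<Longrightarrow> coeffs_in K Q \<Longrightarrow> coeffs_in K (pred A Q)"
  unfolding pred_def by (intro coeffs_in_intros) (auto simp: coeffs_in_def)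

lemma poly_pred:
  "poly (pred A Q) x = lead_coeff A * poly Q x - lead_coeff Q * x ^ (degree Q - degree A) * poly A x"
  by (simp add: pred_def poly_monom)

context prime_pfun
begin

lemma pfun_coeff: "coeffs_in K Q \<Longrightarrow> K \<subseteq> J \<Longrightarrow> pfun J (coeff Q k)"
  by (auto simp: coeffs_in_def intro: pfun_mono)

lemma poly_pfun: "coeffs_in K Q \<Longrightarrow> K \<subseteq> J \<Longrightarrow> u \<in> J \<Longrightarrow> pfun J (poly Q (\<lambda>x. x u))"
  by (rule coeffs_in_poly[OF coeffs_in_mono pfun.coord])

text \<open>One new coordinate \<open>u\<close>: a derivation extends freely if \<open>u\<close> is transcendental over \<open>K\<close>
  modulo \<open>P\<close>; otherwise its value at \<open>u\<close> is forced by the minimal polynomial \<open>M\<close> of \<open>u\<close>, and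
  multiplying by \<open>M'(u)\<close> avoids denominators.\<close>

lemma derivation_step:
  assumes K: "K \<subseteq> J" and u: "u \<in> J" "u \<notin> K"
    and v: "\<And>a. pfun J (v a)" "\<And>a. a \<notin> K \<Longrightarrow> v a = 0"
    and D: "\<And>f. pfun K f \<Longrightarrow> f \<in> P \<Longrightarrow> der J v f \<in> P"
  shows "\<exists>v' m. pfun J m \<and> m \<notin> P \<and> (\<forall>a. pfun J (v' a)) \<and> (\<forall>a. a \<noteq> u \<longrightarrow> v' a = m * v a) \<and>
    (\<forall>f. pfun (insert u K) f \<longrightarrow> f \<in> P \<longrightarrow> der J v' f \<in> P)"
proof (cases "\<exists>M. good K u M")
  case False
  \<comment> \<open>Without a good relation for \<open>u\<close>, every element of \<open>P\<close>
    in the enlarged coordinates has all its coefficients in \<open>P\<close>; the value zero of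
    \<open>v\<close> at \<open>u\<close> then does no harm.\<close>
  have "der J v f \<in> P" if f: "pfun (insert u K) f" "f \<in> P" for f
  proof -
    obtain Q where Q: "coeffs_in K Q" "f = poly Q (\<lambda>x. x u)"
      using pfun_insert_as_poly[OF f(1)] by blast
    then have "coeff Q k \<in> P" for k
      using all_coeffs_in[OF K u(1) Q(1)] f(2) False by blast
    then have "coeff (map_poly (der J v) Q) k \<in> P" for k
      using D Q(1) by (auto simp: coeff_map_poly coeffs_in_def)
    then have "poly (map_poly (der J v) Q) (\<lambda>x. x u) \<in> P"
      by (rule poly_in_P) (rule pfun.coord[OF u(1)])
    then show ?thesis unfolding Q(2) der_poly[OF finJ u(1) Q(1)] by (simp add: v(2)[OF u(2)])
  qed
  then show ?thesis using v(1) one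
    by (intro exI[of _ v] exI[of _ 1]) (auto simp: pfun_1)
next
  case True
  let ?X = "\<lambda>x. x u"
  define e where "e = (LEAST e. \<exists>M. good K u M \<and> degree M = e)"
  obtain M where M: "good K u M" "degree M = e"
    using LeastI_ex[of "\<lambda>e. \<exists>M. good K u M \<and> degree M = e"] True unfolding e_def by auto
  have e_min: "e \<le> degree N" if "good K u N" for N
    using that unfolding e_def by (intro Least_le) auto
  have e1: "degree M \<ge> 1" using good_degree M(1) by blast
  have cM: "coeffs_in K M" "poly M ?X \<in> P" "lead_coeff M \<notin> P" using M(1) by (auto simp: good_def)
  define m where "m = poly (pder M) ?X"
  have pm: "pfun J m" unfolding m_def using cM(1) K u(1) by (intro poly_pfun coeffs_in_pder)
  \<comment> \<open>The derivative of \<open>M\<close> has smaller degree than every good relation,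
    so \<open>m\<close> in \<open>P\<close> would put its top coefficient, \<open>e\<close> times
    the leading coefficient of \<open>M\<close>, into \<open>P\<close>; characteristic zero excludes
    this.\<close>
  have "m \<notin> P"
  proof
    assume "m \<in> P"
    have "degree (pder M) < degree N" if "good K u N" for N
      using degree_pder[OF e1] e_min[OF that] M(2) by simp
    then have "coeff (pder M) (e - 1) \<in> P"
      using all_coeffs_in[OF K u(1) coeffs_in_pder[OF cM(1)]] \<open>m \<in> P\<close> unfolding m_def by blast
    then have "(\<lambda>x. of_nat e) * lead_coeff M \<in> P"
      using e1 M(2) by (simp add: coeff_pder)
    then have "(\<lambda>x. 1 / of_nat e) * ((\<lambda>x. of_nat e) * lead_coeff M) \<in> P"
      by (rule times) (rule pfun.const)
    moreover have "(\<lambda>x. 1 / of_nat e) * ((\<lambda>x. of_nat e) * lead_coeff M) = lead_coeff M"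
      using e1 M(2) by (auto simp: fun_eq_iff)
    ultimately show False using cM(3) by metis
  qed
  \<comment> \<open>Chosen so that the new derivation annihilates \<open>M(u)\<close>: on the
    coefficients of \<open>M\<close> it is \<open>m\<close> times the old one, and \<open>m\<close>
    is also the factor in front of \<open>w\<close>.\<close>
  define w where "w = - poly (map_poly (der J v) M) ?X"
  define v' where "v' a = (if a = u then w else m * v a)" for a
  have pw: "pfun J w" unfolding w_def using coeffs_in_mono[OF cM(1) K] v(1) u(1)
    by (intro pfun_neg poly_pfun[where K = J] coeffs_in_map_der) auto
  have v': "pfun J (v' a)" for a
    using pw v(1) pm by (auto simp: v'_def intro: pfun_times)
  have dv': "der J v' c = m * der J v c" if "pfun K c" for c
  proof
    fix x
    have "der J v' c x = (\<Sum>a\<in>J. m x * (partial a c x * v a x))"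
      unfolding der_def by (rule sum.cong)
        (use partial_outside[OF that u(2)] in \<open>auto simp: v'_def\<close>)
    then show "der J v' c x = (m * der J v c) x" by (simp add: der_def sum_distrib_left)
  qed
  have mapd: "map_poly (der J v') Q = smult m (map_poly (der J v) Q)" if "coeffs_in K Q" for Q
    by (rule poly_eqI) (use that dv' in \<open>auto simp: coeff_map_poly coeffs_in_def\<close>)
  have derM: "der J v' (poly M ?X) = 0"
    unfolding der_poly[OF finJ u(1) cM(1)] mapd[OF cM(1)]
    by (simp add: v'_def w_def m_def)
  \<comment> \<open>Below the minimal degree all coefficients of \<open>Q\<close> lie in
    \<open>P\<close>. Otherwise a pseudo-division step by \<open>M\<close>, whose value at
    \<open>u\<close> has derivative zero, lowers the degree, and primality cancels the leading
    coefficient of \<open>M\<close>.\<close>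
  have main: "der J v' (poly Q ?X) \<in> P" if "coeffs_in K Q" "poly Q ?X \<in> P" for Q
    using that
  proof (induction "degree Q" arbitrary: Q rule: less_induct)
    case less
    note Q = less.prems
    show ?case
    proof (cases "degree Q < e")
      case True
      then have c: "coeff Q k \<in> P" for k
        using all_coeffs_in[OF K u(1) Q] e_min by (meson less_le_trans)
      have "coeff (map_poly (der J v') Q) k \<in> P" for k
        using D c Q(1) pm by (auto simp: coeff_map_poly coeffs_in_def dv' intro: times)
      then have 1: "poly (map_poly (der J v') Q) ?X \<in> P"
        by (rule poly_in_P) (rule pfun.coord[OF u(1)])
      have "coeff (pder Q) k \<in> P" for k
        unfolding coeff_pder by (intro times c pfun.const)
      then have "poly (pder Q) ?X \<in> P"
        by (rule poly_in_P) (rule pfun.coord[OF u(1)])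
      then show ?thesis unfolding der_poly[OF finJ u(1) Q(1)]
        using 1 v' by (intro plus times')
    next
      case False
      let ?Q = "pred M Q" and ?b = "lead_coeff Q * ?X ^ (degree Q - degree M)"
      have pb: "pfun J ?b" using Q(1) K u(1)
        by (intro pfun_times pfun_coeff[of K] pfun_X_power)
      have pq: "pfun J (poly Q ?X)" and pM: "pfun J (poly M ?X)" and pl: "pfun J (lead_coeff M)"
        using Q cM sub pfun_coeff[OF _ K] by auto
      have eq: "poly ?Q ?X = lead_coeff M * poly Q ?X - ?b * poly M ?X"
        by (simp add: poly_pred)
      have "poly ?Q ?X \<in> P"
        unfolding eq using Q cM pb pl by (intro minus times)
      then have "der J v' (poly ?Q ?X) \<in> P"
        using False M(2) degree_pred[OF e1] coeffs_in_pred[OF cM(1) Q(1)]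
        by (intro less.hyps) auto
      also have "der J v' (poly ?Q ?X) = (der J v' (lead_coeff M) * poly Q ?X - der J v' ?b * poly M ?X)
           + lead_coeff M * der J v' (poly Q ?X)"
      proof -
        have "der J v' (poly ?Q ?X) = (lead_coeff M * der J v' (poly Q ?X) + der J v' (lead_coeff M) * poly Q ?X)
            - (?b * 0 + der J v' ?b * poly M ?X)"
          unfolding eq by (simp only: der_minus[OF pfun_times[OF pl pq] pfun_times[OF pb pM]]
              der_times[OF pl pq] der_times[OF pb pM] derM)
        then show ?thesis by simp
      qed
      finally have "(der J v' (lead_coeff M) * poly Q ?X - der J v' ?b * poly M ?X)
           + lead_coeff M * der J v' (poly Q ?X) \<in> P" .
      moreover have "der J v' (lead_coeff M) * poly Q ?X - der J v' ?b * poly M ?X \<in> P"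
        using Q(2) cM(2) pl pb v' by (intro minus times pfun_der)
      ultimately have "lead_coeff M * der J v' (poly Q ?X) \<in> P"
        by (rule plus_cancel)
      then show ?thesis using prime[OF pl pfun_der[of J _ J v', OF pq v']] cM(3) by blast
    qed
  qed
  show ?thesis
  proof (rule exI[of _ v'], rule exI[of _ m], intro conjI allI impI)
    fix f assume f: "pfun (insert u K) f" "f \<in> P"
    obtain Q where Q: "coeffs_in K Q" "f = poly Q ?X"
      using pfun_insert_as_poly[OF f(1)] by blast
    then show "der J v' f \<in> P" using main f by blast
  qed (use pm \<open>m \<notin> P\<close> v' in \<open>auto simp: v'_def\<close>)
qed

text \<open>Algebraic independence of the classes of the coordinates \<open>Y\<close> modulo
  \<open>P\<close>; the largest such sets measure the transcendence degree of the quotient.\<close>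

definition indep :: "'i set \<Rightarrow> bool" where
  "indep Y \<longleftrightarrow> (\<forall>f. pfun Y f \<longrightarrow> f \<in> P \<longrightarrow> f = 0)"

text \<open>The construction starts with the partial derivative by \<open>y0\<close> on polynomials
  in \<open>Y\<close> and adjoins the other coordinates one at a time. \<open>h\<close> is the
  product of the denominators cleared on the way.\<close>

lemma derivation_exists:
  assumes Y: "Y \<subseteq> J" "indep Y" and y0: "y0 \<in> Y"
  shows "\<exists>v h. pfun J h \<and> h \<notin> P \<and> (\<forall>a. pfun J (v a)) \<and> v y0 = h \<and> (\<forall>y\<in>Y - {y0}. v y = 0) \<and>
    (\<forall>f\<in>P. der J v f \<in> P)"
proof -
  \<comment> \<open>The induction also records that \<open>v\<close> vanishes at the coordinates not
    yet treated, which \<open>derivation_step\<close> requires.\<close>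
  have "\<exists>v h. pfun J h \<and> h \<notin> P \<and> (\<forall>a. pfun J (v a)) \<and> v y0 = h \<and> (\<forall>y\<in>Y - {y0}. v y = 0) \<and>
    (\<forall>a. a \<notin> Y \<union> W \<longrightarrow> v a = 0) \<and> (\<forall>f. pfun (Y \<union> W) f \<longrightarrow> f \<in> P \<longrightarrow> der J v f \<in> P)"
    if "finite W" "W \<subseteq> J - Y" for W
    using that
  proof (induction W)
    case empty
    show ?case
    proof (rule exI[of _ "\<lambda>a. if a = y0 then 1 else 0"], rule exI[of _ 1], intro conjI allI impI)
      fix f assume "pfun (Y \<union> {}) f" "f \<in> P"
      then have "f = 0" using Y(2) by (auto simp: indep_def)
      then show "der J (\<lambda>a. if a = y0 then 1 else 0) f \<in> P" by (simp add: zero)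
    qed (use one y0 in \<open>auto simp: zero_fun_def one_fun_def pfun.const\<close>)
  next
    case (insert u W)
    have "finite W" "W \<subseteq> J - Y" using insert by auto
    from insert.IH[OF this(2)] obtain v h where vh: "pfun J h" "h \<notin> P" "\<forall>a. pfun J (v a)" "v y0 = h"
      "\<forall>y\<in>Y - {y0}. v y = 0" "\<forall>a. a \<notin> Y \<union> W \<longrightarrow> v a = 0"
      "\<forall>f. pfun (Y \<union> W) f \<longrightarrow> f \<in> P \<longrightarrow> der J v f \<in> P" by blast
    have D: "\<And>f. pfun (Y \<union> W) f \<Longrightarrow> f \<in> P \<Longrightarrow> der J v f \<in> P" using vh(7) by blast
    have YW: "Y \<union> W \<subseteq> J" "u \<in> J" "u \<notin> Y \<union> W" using insert Y(1) by auto
    obtain v' m where v': "pfun J m" "m \<notin> P" "\<forall>a. pfun J (v' a)" "\<forall>a. a \<noteq> u \<longrightarrow> v' a = m * v a"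
      "\<forall>f. pfun (insert u (Y \<union> W)) f \<longrightarrow> f \<in> P \<longrightarrow> der J v' f \<in> P"
      using derivation_step[OF YW vh(3)[rule_format] vh(6)[rule_format] D] by blast
    have "u \<notin> Y" using insert by auto
    have "v' y0 = m * h" "\<forall>y\<in>Y - {y0}. v' y = 0" "\<forall>a. a \<notin> Y \<union> insert u W \<longrightarrow> v' a = 0"
    proof -
      show "v' y0 = m * h" using v'(4) vh(4) \<open>u \<notin> Y\<close> y0 by auto
      show "\<forall>y\<in>Y - {y0}. v' y = 0"
      proof
        fix y assume y: "y \<in> Y - {y0}"
        then have "v' y = m * v y" "v y = 0" using v'(4) vh(5) \<open>u \<notin> Y\<close> by auto
        then show "v' y = 0" by simp
      qed
      show "\<forall>a. a \<notin> Y \<union> insert u W \<longrightarrow> v' a = 0"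
      proof (intro allI impI)
        fix a assume a: "a \<notin> Y \<union> insert u W"
        then have "v' a = m * v a" "v a = 0" using v'(4) vh(6) by auto
        then show "v' a = 0" by simp
      qed
    qed
    moreover have "pfun J (m * h)" "m * h \<notin> P"
      using vh v' notin_prod[OF v'(1) vh(1)] by (auto intro: pfun_times)
    moreover have "\<forall>f. pfun (Y \<union> insert u W) f \<longrightarrow> f \<in> P \<longrightarrow> der J v' f \<in> P"
      using v'(5) by (simp only: Un_insert_right)
    ultimately show ?case using v'(3) by blast
  qed
  from this[of "J - Y"] obtain v h where vh: "pfun J h" "h \<notin> P" "\<forall>a. pfun J (v a)" "v y0 = h"
      "\<forall>y\<in>Y - {y0}. v y = 0" "\<forall>f. pfun (Y \<union> (J - Y)) f \<longrightarrow> f \<in> P \<longrightarrow> der J v f \<in> P"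
    using finJ by blast
  have "\<forall>f\<in>P. der J v f \<in> P" using vh(6) sub Y(1) by (simp only: Un_Diff_cancel Un_absorb1) blast
  then show ?thesis using vh(1-5) by blast
qed

text \<open>Iterated \<open>pred\<close>. The multiplier \<open>c\<close> is a power of the leading
  coefficient of \<open>Q\<close> and so avoids the prime ideal; the bound on
  \<open>degree B\<close> is what later places the quotient below the minimal polynomial.\<close>

lemma pseudo_division:
  assumes K: "K \<subseteq> J" and Q: "coeffs_in K Q" "degree Q \<ge> 1" "lead_coeff Q \<notin> P" and "coeffs_in K N"
  shows "\<exists>c B R. pfun K c \<and> c \<notin> P \<and> coeffs_in K B \<and> coeffs_in K R \<and> smult c N = B * Q + R \<and>
    degree R < degree Q \<and> degree B \<le> degree N - degree Q"
  using assms(5)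
proof (induction "degree N" arbitrary: N rule: less_induct)
  case less
  show ?case
  proof (cases "degree N < degree Q")
    case True
    then show ?thesis using less.prems one
      by (intro exI[of _ 1] exI[of _ 0] exI[of _ N]) (auto simp: coeffs_in_intros pfun_1)
  next
    case False
    then have deg: "degree (pred Q N) < degree N" using degree_pred[OF Q(2)] by simp
    obtain c B R where cBR: "pfun K c" "c \<notin> P" "coeffs_in K B" "coeffs_in K R"
      "smult c (pred Q N) = B * Q + R" "degree R < degree Q" "degree B \<le> degree (pred Q N) - degree Q"
      using less.hyps[OF deg coeffs_in_pred[OF Q(1) less.prems]] by blast
    let ?m = "smult c (monom (lead_coeff N) (degree N - degree Q))"
    have pc: "pfun K (lead_coeff Q)" "pfun K (lead_coeff N)"
      using Q(1) less.prems by (auto simp: coeffs_in_def)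
    have "smult (c * lead_coeff Q) N = smult c (pred Q N) + ?m * Q"
      by (simp add: pred_def smult_diff_right)
    also have "\<dots> = (B + ?m) * Q + R"
      by (simp add: cBR(5) algebra_simps)
    finally have eq: "smult (c * lead_coeff Q) N = (B + ?m) * Q + R" .
    have "degree ?m \<le> degree N - degree Q"
      by (meson degree_monom_le degree_smult_le le_trans)
    then have "degree (B + ?m) \<le> degree N - degree Q"
      using cBR(7) deg by (intro degree_add_le) auto
    moreover have "c * lead_coeff Q \<notin> P"
      using cBR pc Q(3) K by (intro notin_prod) (auto intro: pfun_mono)
    ultimately show ?thesis
      using cBR pc eq
      by (intro exI[of _ "c * lead_coeff Q"] exI[of _ "B + ?m"] exI[of _ R])
        (auto intro!: coeffs_in_intros pfun_times)
  qed
qed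

text \<open>Among the multiples of \<open>f\<close> modulo \<open>P\<close>, one of least degree in \<open>u\<close> is free of \<open>u\<close>: otherwise
  pseudo-division of the minimal polynomial of \<open>u\<close> by it leaves a smaller one.\<close>

lemma divides_base_step:
  assumes K: "K \<subseteq> J" and u: "u \<in> J" and gM: "good K u M0"
    and f: "pfun (insert u K) f" "f \<notin> P"
  shows "\<exists>a g. pfun K a \<and> a \<notin> P \<and> pfun J g \<and> a - f * g \<in> P"
proof -
  let ?X = "\<lambda>x. x u"
  define e where "e = (LEAST e. \<exists>M. good K u M \<and> degree M = e)"
  obtain M where M: "good K u M" "degree M = e"
    using LeastI_ex[of "\<lambda>e. \<exists>M. good K u M \<and> degree M = e"] gM unfolding e_def by auto
  have e_min: "e \<le> degree N" if "good K u N" for N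
    using that unfolding e_def by (intro Least_le) auto
  have e1: "degree M \<ge> 1" using good_degree M(1) by blast
  have cM: "coeffs_in K M" "poly M ?X \<in> P" "lead_coeff M \<notin> P" using M(1) by (auto simp: good_def)
  have pf: "pfun J f" using f(1) K u by (auto intro: pfun_mono)
  define N where "N Q \<longleftrightarrow> coeffs_in K Q \<and> poly Q ?X \<notin> P \<and> (\<exists>g. pfun J g \<and> poly Q ?X - f * g \<in> P)" for Q
  obtain Q0 where Q0: "coeffs_in K Q0" "f = poly Q0 ?X" using pfun_insert_as_poly[OF f(1)] by blast
  have "poly Q0 ?X - f * 1 \<in> P" unfolding Q0(2) mult_1_right diff_self by (rule zero)
  then have "N Q0" unfolding N_def using Q0 f(2) pfun_1 by metis
  define q where "q = (LEAST q. \<exists>Q. N Q \<and> degree Q = q)"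
  obtain Q where Q: "N Q" "degree Q = q"
    using LeastI_ex[of "\<lambda>e. \<exists>M. N M \<and> degree M = e"] \<open>N Q0\<close> unfolding q_def by auto
  have q_min: "q \<le> degree R" if "N R" for R
    using that unfolding q_def by (intro Least_le) auto
  obtain g where g: "pfun J g" "poly Q ?X - f * g \<in> P" and cQ: "coeffs_in K Q" "poly Q ?X \<notin> P"
    using Q(1) unfolding N_def by blast
  have pQ: "pfun J (poly Q ?X)" using poly_pfun[OF cQ(1) K u] .
  show ?thesis
  proof (cases "q = 0")
    case True
    then obtain c where c: "Q = [:c:]" using Q(2) by (metis degree_eq_zeroE)
    have "poly Q ?X = c" by (simp only: c poly_pCons poly_0 mult_zero_right add_0_right)
    moreover have "pfun K c" using cQ(1) c by (simp add: coeffs_in_pCons)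
    ultimately show ?thesis using g cQ(2) by metis
  next
    case q0: False
    have lcQ: "lead_coeff Q \<notin> P"
    proof
      assume lc: "lead_coeff Q \<in> P"
      let ?Q = "Q - monom (lead_coeff Q) (degree Q)"
      have "degree ?Q \<le> degree Q - 1"
        by (rule degree_minus_lead)
      with q0 Q(2) have deg: "degree ?Q < q" by simp
      have mon: "lead_coeff Q * ?X ^ degree Q \<in> P"
        by (intro times' lc pfun_X_power u)
      have "poly ?Q ?X = poly Q ?X - lead_coeff Q * ?X ^ degree Q" by (simp add: poly_monom)
      then have "poly ?Q ?X + lead_coeff Q * ?X ^ degree Q = poly Q ?X" by (simp only: diff_add_cancel)
      then have "poly ?Q ?X \<notin> P" using mon cQ(2) plus by metis
      moreover have "poly ?Q ?X - f * g = (poly Q ?X - f * g) - lead_coeff Q * ?X ^ degree Q"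
        by (simp add: poly_monom)
      then have "poly ?Q ?X - f * g \<in> P" using g(2) mon minus by metis
      moreover have "coeffs_in K ?Q" using cQ(1) by (intro coeffs_in_intros) (auto simp: coeffs_in_def)
      ultimately have "N ?Q" using g(1) by (auto simp: N_def)
      then show False using q_min[of ?Q] deg by simp
    qed
    have plM: "pfun J (lead_coeff M)" using pfun_coeff[OF cM(1) K] .
    show ?thesis
    proof (cases "degree Q < degree M")
      case False
      let ?b = "lead_coeff Q * ?X ^ (degree Q - degree M)"
      have pb: "pfun J ?b" using cQ(1) K u
        by (intro pfun_times pfun_coeff[of K] pfun_X_power)
      have bM: "?b * poly M ?X \<in> P" using cM pb by (intro times)
      have eq: "poly (pred M Q) ?X = lead_coeff M * poly Q ?X - ?b * poly M ?X"
        by (simp add: poly_pred)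
      have "poly (pred M Q) ?X \<notin> P"
      proof
        assume "poly (pred M Q) ?X \<in> P"
        moreover have "poly (pred M Q) ?X + ?b * poly M ?X = lead_coeff M * poly Q ?X"
          unfolding eq by (simp only: diff_add_cancel)
        ultimately have "lead_coeff M * poly Q ?X \<in> P" using bM plus by metis
        then show False using prime[OF plM pQ] cM(3) cQ(2) by blast
      qed
      moreover have "poly (pred M Q) ?X - f * (lead_coeff M * g) =
          lead_coeff M * (poly Q ?X - f * g) - ?b * poly M ?X"
        unfolding eq by (simp add: algebra_simps)
      then have "poly (pred M Q) ?X - f * (lead_coeff M * g) \<in> P"
        using bM g(2) plM by (metis minus times)
      ultimately have "N (pred M Q)"
        using coeffs_in_pred[OF cM(1) cQ(1)] pfun_times[OF plM g(1)] by (auto simp: N_def)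
      then show ?thesis using q_min[of "pred M Q"] degree_pred[OF e1, of Q] False Q(2) by simp
    next
      case True
      obtain c B R where cBR: "pfun K c" "c \<notin> P" "coeffs_in K B" "coeffs_in K R"
        "smult c M = B * Q + R" "degree R < degree Q" "degree B \<le> degree M - degree Q"
        using pseudo_division[OF K cQ(1) _ lcQ cM(1)] q0 Q(2) by auto
      have pB: "pfun J (poly B ?X)" and pR: "pfun J (poly R ?X)" and pcJ: "pfun J c"
        using poly_pfun[OF _ K u] cBR pfun_mono[OF _ K] by auto
      have eq: "c * poly M ?X = poly B ?X * poly Q ?X + poly R ?X"
        using arg_cong[OF cBR(5), of "\<lambda>p. poly p ?X"] by simp
      have cMP: "c * poly M ?X \<in> P" using cM pcJ by (intro times)
      have "poly R ?X \<in> P"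
      proof (rule ccontr)
        assume nR: "poly R ?X \<notin> P"
        have "poly R ?X - f * (- poly B ?X * g) = c * poly M ?X - poly B ?X * (poly Q ?X - f * g)"
          unfolding eq by (simp add: algebra_simps)
        then have "poly R ?X - f * (- poly B ?X * g) \<in> P"
          using cMP g(2) pB by (metis minus times)
        moreover have "pfun J (- poly B ?X * g)"
          using pB g(1) by (intro pfun_times pfun_neg)
        ultimately have "N R" using nR cBR by (auto simp: N_def)
        then show False using q_min[of R] cBR(6) Q(2) by simp
      qed
      \<comment> \<open>Now \<open>B(u) Q(u)\<close> lies in \<open>P\<close>, hence
        \<open>B(u)\<close> does. As \<open>B\<close> has smaller degree than \<open>M\<close>, all
        its coefficients lie in \<open>P\<close>, and comparing the coefficients of index
        \<open>e\<close> in \<open>c M = B Q + R\<close> puts \<open>c\<close> times the leading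
        coefficient of \<open>M\<close> into \<open>P\<close>, which is impossible.\<close>
      then have "poly B ?X * poly Q ?X \<in> P" using eq cMP plus_cancel by (metis add.commute)
      then have "poly B ?X \<in> P" using prime[OF pB pQ] cQ(2) by blast
      moreover have "degree B < degree N" if "good K u N" for N
        using e_min[OF that] M(2) cBR(7) q0 Q(2) e1 by simp
      ultimately have Bk: "coeff B k \<in> P" for k
        using all_coeffs_in[OF K u cBR(3)] by blast
      have sumP: "sum F A \<in> P" if "\<And>i. i \<in> A \<Longrightarrow> F i \<in> P" for F and A :: "nat set"
        using that by (induction A rule: infinite_finite_induct) (auto intro: plus zero)
      have "coeff (B * Q) e \<in> P"
        unfolding coeff_mult using Bk pfun_coeff[OF cQ(1) K] by (intro sumP times')
      moreover have "coeff R e = 0" using cBR(6) True M(2) by (simp add: coeff_eq_0)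
      ultimately have "coeff (smult c M) e \<in> P" unfolding cBR(5) by simp
      then have "c * lead_coeff M \<in> P" by (simp add: M(2))
      then show ?thesis using notin_prod[OF pcJ plM] cBR(2) cM(3) by blast
    qed
  qed
qed

text \<open>An algebraic extension: modulo \<open>P\<close> every nonzero element divides a nonzero
  element of the base ring, as an algebraic number divides its norm. The coordinates outside
  \<open>Y\<close> are eliminated one at a time.\<close>

lemma divides_base:
  assumes Y: "Y \<subseteq> J" and alg: "\<And>u. u \<in> J - Y \<Longrightarrow> \<exists>M. good Y u M"
    and f: "pfun J f" "f \<notin> P"
  shows "\<exists>a g. pfun Y a \<and> a \<notin> P \<and> pfun J g \<and> a - f * g \<in> P"
proof -
  have "\<exists>a g. pfun Y a \<and> a \<notin> P \<and> pfun J g \<and> a - f * g \<in> P"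
    if "finite W" "W \<subseteq> J - Y" "pfun (Y \<union> W) f" "f \<notin> P" for W f
    using that
  proof (induction W arbitrary: f)
    case empty
    have "pfun J 1" "f - f * 1 \<in> P" by (simp_all add: zero pfun_1)
    then show ?case using empty unfolding Un_empty_right by blast
  next
    case (insert u W)
    obtain M where "good Y u M" using alg insert by blast
    then have "good (Y \<union> W) u M" by (auto simp: good_def intro: coeffs_in_mono)
    moreover have YW: "Y \<union> W \<subseteq> J" "u \<in> J" "W \<subseteq> J - Y" "pfun (insert u (Y \<union> W)) f"
      using insert.prems Y by auto
    ultimately obtain a g where ag: "pfun (Y \<union> W) a" "a \<notin> P" "pfun J g" "a - f * g \<in> P"
      using divides_base_step[OF YW(1,2) _ YW(4) insert.prems(3)] by blast
    obtain b h where bh: "pfun Y b" "b \<notin> P" "pfun J h" "b - a * h \<in> P"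
      using insert.IH[OF YW(3) ag(1,2)] by blast
    have "b - f * (g * h) = (b - a * h) + (a - f * g) * h" by (simp add: algebra_simps)
    then have "b - f * (g * h) \<in> P" using ag bh plus times' by metis
    then show ?case using bh pfun_times[OF ag(3) bh(3)] by blast
  qed
  moreover have "pfun (Y \<union> (J - Y)) f" using Y f(1) by (simp only: Un_Diff_cancel Un_absorb1)
  ultimately show ?thesis using finJ f(2) by blast
qed

end

text \<open>Passing to a strictly smaller prime ideal raises the transcendence degree. If all
  coordinates were algebraic over \<open>Y\<close> modulo \<open>P'\<close>, some \<open>f\<close>
  in \<open>P\<close> but not in \<open>P'\<close> would divide, modulo \<open>P'\<close>, an
  \<open>a\<close> in the coordinates \<open>Y\<close> outside \<open>P'\<close>; then
  \<open>a\<close> lies in \<open>P\<close>, against the independence of \<open>Y\<close>.\<close>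

lemma indep_extend:
  assumes P: "prime_pfun J P" and P': "prime_pfun J P'" and "P' \<subset> P"
    and Y: "Y \<subseteq> J" "prime_pfun.indep P Y"
  shows "\<exists>u\<in>J - Y. prime_pfun.indep P' (insert u Y)"
proof (rule ccontr)
  interpret P: prime_pfun J P by fact
  interpret P': prime_pfun J P' by fact
  assume neg: "\<not> ?thesis"
  have "\<exists>M. P'.good Y u M" if u: "u \<in> J - Y" for u
  proof -
    obtain f where f: "pfun (insert u Y) f" "f \<in> P'" "f \<noteq> 0"
      using neg u unfolding P'.indep_def by blast
    obtain Q where Q: "coeffs_in Y Q" "f = poly Q (\<lambda>x. x u)"
      using pfun_insert_as_poly[OF f(1)] by blast
    have "Q \<noteq> 0" using f(3) unfolding Q(2) by (metis poly_0)
    then have "lead_coeff Q \<noteq> 0" using leading_coeff_0_iff by blast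
    moreover have "pfun Y (lead_coeff Q)" using Q by (auto simp: coeffs_in_def)
    ultimately have "lead_coeff Q \<notin> P'" using Y(2) \<open>P' \<subset> P\<close> unfolding P.indep_def by blast
    then show ?thesis using Q f(2) unfolding P'.good_def by blast
  qed
  moreover obtain f where f: "f \<in> P" "f \<notin> P'" using \<open>P' \<subset> P\<close> by blast
  ultimately obtain a g where ag: "pfun Y a" "a \<notin> P'" "pfun J g" "a - f * g \<in> P'"
    using P'.divides_base[OF Y(1) _ P.sub[OF f(1)] f(2)] by blast
  have "f * g \<in> P" using f ag by (intro P.times')
  moreover have "a - f * g \<in> P" using ag(4) \<open>P' \<subset> P\<close> by blast
  ultimately have "(a - f * g) + f * g \<in> P" by (intro P.plus)
  then have "a \<in> P" by (simp only: diff_add_cancel)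
  then have "a = 0" using ag(1) Y(2) unfolding P.indep_def by blast
  then show False using ag(2) P'.zero by blast
qed

section \<open>Linear algebra\<close>

lemma homogeneous_system:
  fixes c :: "'l \<Rightarrow> 'a \<Rightarrow> 'k::field"
  assumes "finite A" "finite L" "card A < card L"
  shows "\<exists>\<alpha>. (\<exists>l\<in>L. \<alpha> l \<noteq> 0) \<and> (\<forall>a\<in>A. (\<Sum>l\<in>L. \<alpha> l * c l a) = 0)"
  using assms
proof (induction A arbitrary: L c)
  case empty
  then obtain l where "l \<in> L" by fastforce
  then show ?case by (intro exI[of _ "\<lambda>_. 1"]) auto
next
  case (insert a A)
  show ?case
  proof (cases "\<forall>l\<in>L. c l a = 0")
    case True
    have "card A < card L" using insert by simp
    then obtain \<alpha> where "\<exists>l\<in>L. \<alpha> l \<noteq> 0" "\<forall>a\<in>A. (\<Sum>l\<in>L. \<alpha> l * c l a) = 0"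
      using insert.IH[of L c] insert by blast
    then show ?thesis using True by (intro exI[of _ \<alpha>]) auto
  next
    case False
    then obtain m where m: "m \<in> L" "c m a \<noteq> 0" by blast
    let ?c = "\<lambda>l b. c l b - c l a / c m a * c m b"
    have "card A < card (L - {m})" using insert m by simp
    then obtain \<alpha> where \<alpha>: "\<exists>l\<in>L - {m}. \<alpha> l \<noteq> 0" "\<forall>b\<in>A. (\<Sum>l\<in>L - {m}. \<alpha> l * ?c l b) = 0"
      using insert.IH[of "L - {m}" ?c] insert.prems by blast
    define \<beta> where "\<beta> l = (if l = m then - (\<Sum>l\<in>L - {m}. \<alpha> l * (c l a / c m a)) else \<alpha> l)" for l
    have "(\<Sum>l\<in>L. \<beta> l * c l b) = (\<Sum>l\<in>L - {m}. \<alpha> l * ?c l b)" for b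
    proof -
      have "(\<Sum>l\<in>L. \<beta> l * c l b) = \<beta> m * c m b + (\<Sum>l\<in>L - {m}. \<beta> l * c l b)"
        using m insert.prems by (intro sum.remove) auto
      also have "(\<Sum>l\<in>L - {m}. \<beta> l * c l b) = (\<Sum>l\<in>L - {m}. \<alpha> l * c l b)"
        by (rule sum.cong) (auto simp: \<beta>_def)
      finally show ?thesis
        by (simp add: \<beta>_def algebra_simps sum_subtractf sum_distrib_left sum_distrib_right)
    qed
    moreover have "?c l a = 0" for l using m by simp
    ultimately have "\<forall>b\<in>insert a A. (\<Sum>l\<in>L. \<beta> l * c l b) = 0" using \<alpha>(2) by simp
    moreover have "\<exists>l\<in>L. \<beta> l \<noteq> 0" using \<alpha>(1) by (auto simp: \<beta>_def)
    ultimately show ?thesis by blast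
  qed
qed

text \<open>Linear independence of vectors of polynomials is an open condition; Gaussian elimination
  produces the polynomial \<open>\<delta>\<close> without mentioning determinants.\<close>

lemma trivial_kernel_open:
  fixes R :: "('b \<Rightarrow> ('i \<Rightarrow> complex) \<Rightarrow> complex) set"
  assumes "finite B" "\<And>r b. r \<in> R \<Longrightarrow> pfun I (r b)"
    and "\<And>v b. (\<forall>r\<in>R. (\<Sum>b\<in>B. r b p * v b) = 0) \<Longrightarrow> b \<in> B \<Longrightarrow> v b = 0"
  shows "\<exists>\<delta>. pfun I \<delta> \<and> \<delta> p \<noteq> 0 \<and>
    (\<forall>q v. \<delta> q \<noteq> 0 \<longrightarrow> (\<forall>r\<in>R. (\<Sum>b\<in>B. r b q * v b) = 0) \<longrightarrow> (\<forall>b\<in>B. v b = 0))"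
  using assms
proof (induction B arbitrary: R)
  case empty
  show ?case by (rule exI[of _ "\<lambda>x. 1"]) (auto intro: pfun.const)
next
  case (insert b B)
  have "\<exists>r\<in>R. r b p \<noteq> 0"
  proof (rule ccontr)
    assume neg: "\<not> ?thesis"
    have "(\<Sum>c\<in>insert b B. r c p * (if c = b then 1 else 0)) = 0" if "r \<in> R" for r
      using neg that by (intro sum.neutral) auto
    then show False using insert.prems(2)[of "\<lambda>c. if c = b then 1 else 0" b] by auto
  qed
  then obtain r where r: "r \<in> R" "r b p \<noteq> 0" by blast
  \<comment> \<open>Elimination of the column \<open>b\<close> with pivot row \<open>r\<close>,
    cleared of denominators so that the entries remain polynomials; the final
    \<open>\<delta>\<close> is the product of the pivots.\<close>
  define T where "T s = (\<lambda>c x. r b x * s c x - s b x * r c x)" for s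
  have T: "(\<Sum>c\<in>B. T s c q * v c) = r b q * (\<Sum>c\<in>insert b B. s c q * v' c) - s b q * (\<Sum>c\<in>insert b B. r c q * v' c)"
    if "\<And>c. c \<in> B \<Longrightarrow> v' c = v c" for s q v v'
  proof -
    have "(\<Sum>c\<in>B. s c q * v' c) = (\<Sum>c\<in>B. s c q * v c)" for s :: "'b \<Rightarrow> ('i \<Rightarrow> complex) \<Rightarrow> complex"
      by (rule sum.cong) (auto simp: that)
    then show ?thesis using insert.hyps
      by (simp add: T_def algebra_simps sum_subtractf sum_distrib_left)
  qed
  have "\<exists>\<delta>. pfun I \<delta> \<and> \<delta> p \<noteq> 0 \<and>
    (\<forall>q v. \<delta> q \<noteq> 0 \<longrightarrow> (\<forall>r\<in>T ` R. (\<Sum>b\<in>B. r b q * v b) = 0) \<longrightarrow> (\<forall>b\<in>B. v b = 0))"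
  proof (rule insert.IH)
    show "pfun I (s c)" if "s \<in> T ` R" for s c
      using that insert.prems(1) r(1) unfolding T_def
      by (auto intro!: pfun_diff pfun.mult)
    show "v c = 0" if v: "\<forall>s\<in>T ` R. (\<Sum>b\<in>B. s b p * v b) = 0" and c: "c \<in> B" for v c
    proof -
      define v' where "v' c = (if c = b then - (\<Sum>c\<in>B. r c p * v c) / r b p else v c)" for c
      have vv: "v' c = v c" if "c \<in> B" for c using that insert.hyps by (auto simp: v'_def)
      have r0: "(\<Sum>c\<in>insert b B. r c p * v' c) = 0"
      proof -
        have "(\<Sum>c\<in>B. r c p * v' c) = (\<Sum>c\<in>B. r c p * v c)" by (rule sum.cong) (auto simp: vv)
        then show ?thesis using insert.hyps r by (simp add: v'_def)
      qed
      have "(\<Sum>c\<in>insert b B. s c p * v' c) = 0" if "s \<in> R" for s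
        using T[of v' v s p, OF vv] v that r r0 by simp
      then have "v' c = 0" using insert.prems(2)[of v' c] c by blast
      then show ?thesis using vv[OF c] by simp
    qed
  qed
  then obtain \<delta> where \<delta>: "pfun I \<delta>" "\<delta> p \<noteq> 0"
    "\<And>q v. \<delta> q \<noteq> 0 \<Longrightarrow> (\<forall>r\<in>T ` R. (\<Sum>b\<in>B. r b q * v b) = 0) \<Longrightarrow> (\<forall>b\<in>B. v b = 0)" by blast
  show ?case
  proof (intro exI[of _ "\<lambda>x. r b x * \<delta> x"] conjI allI impI)
    show "pfun I (\<lambda>x. r b x * \<delta> x)" using insert.prems(1) r(1) \<delta>(1) by (intro pfun.mult)
    show "r b p * \<delta> p \<noteq> 0" using r \<delta> by simp
    fix q v assume q: "r b q * \<delta> q \<noteq> 0" and v: "\<forall>r\<in>R. (\<Sum>b\<in>insert b B. r b q * v b) = 0"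
    have B: "\<forall>c\<in>B. v c = 0"
      by (rule \<delta>(3)[of q v]) (use q v r(1) T[of v v _ q] in auto)
    then have "(\<Sum>c\<in>insert b B. r c q * v c) = r b q * v b"
      using insert.hyps by (simp add: sum.neutral)
    then have "v b = 0" using v r(1) q by auto
    with B show "\<forall>c\<in>insert b B. v c = 0" by simp
  qed
qed

lemma dim_graph_subspace:
  fixes M :: "'i \<Rightarrow> 'i \<Rightarrow> complex"
  assumes "finite I" "A \<subseteq> I"
  shows "vector_space.dim fun_scale {v \<in> coord_space I. \<forall>a\<in>A. v a = (\<Sum>b\<in>I - A. M a b * v b)} = card (I - A)"
proof -
  let ?T = "{v \<in> coord_space I. \<forall>a\<in>A. v a = (\<Sum>b\<in>I - A. M a b * v b)}"
  interpret vs: vector_space "fun_scale :: complex \<Rightarrow> ('i \<Rightarrow> complex) \<Rightarrow> _"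
    by (rule vector_space_fun_scale)
  \<comment> \<open>The basis vector of the free coordinate \<open>b\<close>: the other free
    coordinates are zero, and those in \<open>A\<close> are filled in from the graph.\<close>
  define e where "e b = (\<lambda>i. if i = b then 1 else if i \<in> A then M i b else 0)" for b
  let ?S = "I - A"
  have fS: "finite ?S" using assms by simp
  have ap: "sum F X i = (\<Sum>b\<in>X. F b i)" for F :: "'i \<Rightarrow> 'i \<Rightarrow> complex" and X i
    by (induction X rule: infinite_finite_induct) auto
  have eS: "e b c = (if c = b then 1 else 0)" if "b \<in> ?S" "c \<in> ?S" for b c
    using that by (auto simp: e_def)
  have inj: "inj_on e ?S"
  proof (rule inj_onI)
    fix b c assume "b \<in> ?S" "c \<in> ?S" "e b = e c"
    then show "b = c" using eS[of b b] eS[of c b] by (auto split: if_splits)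
  qed
  have "vs.independent (e ` ?S)"
  proof (rule vs.independent_if_scalars_zero)
    show "finite (e ` ?S)" using fS by simp
    fix f x assume s: "(\<Sum>x\<in>e ` ?S. fun_scale (f x) x) = 0" and "x \<in> e ` ?S"
    then obtain b where b: "b \<in> ?S" "x = e b" by blast
    have "(\<Sum>c\<in>?S. fun_scale (f (e c)) (e c)) = 0"
      using s by (simp add: sum.reindex[OF inj])
    then have "(\<Sum>c\<in>?S. fun_scale (f (e c)) (e c)) b = 0 b" by (rule fun_cong)
    then have "(\<Sum>c\<in>?S. f (e c) * e c b) = 0" by (simp only: ap zero_fun_apply)
    moreover have "(\<Sum>c\<in>?S. f (e c) * e c b) = (\<Sum>c\<in>?S. if c = b then f (e c) else 0)"
      by (rule sum.cong) (use b eS in auto)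
    ultimately show "f x = 0" using b fS by simp
  qed
  moreover have "vs.span (e ` ?S) = vs.span ?T"
  proof (rule vs.span_eq[THEN iffD2], intro conjI subsetI)
    fix x assume "x \<in> e ` ?S"
    then obtain b where b: "b \<in> ?S" "x = e b" by blast
    have "e b \<in> ?T"
    proof (intro CollectI conjI ballI)
      show "e b \<in> coord_space I" using b assms by (auto simp: e_def coord_space_def)
      fix a assume a: "a \<in> A"
      have "(\<Sum>c\<in>?S. M a c * e b c) = (\<Sum>c\<in>?S. if c = b then M a c else 0)"
        by (rule sum.cong) (use b eS in auto)
      then show "e b a = (\<Sum>c\<in>?S. M a c * e b c)" using a b fS by (auto simp: e_def)
    qed
    then show "x \<in> vs.span ?T" unfolding b(2) by (rule vs.span_base)
  next
    fix v assume v: "v \<in> ?T"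
    have "v = (\<Sum>b\<in>?S. fun_scale (v b) (e b))"
    proof
      fix i
      show "v i = (\<Sum>b\<in>?S. fun_scale (v b) (e b)) i"
      proof (cases "i \<in> A")
        case True
        then have "(\<Sum>b\<in>?S. v b * e b i) = (\<Sum>b\<in>?S. M i b * v b)"
          by (intro sum.cong) (auto simp: e_def)
        then show ?thesis using v True by (simp add: ap)
      next
        case False
        then have "(\<Sum>b\<in>?S. v b * e b i) = (\<Sum>b\<in>?S. if b = i then v b else 0)"
          by (intro sum.cong) (auto simp: e_def)
        then show ?thesis using v False fS by (auto simp: ap coord_space_def)
      qed
    qed
    also have "\<dots> \<in> vs.span (e ` ?S)"
      by (intro vs.span_sum vs.span_scale vs.span_base) auto
    finally show "v \<in> vs.span (e ` ?S)" .
  qed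
  ultimately have "vs.dim ?T = card (e ` ?S)" by (intro vs.dim_eq_card) auto
  then show ?thesis by (simp add: card_image[OF inj])
qed

lemma partial_cmult: "pfun I f \<Longrightarrow> partial i (\<lambda>x. c * f x) x = c * partial i f x"
  by (simp add: partial_mult[OF pfun.const])

lemma partial_sum:
  assumes "\<And>a. a \<in> A \<Longrightarrow> pfun B (f a)"
  shows "partial i (\<lambda>x. \<Sum>a\<in>A. f a x) x = (\<Sum>a\<in>A. partial i (f a) x)"
  using assms
proof (induction A rule: infinite_finite_induct)
  case (insert a A)
  then have "partial i (\<lambda>x. f a x + (\<Sum>a\<in>A. f a x)) x = partial i (f a) x + partial i (\<lambda>x. \<Sum>a\<in>A. f a x) x"
    by (intro partial_add[of B _ B] pfun_sum) auto
  with insert show ?case by simp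
qed auto

text \<open>Only gradients at \<open>p\<close> matter, so \<open>\<L>\<close> may be as large as a
  whole vanishing ideal: a largest \<open>A\<close> for which members of \<open>\<L>\<close> have
  the identity matrix as Jacobian on \<open>A\<close> already determines all gradients.\<close>

lemma gradient_echelon:
  fixes \<L> :: "(('i \<Rightarrow> complex) \<Rightarrow> complex) set"
  assumes fin: "finite I" and pf: "\<And>f. f \<in> \<L> \<Longrightarrow> pfun I f"
    and zero: "(\<lambda>x. 0) \<in> \<L>" and lin: "\<And>f g c. f \<in> \<L> \<Longrightarrow> g \<in> \<L> \<Longrightarrow> (\<lambda>x. f x + c * g x) \<in> \<L>"
  shows "\<exists>A F. A \<subseteq> I \<and> (\<forall>a\<in>A. F a \<in> \<L>) \<and>
    (\<forall>a\<in>A. \<forall>b\<in>A. partial b (F a) p = (if a = b then 1 else 0)) \<and>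
    (\<forall>g\<in>\<L>. \<forall>b\<in>I. partial b g p = (\<Sum>a\<in>A. partial a g p * partial b (F a) p))"
proof -
  define N where "N A F \<longleftrightarrow> A \<subseteq> I \<and> (\<forall>a\<in>A. F a \<in> \<L>) \<and>
    (\<forall>a\<in>A. \<forall>b\<in>A. partial b (F a) p = (if a = b then 1 else 0))" for A F
  have "N {} (\<lambda>_ _. 0)" by (simp add: N_def)
  then have "\<exists>A. (\<exists>F. N A F) \<and> (\<forall>B. (\<exists>F. N B F) \<longrightarrow> card B \<le> card A)"
    by (intro ex_has_greatest_nat[where b = "Suc (card I)" and k = "{}"])
      (auto simp: N_def less_Suc_eq_le intro: card_mono[OF fin])
  then obtain A F where AF: "N A F" and max: "\<And>B G. N B G \<Longrightarrow> card B \<le> card A" by blast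
  have finA: "finite A" using AF fin finite_subset by (auto simp: N_def)
  have comb: "(\<lambda>x. g x + (\<Sum>a\<in>B. c a * F a x)) \<in> \<L>" if "g \<in> \<L>" "finite B" "B \<subseteq> A" for g c B
    using that(2,3)
  proof (induction B)
    case empty
    then show ?case using that(1) by simp
  next
    case (insert a B)
    then have "(\<lambda>x. (g x + (\<Sum>a\<in>B. c a * F a x)) + c a * F a x) \<in> \<L>"
      using AF by (intro lin) (auto simp: N_def)
    moreover have "(\<lambda>x. (g x + (\<Sum>a\<in>B. c a * F a x)) + c a * F a x) = (\<lambda>x. g x + (\<Sum>a\<in>insert a B. c a * F a x))"
      using insert by (auto simp: fun_eq_iff algebra_simps)
    ultimately show ?case by simp
  qed
  have "partial b g p = (\<Sum>a\<in>A. partial a g p * partial b (F a) p)" if g: "g \<in> \<L>" and b: "b \<in> I" for g b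
  proof (rule ccontr)
    assume neg: "partial b g p \<noteq> (\<Sum>a\<in>A. partial a g p * partial b (F a) p)"
    define g' where "g' = (\<lambda>x. g x + (\<Sum>a\<in>A. - partial a g p * F a x))"
    have g': "g' \<in> \<L>" unfolding g'_def using g finA by (intro comb) auto
    have FL: "pfun I (F a)" if "a \<in> A" for a using AF that pf by (auto simp: N_def)
    have dg': "partial c g' p = partial c g p - (\<Sum>a\<in>A. partial a g p * partial c (F a) p)" for c
    proof -
      have pfs: "pfun I (\<lambda>x. - partial a g p * F a x)" if "a \<in> A" for a
        by (rule pfun.mult[OF pfun.const FL[OF that]])
      have "partial c g' p = partial c g p + (\<Sum>a\<in>A. partial c (\<lambda>x. - partial a g p * F a x) p)"
        unfolding g'_def by (subst partial_add[OF pf[OF g] pfun_sum[OF pfs]], assumption)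
          (subst partial_sum[OF pfs], auto)
      also have "(\<Sum>a\<in>A. partial c (\<lambda>x. - partial a g p * F a x) p) = (\<Sum>a\<in>A. - partial a g p * partial c (F a) p)"
        by (rule sum.cong[OF refl]) (rule partial_cmult[OF FL])
      finally show ?thesis by (simp add: sum_negf)
    qed
    have zeroA: "partial c g' p = 0" if "c \<in> A" for c
    proof -
      have "(\<Sum>a\<in>A. partial a g p * partial c (F a) p) = (\<Sum>a\<in>A. if a = c then partial a g p else 0)"
        by (rule sum.cong) (use AF that in \<open>auto simp: N_def\<close>)
      then show ?thesis using that finA by (simp add: dg')
    qed
    let ?c = "partial b g' p"
    have c: "?c \<noteq> 0" using neg by (simp add: dg')
    then have bA: "b \<notin> A" using zeroA by blast
    define H where "H = (\<lambda>x. 0 + (1 / ?c) * g' x)"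
    have HL: "H \<in> \<L>" unfolding H_def by (rule lin[OF zero g'])
    have dH: "partial d H p = partial d g' p / ?c" for d
      unfolding H_def using partial_cmult[OF pf[OF g'], of d "1 / ?c"] by simp
    \<comment> \<open>A pivot at \<open>b\<close>: the gradient of \<open>H\<close> is
      \<open>0\<close> on \<open>A\<close> and \<open>1\<close> at \<open>b\<close>, and each
      \<open>F a\<close> is corrected by a multiple of \<open>H\<close>. This would enlarge
      \<open>A\<close>.\<close>
    define G where "G a = (if a = b then H else (\<lambda>x. F a x + (- partial b (F a) p) * H x))" for a
    have dG: "partial d (G a) p = (if a = b then partial d H p else partial d (F a) p - partial b (F a) p * partial d H p)"
      if "a \<in> insert b A" for a d
    proof (cases "a = b")
      case False
      then have "a \<in> A" using that by simp
      have "partial d (\<lambda>x. F a x + (- partial b (F a) p) * H x) p = partial d (F a) p + (- partial b (F a) p) * partial d H p"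
        by (subst partial_add[OF FL[OF \<open>a \<in> A\<close>] pfun.mult[OF pfun.const pf[OF HL]]])
          (subst partial_cmult[OF pf[OF HL]], simp)
      then show ?thesis using False by (simp add: G_def)
    qed (simp add: G_def)
    have "N (insert b A) G"
      unfolding N_def
    proof (intro conjI ballI)
      show "insert b A \<subseteq> I" using b AF by (auto simp: N_def)
      show "G a \<in> \<L>" if "a \<in> insert b A" for a
      proof (cases "a = b")
        case False
        then have "F a \<in> \<L>" using that AF by (auto simp: N_def)
        then show ?thesis unfolding G_def using False lin[OF _ HL, of "F a" "- partial b (F a) p"] by simp
      qed (simp add: G_def HL)
      show "partial d (G a) p = (if a = d then 1 else 0)" if "a \<in> insert b A" "d \<in> insert b A" for a d
        using that AF bA c zeroA by (auto simp: dG dH N_def)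
    qed
    then have "card (insert b A) \<le> card A" by (rule max)
    then show False using bA finA by simp
  qed
  then show ?thesis using AF unfolding N_def by blast
qed

definition independent_gradients ::
    "'i set \<Rightarrow> 'l set \<Rightarrow> ('l \<Rightarrow> ('i \<Rightarrow> complex) \<Rightarrow> complex) \<Rightarrow> ('i \<Rightarrow> complex) \<Rightarrow> bool" where
  "independent_gradients I L G p \<longleftrightarrow>
     (\<forall>\<alpha>. (\<forall>b\<in>I. (\<Sum>l\<in>L. \<alpha> l * partial b (G l) p) = 0) \<longrightarrow> (\<forall>l\<in>L. \<alpha> l = 0))"

lemma independent_gradients_card_le:
  assumes "finite A" "finite L" "independent_gradients I L G p"
    and "\<And>l b. l \<in> L \<Longrightarrow> b \<in> I \<Longrightarrow> partial b (G l) p = (\<Sum>a\<in>A. partial a (G l) p * partial b (F a) p)"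
  shows "card L \<le> card A"
proof (rule ccontr)
  assume "\<not> ?thesis"
  then obtain \<alpha> where \<alpha>: "\<exists>l\<in>L. \<alpha> l \<noteq> 0" "\<forall>a\<in>A. (\<Sum>l\<in>L. \<alpha> l * partial a (G l) p) = 0"
    using homogeneous_system[OF assms(1,2), of "\<lambda>l a. partial a (G l) p"] by auto
  have "(\<Sum>l\<in>L. \<alpha> l * partial b (G l) p) = 0" if "b \<in> I" for b
  proof -
    have "(\<Sum>l\<in>L. \<alpha> l * partial b (G l) p) = (\<Sum>l\<in>L. \<Sum>a\<in>A. \<alpha> l * partial a (G l) p * partial b (F a) p)"
      by (rule sum.cong) (use assms(4)[OF _ that] in \<open>simp_all add: sum_distrib_left mult.assoc\<close>)
    also have "\<dots> = (\<Sum>a\<in>A. (\<Sum>l\<in>L. \<alpha> l * partial a (G l) p) * partial b (F a) p)"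
      by (subst sum.swap) (simp add: sum_distrib_right)
    finally show ?thesis using \<alpha>(2) by simp
  qed
  then show False using assms(3) \<alpha>(1) unfolding independent_gradients_def by blast
qed

section \<open>Projective varieties and their dimension\<close>

lemma proj_space_rep:
  assumes "x \<in> proj_space I" "p \<in> x"
  shows "p \<in> coord_space I" "\<exists>i\<in>I. p i \<noteq> 0" "x = proj_pt p"
    "q \<in> x \<longleftrightarrow> (\<exists>c. c \<noteq> 0 \<and> q = (\<lambda>i. c * p i))"
proof -
  obtain r where r: "x = proj_pt r" "r \<in> coord_space I" "\<exists>i. r i \<noteq> 0"
    using assms(1) by (auto simp: proj_space_def)
  then obtain c where c: "c \<noteq> 0" "p = (\<lambda>i. c * r i)" using assms(2) by (auto simp: proj_pt_def)
  show "p \<in> coord_space I" using c r by (auto simp: coord_space_def)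
  show "\<exists>i\<in>I. p i \<noteq> 0" using c r by (auto simp: coord_space_def)
  show eq: "x = proj_pt p"
  proof -
    have "\<exists>e. (\<lambda>i. d * r i) = (\<lambda>i. e * p i) \<and> e \<noteq> 0" if "d \<noteq> 0" for d
      using c that by (intro exI[of _ "d / c"]) auto
    moreover have "\<exists>e. (\<lambda>i. d * p i) = (\<lambda>i. e * r i) \<and> e \<noteq> 0" if "d \<noteq> 0" for d
      using c that by (intro exI[of _ "d * c"]) (auto simp: mult.assoc)
    ultimately show ?thesis unfolding r(1) proj_pt_def by blast
  qed
  show "q \<in> x \<longleftrightarrow> (\<exists>c. c \<noteq> 0 \<and> q = (\<lambda>i. c * p i))"
    unfolding eq proj_pt_def by auto
qed

lemma proj_pt_self: "p \<in> proj_pt p"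
  unfolding proj_pt_def by (auto intro: exI[of _ 1])

lemma proj_pt_in_proj_space: "p \<in> coord_space I \<Longrightarrow> p i \<noteq> 0 \<Longrightarrow> proj_pt p \<in> proj_space I"
  unfolding proj_space_def by blast

lemma proj_space_nonempty: "x \<in> proj_space I \<Longrightarrow> \<exists>p. p \<in> x"
  using proj_pt_self unfolding proj_space_def by blast

lemma proj_space_scale: "x \<in> proj_space I \<Longrightarrow> p \<in> x \<Longrightarrow> c \<noteq> 0 \<Longrightarrow> (\<lambda>i. c * p i) \<in> x"
  using proj_space_rep(4) by blast

lemma hfun_zero_on_class:
  assumes "hfun I D f" "x \<in> proj_space I" "p \<in> x" "f p = 0" "q \<in> x"
  shows "f q = 0"
proof -
  obtain c where "q = (\<lambda>i. c * p i)" using assms proj_space_rep(4) by blast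
  then show ?thesis using hfun_scale[OF assms(1), of c p] assms(4) by simp
qed

section \<open>The Zariski topology of projective space in terms of polynomial functions\<close>

lemma topspace_zariski_proj [simp]: "topspace (zariski_proj I) = proj_space I"
proof
  show "topspace (zariski_proj I) \<subseteq> proj_space I"
    unfolding zariski_proj_def topology_generated_by_topspace by auto
  obtain F :: "('a, complex) mpoly" where F: "F \<in> polys_in I" "homogeneous F" "mpoly_eval F = (\<lambda>x. 1)"
    using hfun_imp_mpoly[OF hfun.const[of I 1]] by blast
  then have "proj_space I \<in> {{x \<in> proj_space I. \<forall>p\<in>x. mpoly_eval f p \<noteq> 0} |f. f \<in> polys_in I \<and> homogeneous f}"
    by (intro CollectI exI[of _ F]) auto
  then show "proj_space I \<subseteq> topspace (zariski_proj I)"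
    unfolding zariski_proj_def topology_generated_by_topspace by blast
qed

lemma openin_hfun:
  assumes "hfun I D f"
  shows "openin (zariski_proj I) {x \<in> proj_space I. \<forall>p\<in>x. f p \<noteq> 0}"
proof -
  obtain F where "F \<in> polys_in I" "homogeneous F" "mpoly_eval F = f"
    using hfun_imp_mpoly[OF assms] by blast
  then show ?thesis unfolding zariski_proj_def
    by (intro topology_generated_by_Basis) auto
qed

lemma closedin_hfun:
  assumes "hfun I D f"
  shows "closedin (zariski_proj I) {x \<in> proj_space I. \<forall>p\<in>x. f p = 0}"
proof -
  have "{x \<in> proj_space I. \<forall>p\<in>x. f p = 0} = proj_space I - {x \<in> proj_space I. \<forall>p\<in>x. f p \<noteq> 0}"
    using hfun_zero_on_class[OF assms] proj_space_nonempty by blast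
  then show ?thesis
    using openin_hfun[OF assms] by (simp add: closedin_def double_diff)
qed

lemma pfun_components:
  assumes "pfun I (f :: ('i \<Rightarrow> complex) \<Rightarrow> complex)"
  shows "\<exists>N C. (\<forall>k. hfun I k (C k)) \<and> (\<forall>c p. f (\<lambda>i. c * p i) = (\<Sum>k\<le>N. c ^ k * C k p))"
proof -
  obtain P where P: "\<forall>D. hfun I D (coeff P D)" "f = poly P 1"
    using pfun_homogeneous_components[OF assms] by blast
  have ap: "sum F A x = (\<Sum>i\<in>A. F i x)" for F :: "nat \<Rightarrow> ('i \<Rightarrow> complex) \<Rightarrow> complex" and A x
    by (induction A rule: infinite_finite_induct) auto
  have "f (\<lambda>i. c * p i) = (\<Sum>k\<le>degree P. c ^ k * coeff P k p)" for c p
    unfolding P(2) poly_altdef ap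
    by (rule sum.cong) (simp_all add: hfun_scale[OF P(1)[rule_format]])
  then show ?thesis using P(1) by blast
qed

lemma poly_vanishing_off_0:
  fixes q :: "complex poly"
  assumes "\<And>c. c \<noteq> 0 \<Longrightarrow> poly q c = 0"
  shows "q = 0"
proof (rule ccontr)
  assume "q \<noteq> 0"
  then have "finite {c. poly q c = 0}" by (rule poly_roots_finite)
  then have "finite (insert 0 {c. poly q c = 0})" by simp
  moreover have "insert 0 {c. poly q c = 0} = UNIV" using assms by auto
  ultimately show False using infinite_UNIV_char_0 by metis
qed

lemma pfun_on_class:
  assumes "pfun I (f :: ('i \<Rightarrow> complex) \<Rightarrow> complex)"
  shows "\<exists>q. \<forall>c. f (\<lambda>i. c * p i) = poly q c"
proof -
  obtain N C where "\<forall>c p. f (\<lambda>i. c * p i) = (\<Sum>k\<le>N. c ^ k * C k p)"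
    using pfun_components[OF assms] by blast
  then show ?thesis
    by (intro exI[of _ "\<Sum>k\<le>N. monom (C k p) k"]) (auto simp: poly_sum poly_monom mult.commute)
qed

text \<open>Along the line through \<open>p\<close> the values of \<open>f\<close> form a polynomial
  in \<open>c\<close> whose coefficients are the components at \<open>p\<close>; it vanishes off
  \<open>0\<close>, hence identically.\<close>

lemma component_zero_on_class:
  assumes C: "\<forall>c p. f (\<lambda>i. c * p i) = (\<Sum>k\<le>N. c ^ k * C k p)"
    and x: "x \<in> proj_space I" "\<forall>p\<in>x. f p = 0" "p \<in> x" and k: "k \<le> N"
  shows "C k p = (0::complex)"
proof -
  let ?q = "\<Sum>k\<le>N. monom (C k p) k"
  have "poly ?q c = 0" if "c \<noteq> 0" for c
  proof -
    have "f (\<lambda>i. c * p i) = 0" using x(2) proj_space_scale[OF x(1,3) that] by blast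
    then show ?thesis using C by (simp add: poly_sum poly_monom mult.commute)
  qed
  then have "?q = 0" by (rule poly_vanishing_off_0)
  then have "coeff ?q k = 0" by (simp only: coeff_0)
  then show ?thesis using k by (simp add: coeff_sum)
qed

text \<open>A polynomial vanishes on a whole class exactly if all its homogeneous components do, so
  inhomogeneous polynomials define no new closed sets.\<close>

lemma closedin_pfun:
  assumes "pfun I f"
  shows "closedin (zariski_proj I) {x \<in> proj_space I. \<forall>p\<in>x. f p = 0}"
proof -
  obtain N C where C: "\<forall>k. hfun I k (C k)" "\<forall>c p. f (\<lambda>i. c * p i) = (\<Sum>k\<le>N. c ^ k * C k p)"
    using pfun_components[OF assms] by blast
  have "{x \<in> proj_space I. \<forall>p\<in>x. f p = 0} = (\<Inter>k\<in>{..N}. {x \<in> proj_space I. \<forall>p\<in>x. C k p = 0})"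
    (is "?L = ?R")
  proof
    show "?L \<subseteq> ?R" using component_zero_on_class[OF C(2)] by blast
    have "f p = 0" if "\<forall>k\<le>N. C k p = 0" for p
      using C(2)[rule_format, of 1 p] that by simp
    then show "?R \<subseteq> ?L" by auto
  qed
  then show ?thesis using closedin_hfun[OF C(1)[rule_format]] by (auto intro!: closedin_INT)
qed

text \<open>Unlike \<open>vanishing_ideal\<close> this admits inhomogeneous functions, so that it is
  an ideal in the sense of \<open>prime_pfun\<close>.\<close>

definition vanishing_on :: "'i set \<Rightarrow> ('i \<Rightarrow> complex) set set \<Rightarrow> (('i \<Rightarrow> complex) \<Rightarrow> complex) set" where
  "vanishing_on I Z = {f. pfun I f \<and> (\<forall>x\<in>Z. \<forall>p\<in>x. f p = 0)}"

lemma not_vanishing_on: "pfun I f \<Longrightarrow> f \<notin> vanishing_on I Z \<Longrightarrow> \<exists>z\<in>Z. \<exists>q\<in>z. f q \<noteq> 0"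
  by (simp add: vanishing_on_def)

text \<open>On a single class both factors are univariate polynomials in the scalar, so one of them
  vanishes on all of it. The set is therefore covered by two closed sets, and irreducibility selects
  one.\<close>

lemma prime_vanishing_on:
  assumes "finite I" "irreducible_in (zariski_proj I) Z"
  shows "prime_pfun I (vanishing_on I Z)"
proof
  have Z: "Z \<subseteq> proj_space I" "Z \<noteq> {}" using assms(2) by (auto simp: irreducible_in_def)
  show "1 \<notin> vanishing_on I Z"
    using Z proj_space_nonempty by (fastforce simp: vanishing_on_def)
  fix f g assume f: "pfun I f" and g: "pfun I g" and fg: "f * g \<in> vanishing_on I Z"
  let ?A = "\<lambda>f. {x \<in> proj_space I. \<forall>p\<in>x. f p = 0}"
  have "x \<in> ?A f \<union> ?A g" if "x \<in> Z" for x
  proof -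
    have x: "x \<in> proj_space I" using that Z by blast
    then obtain p where p: "p \<in> x" using proj_space_nonempty by blast
    obtain a b where ab: "\<forall>c. f (\<lambda>i. c * p i) = poly a c" "\<forall>c. g (\<lambda>i. c * p i) = poly b c"
      using pfun_on_class f g by metis
    have "poly (a * b) c = 0" if "c \<noteq> 0" for c
    proof -
      have "(f * g) (\<lambda>i. c * p i) = 0"
        using fg proj_space_scale[OF x p that] \<open>x \<in> Z\<close> unfolding vanishing_on_def by blast
      then show ?thesis using ab by simp
    qed
    then have "a * b = 0" by (rule poly_vanishing_off_0)
    then consider "a = 0" | "b = 0" by auto
    then show ?thesis
    proof cases
      case 1
      have "f q = 0" if "q \<in> x" for q using ab(1) 1 that proj_space_rep(4)[OF x p] by auto
      then show ?thesis using x by blast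
    next
      case 2
      have "g q = 0" if "q \<in> x" for q using ab(2) 2 that proj_space_rep(4)[OF x p] by auto
      then show ?thesis using x by blast
    qed
  qed
  then have "Z \<subseteq> ?A f \<or> Z \<subseteq> ?A g"
    using assms(2) closedin_pfun[OF f] closedin_pfun[OF g] unfolding irreducible_in_def by blast
  then show "f \<in> vanishing_on I Z \<or> g \<in> vanishing_on I Z"
    using f g unfolding vanishing_on_def by blast
qed (use assms(1) in \<open>auto simp: vanishing_on_def intro: pfun_0 pfun_plus pfun_times\<close>)

text \<open>Principal open sets are closed under intersection, since homogeneous functions can be
  multiplied; the generating family is thus a basis and not only a subbasis.\<close>

lemma zariski_basic_neighbourhood:
  assumes "openin (zariski_proj I) U" "x \<in> U"
  shows "\<exists>D f. hfun I D f \<and> (\<forall>p\<in>x. f p \<noteq> 0) \<and> (\<forall>y\<in>proj_space I - U. \<forall>p\<in>y. f p = 0)"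
proof -
  let ?B = "{{x \<in> proj_space I. \<forall>p\<in>x. mpoly_eval f p \<noteq> 0} |f. f \<in> polys_in I \<and> homogeneous f}"
  have "generate_topology_on ?B U"
    using assms(1) unfolding zariski_proj_def openin_topology_generated_by_iff .
  then show ?thesis using assms(2)
  proof (induction rule: generate_topology_on.induct)
    case Empty
    then show ?case by simp
  next
    case (Int a b)
    have "x \<in> a" "x \<in> b" using Int.prems by simp_all
    from Int.IH(1)[OF this(1)] Int.IH(2)[OF this(2)] obtain D f D' g where
      f: "hfun I D f" "\<forall>p\<in>x. f p \<noteq> 0" "\<forall>y\<in>proj_space I - a. \<forall>p\<in>y. f p = 0" and
      g: "hfun I D' g" "\<forall>p\<in>x. g p \<noteq> 0" "\<forall>y\<in>proj_space I - b. \<forall>p\<in>y. g p = 0"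
      by (elim exE conjE)
    show ?case
      using f(2,3) g(2,3)
      by (intro exI[of _ "D + D'"] exI[of _ "\<lambda>p. f p * g p"] conjI hfun.mult f(1) g(1)) auto
  next
    case (UN K)
    then obtain k where k: "k \<in> K" "x \<in> k" by blast
    from UN.IH[OF this] obtain D f where f: "hfun I D f" "\<forall>p\<in>x. f p \<noteq> 0" "\<forall>y\<in>proj_space I - k. \<forall>p\<in>y. f p = 0"
      by (elim exE conjE)
    show ?case using f k by (intro exI[of _ D] exI[of _ f]) auto
  next
    case (Basis s)
    then obtain F where F: "F \<in> polys_in I" "homogeneous F" "s = {x \<in> proj_space I. \<forall>p\<in>x. mpoly_eval F p \<noteq> 0}"
      by blast
    then obtain D where D: "hfun I D (mpoly_eval F)" using mpoly_imp_hfun by blast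
    have "mpoly_eval F p = 0" if y: "y \<in> proj_space I - s" "p \<in> y" for y p
    proof -
      obtain q where "q \<in> y" "mpoly_eval F q = 0" using F(3) y(1) by blast
      then show ?thesis using hfun_zero_on_class[OF D, of y q p] y by simp
    qed
    moreover have "\<forall>p\<in>x. mpoly_eval F p \<noteq> 0" using Basis.prems F(3) by simp
    ultimately show ?case using D by (intro exI[of _ D] exI[of _ "mpoly_eval F"]) simp
  qed
qed

section \<open>Lengths of chains of irreducible closed sets\<close>

lemma vanishing_on_strict:
  assumes "closedin (zariski_proj I) Z" "Z \<subset> Z'" "Z' \<subseteq> proj_space I"
  shows "vanishing_on I Z' \<subset> vanishing_on I Z"
proof -
  obtain x where x: "x \<in> Z'" "x \<notin> Z" using assms by blast
  have Z: "openin (zariski_proj I) (proj_space I - Z)" "x \<in> proj_space I - Z"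
    using assms x by (auto simp: closedin_def)
  obtain D f where f: "hfun I D f" "\<forall>p\<in>x. f p \<noteq> 0" "\<forall>y\<in>proj_space I - (proj_space I - Z). \<forall>p\<in>y. f p = 0"
    using zariski_basic_neighbourhood[OF Z] by (elim exE conjE)
  have "\<forall>y\<in>Z. \<forall>p\<in>y. f p = 0" using f(3) assms(2,3) by blast
  then have "f \<in> vanishing_on I Z" using f hfun_imp_pfun by (auto simp: vanishing_on_def)
  moreover have "f \<notin> vanishing_on I Z'"
    using f(2) x(1) assms(3) proj_space_nonempty by (fastforce simp: vanishing_on_def)
  moreover have "vanishing_on I Z' \<subseteq> vanishing_on I Z"
    using assms(2) unfolding vanishing_on_def by blast
  ultimately show ?thesis by blast
qed

text \<open>A class is a full punctured line, along which a nonzero coordinate takes every nonzero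
  value. This first independent coordinate is the extra dimension of the cone.\<close>

lemma indep_singleton:
  assumes "finite I" "irreducible_in (zariski_proj I) Z"
  shows "\<exists>j\<in>I. prime_pfun.indep (vanishing_on I Z) {j}"
proof -
  interpret prime_pfun I "vanishing_on I Z" by (rule prime_vanishing_on) fact+
  obtain x where x: "x \<in> Z" "x \<in> proj_space I" using assms(2) by (auto simp: irreducible_in_def)
  then obtain p where p: "p \<in> x" using proj_space_nonempty by blast
  then obtain j where j: "j \<in> I" "p j \<noteq> 0" using proj_space_rep(2) x by blast
  have "f = 0" if f: "pfun {j} f" "f \<in> vanishing_on I Z" for f
  proof
    fix y
    obtain q where q: "\<forall>c. f (\<lambda>i. c * p i) = poly q c" using pfun_on_class[OF f(1)] by blast
    have "poly q c = 0" if "c \<noteq> 0" for c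
      using q f(2) x(1) proj_space_scale[OF x(2) p that] unfolding vanishing_on_def by force
    then have "q = 0" by (rule poly_vanishing_off_0)
    moreover have "f y = f (\<lambda>i. (y j / p j) * p i)"
      by (rule pfun_cong[OF f(1)]) (use j in auto)
    ultimately show "f y = 0 y" using q[rule_format, of "y j / p j"] by (simp only: poly_0 zero_fun_apply)
  qed
  then show ?thesis using j by (auto simp: indep_def)
qed

text \<open>Going up the chain the vanishing ideals shrink strictly, and each step frees one more
  coordinate by \<open>indep_extend\<close>.\<close>

lemma chain_indep:
  assumes "finite I" "irreducible_chain (zariski_proj I) V m Z" "k \<le> m"
  shows "\<exists>Y\<subseteq>I. card Y = Suc k \<and> prime_pfun.indep (vanishing_on I (Z k)) Y"
  using assms(3)
proof (induction k)
  case 0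
  have "irreducible_in (zariski_proj I) (Z 0)" using assms(2) by (auto simp: irreducible_chain_def)
  then obtain j where j: "j \<in> I" "prime_pfun.indep (vanishing_on I (Z 0)) {j}"
    using indep_singleton[OF assms(1)] by blast
  then show ?case by (intro exI[of _ "{j}"]) auto
next
  case (Suc k)
  then obtain Y where Y: "Y \<subseteq> I" "card Y = Suc k" "prime_pfun.indep (vanishing_on I (Z k)) Y" by auto
  have irr: "irreducible_in (zariski_proj I) (Z i)" "closedin (zariski_proj I) (Z i)" if "i \<le> m" for i
    using assms(2) that by (auto simp: irreducible_chain_def)
  have "Z k \<subset> Z (Suc k)" using assms(2) Suc.prems by (auto simp: irreducible_chain_def)
  moreover have "Z (Suc k) \<subseteq> proj_space I" using irr(1)[OF Suc.prems] by (auto simp: irreducible_in_def)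
  ultimately have "vanishing_on I (Z (Suc k)) \<subset> vanishing_on I (Z k)"
    using irr Suc.prems by (intro vanishing_on_strict) auto
  moreover have "prime_pfun I (vanishing_on I (Z (Suc k)))" "prime_pfun I (vanishing_on I (Z k))"
    using prime_vanishing_on[OF assms(1)] irr(1) Suc.prems by simp_all
  ultimately obtain u where u: "u \<in> I - Y" "prime_pfun.indep (vanishing_on I (Z (Suc k))) (insert u Y)"
    using indep_extend[OF _ _ _ Y(1,3)] by metis
  moreover have "finite Y" using Y(1) assms(1) finite_subset by blast
  ultimately show ?case using Y by (intro exI[of _ "insert u Y"]) auto
qed

text \<open>\<open>H\<close> is the product of the values \<open>v y y\<close>, so a single
  inequation makes all derivations nondegenerate at a point.\<close>

lemma (in prime_pfun) derivations_exist:
  assumes Y: "Y \<subseteq> J" "indep Y"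
  shows "\<exists>v H. pfun J H \<and> H \<notin> P \<and> (\<forall>q. H q \<noteq> 0 \<longrightarrow> (\<forall>y\<in>Y. v y y q \<noteq> 0)) \<and>
    (\<forall>y\<in>Y. (\<forall>z\<in>Y - {y}. v y z = 0) \<and> (\<forall>f\<in>P. der J (v y) f \<in> P))"
proof -
  have finY: "finite Y" using Y(1) finJ finite_subset by blast
  have "\<forall>y\<in>Y. \<exists>v. pfun J (v y) \<and> v y \<notin> P \<and> (\<forall>z\<in>Y - {y}. v z = 0) \<and> (\<forall>f\<in>P. der J v f \<in> P)"
  proof
    fix y assume "y \<in> Y"
    from derivation_exists[OF Y this] obtain v h where v: "pfun J h" "h \<notin> P" "\<forall>a. pfun J (v a)"
        "v y = h" "\<forall>z\<in>Y - {y}. v z = 0" "\<forall>f\<in>P. der J v f \<in> P"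
      by (elim exE conjE)
    show "\<exists>v. pfun J (v y) \<and> v y \<notin> P \<and> (\<forall>z\<in>Y - {y}. v z = 0) \<and> (\<forall>f\<in>P. der J v f \<in> P)"
      by (rule exI[of _ v], intro conjI; (unfold v(4))?; fact v)
  qed
  then have "\<exists>v. \<forall>y\<in>Y. pfun J (v y y) \<and> v y y \<notin> P \<and> (\<forall>z\<in>Y - {y}. v y z = 0) \<and> (\<forall>f\<in>P. der J (v y) f \<in> P)"
    by (rule bchoice)
  then obtain v where vh: "\<forall>y\<in>Y. pfun J (v y y) \<and> v y y \<notin> P \<and> (\<forall>z\<in>Y - {y}. v y z = 0) \<and> (\<forall>f\<in>P. der J (v y) f \<in> P)"
    by (elim exE)
  define h where "h y = v y y" for y
  have "\<exists>H. pfun J H \<and> H \<notin> P \<and> (\<forall>q. H q \<noteq> 0 \<longrightarrow> (\<forall>y\<in>W. h y q \<noteq> 0))" if "W \<subseteq> Y" for W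
  proof -
    have "finite W" using that finY finite_subset by blast
    then show ?thesis using that
    proof (induction W)
      case empty
      show ?case
      proof (rule exI[of _ 1], intro conjI allI impI ballI)
        show "pfun J 1" by (rule pfun_1)
        show "1 \<notin> P" by (rule one)
      qed simp
    next
      case (insert y W)
      then obtain H where H: "pfun J H" "H \<notin> P" "\<forall>q. H q \<noteq> 0 \<longrightarrow> (\<forall>y\<in>W. h y q \<noteq> 0)" by auto
      have hy: "pfun J (h y)" "h y \<notin> P" unfolding h_def using vh insert.prems by blast+
      have "(h y * H) q \<noteq> 0 \<longrightarrow> (\<forall>z\<in>insert y W. h z q \<noteq> 0)" for q using H(3) by auto
      then show ?case using notin_prod[OF hy(1) H(1) hy(2) H(2)] pfun_times[OF hy(1) H(1)] by blast
    qed
  qed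
  then obtain H where H: "pfun J H" "H \<notin> P" "\<forall>q. H q \<noteq> 0 \<longrightarrow> (\<forall>y\<in>Y. h y q \<noteq> 0)" by blast
  have "\<forall>y\<in>Y. (\<forall>z\<in>Y - {y}. v y z = 0) \<and> (\<forall>f\<in>P. der J (v y) f \<in> P)" using vh by blast
  with H show ?thesis unfolding h_def by blast
qed

text \<open>The chain yields \<open>m + 1\<close> independent coordinates and as many derivations
  preserving the ideal of \<open>Z m\<close>. At a suitable point of \<open>Z m\<close> their values
  are linearly independent vectors annihilated by the gradients of the \<open>F a\<close>, so at
  most \<open>card (I - A)\<close> of them fit.\<close>

lemma chain_length_bound:
  assumes I: "finite I" and ch: "irreducible_chain (zariski_proj I) V m Z"
    and x: "x \<in> Z m" "p \<in> x"
    and A: "A \<subseteq> I" and F: "\<And>a. a \<in> A \<Longrightarrow> F a \<in> vanishing_on I (Z m)"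
    and dF: "\<And>a b. a \<in> A \<Longrightarrow> b \<in> A \<Longrightarrow> partial b (F a) p = (if a = b then 1 else 0)"
  shows "Suc m \<le> card (I - A)"
proof -
  let ?P = "vanishing_on I (Z m)"
  have irr: "irreducible_in (zariski_proj I) (Z m)" using ch by (auto simp: irreducible_chain_def)
  interpret prime_pfun I ?P by (rule prime_vanishing_on[OF I irr])
  have finA: "finite A" using A I finite_subset by blast
  obtain Y where Y: "Y \<subseteq> I" "card Y = Suc m" "indep Y" using chain_indep[OF I ch] by blast
  have finY: "finite Y" using Y(1) I finite_subset by blast
  obtain v H where H: "pfun I H" "H \<notin> ?P" "\<forall>q. H q \<noteq> 0 \<longrightarrow> (\<forall>y\<in>Y. v y y q \<noteq> 0)"
    and vh: "\<forall>y\<in>Y. (\<forall>z\<in>Y - {y}. v y z = 0) \<and> (\<forall>f\<in>?P. der I (v y) f \<in> ?P)"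
    using derivations_exist[OF Y(1,3)] by (elim exE conjE)
  define h where "h y = v y y" for y
  let ?R = "(\<lambda>a b. partial b (F a)) ` A"
  have pF: "pfun I (F a)" if "a \<in> A" for a using F[OF that] by (auto simp: vanishing_on_def)
  have "\<exists>\<delta>. pfun I \<delta> \<and> \<delta> p \<noteq> 0 \<and>
    (\<forall>q v. \<delta> q \<noteq> 0 \<longrightarrow> (\<forall>r\<in>?R. (\<Sum>b\<in>A. r b q * v b) = 0) \<longrightarrow> (\<forall>b\<in>A. v b = 0))"
  proof (rule trivial_kernel_open[OF finA])
    show "pfun I (r b)" if "r \<in> ?R" for r b using that pF by (auto intro: pfun_partial)
    fix w a assume w: "\<forall>r\<in>?R. (\<Sum>b\<in>A. r b p * w b) = 0" and a: "a \<in> A"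
    have "(\<Sum>b\<in>A. partial b (F a) p * w b) = 0" using w a by auto
    moreover have "(\<Sum>b\<in>A. partial b (F a) p * w b) = (\<Sum>b\<in>A. if b = a then w b else 0)"
      by (rule sum.cong) (use dF[OF a] in auto)
    ultimately show "w a = 0" using a finA by simp
  qed
  then obtain \<delta> where \<delta>12: "pfun I \<delta>" "\<delta> p \<noteq> 0"
    and \<delta>0: "\<forall>q v. \<delta> q \<noteq> 0 \<longrightarrow> (\<forall>r\<in>?R. (\<Sum>b\<in>A. r b q * v b) = 0) \<longrightarrow> (\<forall>b\<in>A. v b = 0)"
    by (elim exE conjE)
  have "\<forall>b\<in>A. v b = 0" if "\<delta> q \<noteq> 0" "\<forall>a\<in>A. (\<Sum>b\<in>A. partial b (F a) q * v b) = 0" for q v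
    using \<delta>0[rule_format, of q v] that by auto
  note \<delta> = \<delta>12 this
  have "\<delta> \<notin> ?P" using \<delta>(2) x by (auto simp: vanishing_on_def)
  \<comment> \<open>The derivations may degenerate at \<open>p\<close> itself. As the ideal is
    prime, some point of \<open>Z m\<close> satisfies both open conditions: independent gradients
    and nonzero \<open>H\<close>.\<close>
  have "\<delta> * H \<notin> ?P" by (rule notin_prod[OF \<delta>(1) H(1) \<open>\<delta> \<notin> ?P\<close> H(2)])
  then obtain z q where zq: "z \<in> Z m" "q \<in> z" "(\<delta> * H) q \<noteq> 0"
    using not_vanishing_on[OF pfun_times[OF \<delta>(1) H(1)]] by blast
  then have q: "\<delta> q \<noteq> 0" "\<forall>y\<in>Y. h y q \<noteq> 0" using H(3) by (auto simp: h_def)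
  show ?thesis
  proof (rule ccontr)
    assume "\<not> ?thesis"
    then have "card (I - A) < card Y" using Y(2) by simp
    then obtain \<alpha> where \<alpha>: "\<exists>y\<in>Y. \<alpha> y \<noteq> 0" "\<forall>b\<in>I - A. (\<Sum>y\<in>Y. \<alpha> y * v y b q) = 0"
      using homogeneous_system[of "I - A" Y "\<lambda>y b. v y b q"] I finY by auto
    \<comment> \<open>A combination of the derivations at \<open>q\<close> without components
      outside \<open>A\<close>. The gradients of the \<open>F a\<close> force its components in
      \<open>A\<close> to vanish too, although its component at \<open>y\<close> is
      \<open>\<alpha> y * h y q\<close>, nonzero for some \<open>y\<close>.\<close>
    define w where "w b = (\<Sum>y\<in>Y. \<alpha> y * v y b q)" for b
    have "(\<Sum>b\<in>A. partial b (F a) q * w b) = 0" if a: "a \<in> A" for a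
    proof -
      have "(\<Sum>b\<in>A. partial b (F a) q * w b) = (\<Sum>b\<in>I. partial b (F a) q * w b)"
        by (rule sum.mono_neutral_left) (use I A \<alpha>(2) in \<open>auto simp: w_def\<close>)
      also have "\<dots> = (\<Sum>b\<in>I. \<Sum>y\<in>Y. \<alpha> y * (partial b (F a) q * v y b q))"
        unfolding w_def by (simp add: sum_distrib_left algebra_simps)
      also have "\<dots> = (\<Sum>y\<in>Y. \<alpha> y * der I (v y) (F a) q)"
        unfolding der_def by (subst sum.swap) (simp add: sum_distrib_left)
      also have "\<dots> = 0"
      proof (rule sum.neutral, intro ballI)
        fix y assume "y \<in> Y"
        then have "der I (v y) (F a) \<in> ?P" using vh F[OF a] by blast
        then show "\<alpha> y * der I (v y) (F a) q = 0" using zq by (auto simp: vanishing_on_def)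
      qed
      finally show ?thesis .
    qed
    then have "\<forall>b\<in>A. w b = 0" using \<delta>(3)[OF q(1), of w] by blast
    then have w0: "w b = 0" if "b \<in> I" for b using that \<alpha>(2) by (auto simp: w_def)
    obtain y where y: "y \<in> Y" "\<alpha> y \<noteq> 0" using \<alpha>(1) by blast
    have "w y = (\<Sum>z\<in>Y. if z = y then \<alpha> y * h y q else 0)"
      unfolding w_def
    proof (rule sum.cong)
      fix z assume "z \<in> Y"
      then have "z \<noteq> y \<Longrightarrow> v z y = 0" using vh y(1) by blast
      then show "\<alpha> z * v z y q = (if z = y then \<alpha> y * h y q else 0)" by (cases "z = y") (simp_all add: h_def)
    qed simp
    then have "w y = \<alpha> y * h y q" using y(1) finY by simp
    then show False using w0[of y] y q(2) Y(1) by auto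
  qed
qed

text \<open>In echelon form the tangent equations express the coordinates in \<open>A\<close>
  through the others, so the tangent space is a graph and its dimension is the number of free
  coordinates.\<close>

lemma cone_tangent_space_echelon:
  assumes I: "finite I" and V: "V \<subseteq> proj_space I"
  shows "\<exists>A F. A \<subseteq> I \<and> (\<forall>a\<in>A. F a \<in> vanishing_on I V) \<and>
    (\<forall>a\<in>A. \<forall>b\<in>A. partial b (F a) p = (if a = b then 1 else 0)) \<and>
    (\<forall>g\<in>vanishing_on I V. \<forall>b\<in>I. partial b g p = (\<Sum>a\<in>A. partial a g p * partial b (F a) p)) \<and>
    vector_space.dim fun_scale (cone_tangent_space I V p) = card (I - A)"
proof -
  have "\<exists>A F. A \<subseteq> I \<and> (\<forall>a\<in>A. F a \<in> vanishing_on I V) \<and>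
    (\<forall>a\<in>A. \<forall>b\<in>A. partial b (F a) p = (if a = b then 1 else 0)) \<and>
    (\<forall>g\<in>vanishing_on I V. \<forall>b\<in>I. partial b g p = (\<Sum>a\<in>A. partial a g p * partial b (F a) p))"
    by (rule gradient_echelon[OF I])
      (auto simp: vanishing_on_def intro!: pfun.const pfun.add pfun.mult)
  then obtain A F where AF0: "A \<subseteq> I" "\<forall>a\<in>A. F a \<in> vanishing_on I V"
    "\<forall>a\<in>A. \<forall>b\<in>A. partial b (F a) p = (if a = b then 1 else 0)"
    "\<forall>g\<in>vanishing_on I V. \<forall>b\<in>I. partial b g p = (\<Sum>a\<in>A. partial a g p * partial b (F a) p)"
    by (elim exE conjE)
  note AF = AF0(1) AF0(2,3,4)[rule_format]
  have finA: "finite A" using AF(1) I finite_subset by blast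
  have split: "(\<Sum>b\<in>I. partial b (F a) p * v b) = v a + (\<Sum>b\<in>I - A. partial b (F a) p * v b)"
    if a: "a \<in> A" for a and v :: "_ \<Rightarrow> complex"
  proof -
    have "(\<Sum>b\<in>A. partial b (F a) p * v b) = (\<Sum>b\<in>A. if b = a then v b else 0)"
      by (rule sum.cong) (use AF(3)[OF a] in auto)
    then show ?thesis using a finA AF(1) I by (simp add: sum.subset_diff[of A I] add.commute)
  qed
  have "cone_tangent_space I V p = {v \<in> coord_space I. \<forall>a\<in>A. v a = (\<Sum>b\<in>I - A. - partial b (F a) p * v b)}"
    (is "?L = ?R")
  proof (intro equalityI subsetI)
    fix v assume v: "v \<in> ?L"
    have "v a = (\<Sum>b\<in>I - A. - partial b (F a) p * v b)" if a: "a \<in> A" for a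
    proof -
      have pF: "pfun I (F a)" using AF(2)[OF a] by (auto simp: vanishing_on_def)
      \<comment> \<open>Tangent spaces are defined by homogeneous polynomials, while
        \<open>F a\<close> may be inhomogeneous. Its components vanish on \<open>V\<close> as well,
        and their tangent equations add up to that of \<open>F a\<close>.\<close>
      obtain N C where C: "\<forall>k. hfun I k (C k)" "\<forall>c p. F a (\<lambda>i. c * p i) = (\<Sum>k\<le>N. c ^ k * C k p)"
        using pfun_components[OF pF] by blast
      have "(\<Sum>b\<in>I. partial b (C k) p * v b) = 0" if k: "k \<le> N" for k
      proof -
        obtain f where f: "f \<in> polys_in I" "homogeneous f" "mpoly_eval f = C k"
          using hfun_imp_mpoly C(1) by blast
        have "C k q = 0" if "x \<in> V" "q \<in> x" for x q
          using component_zero_on_class[OF C(2) _ _ that(2) k] that V AF(2)[OF a]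
          unfolding vanishing_on_def by blast
        then have "f \<in> vanishing_ideal I V" using f by (auto simp: vanishing_ideal_def)
        then show ?thesis using v f(3) by (auto simp: cone_tangent_space_def)
      qed
      then have "(\<Sum>k\<le>N. \<Sum>b\<in>I. partial b (C k) p * v b) = 0" by simp
      moreover have "partial b (F a) p = (\<Sum>k\<le>N. partial b (C k) p)" for b
      proof -
        have "F a = (\<lambda>q. \<Sum>k\<le>N. C k q)" using C(2)[rule_format, of 1] by (auto simp: fun_eq_iff)
        then show ?thesis using C(1) hfun_imp_pfun by (metis partial_sum)
      qed
      ultimately have "(\<Sum>b\<in>I. partial b (F a) p * v b) = 0"
        by (subst (asm) sum.swap) (simp add: sum_distrib_right)
      then have "v a + (\<Sum>b\<in>I - A. partial b (F a) p * v b) = 0" using split[OF a] by simp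
      then show ?thesis by (simp add: sum_negf add_eq_0_iff2)
    qed
    then show "v \<in> ?R" using v by (auto simp: cone_tangent_space_def)
  next
    fix v assume v: "v \<in> ?R"
    have "(\<Sum>b\<in>I. partial b (mpoly_eval f) p * v b) = 0" if f: "f \<in> vanishing_ideal I V" for f
    proof -
      have g: "mpoly_eval f \<in> vanishing_on I V"
        using f mpoly_imp_pfun by (auto simp: vanishing_ideal_def vanishing_on_def)
      have "(\<Sum>b\<in>I. partial b (mpoly_eval f) p * v b) =
          (\<Sum>b\<in>I. \<Sum>a\<in>A. partial a (mpoly_eval f) p * (partial b (F a) p * v b))"
        by (rule sum.cong) (simp_all add: AF(4)[OF g] sum_distrib_right mult.assoc)
      also have "\<dots> = (\<Sum>a\<in>A. partial a (mpoly_eval f) p * (\<Sum>b\<in>I. partial b (F a) p * v b))"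
        by (subst sum.swap) (simp add: sum_distrib_left)
      also have "\<dots> = 0"
      proof (rule sum.neutral, intro ballI)
        fix a assume a: "a \<in> A"
        have "v a + (\<Sum>b\<in>I - A. partial b (F a) p * v b) = 0" using v a by (auto simp: sum_negf)
        then show "partial a (mpoly_eval f) p * (\<Sum>b\<in>I. partial b (F a) p * v b) = 0"
          using split[OF a] by simp
      qed
      finally show ?thesis .
    qed
    then show "v \<in> ?L" using v by (auto simp: cone_tangent_space_def)
  qed
  then have "vector_space.dim fun_scale (cone_tangent_space I V p) = card (I - A)"
    using dim_graph_subspace[OF I AF(1), of "\<lambda>a b. - partial b (F a) p"] by simp
  then show ?thesis using AF0 by (intro exI[of _ A] exI[of _ F] conjI)
qed

section \<open>Tangent spaces: bounded below by chains, above by independent equations\<close>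

lemma chain_le_dim_tangent:
  assumes I: "finite I" and V: "V \<subseteq> proj_space I" and ch: "irreducible_chain (zariski_proj I) V m Z"
    and x: "x \<in> Z m" "p \<in> x"
  shows "Suc m \<le> vector_space.dim fun_scale (cone_tangent_space I V p)"
proof -
  obtain A F where AF0: "A \<subseteq> I" "\<forall>a\<in>A. F a \<in> vanishing_on I V"
    "\<forall>a\<in>A. \<forall>b\<in>A. partial b (F a) p = (if a = b then 1 else 0)"
    "\<forall>g\<in>vanishing_on I V. \<forall>b\<in>I. partial b g p = (\<Sum>a\<in>A. partial a g p * partial b (F a) p)"
    "vector_space.dim fun_scale (cone_tangent_space I V p) = card (I - A)"
    using cone_tangent_space_echelon[OF I V, of p] by (elim exE conjE)
  note AF = AF0(1) AF0(2,3,4)[rule_format] AF0(5)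
  have "F a \<in> vanishing_on I (Z m)" if "a \<in> A" for a
    using AF(2)[OF that] ch by (auto simp: vanishing_on_def irreducible_chain_def)
  then show ?thesis using chain_length_bound[OF I ch x AF(1) _ AF(3)] AF(5) by simp
qed

lemma dim_tangent_le:
  assumes I: "finite I" and V: "V \<subseteq> proj_space I" and L: "finite L" "independent_gradients I L G p"
    and G: "\<And>l. l \<in> L \<Longrightarrow> G l \<in> vanishing_on I V"
  shows "vector_space.dim fun_scale (cone_tangent_space I V p) + card L \<le> card I"
proof -
  obtain A F where AF0: "A \<subseteq> I" "\<forall>a\<in>A. F a \<in> vanishing_on I V"
    "\<forall>a\<in>A. \<forall>b\<in>A. partial b (F a) p = (if a = b then 1 else 0)"
    "\<forall>g\<in>vanishing_on I V. \<forall>b\<in>I. partial b g p = (\<Sum>a\<in>A. partial a g p * partial b (F a) p)"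
    "vector_space.dim fun_scale (cone_tangent_space I V p) = card (I - A)"
    using cone_tangent_space_echelon[OF I V, of p] by (elim exE conjE)
  note AF = AF0(1) AF0(2,3,4)[rule_format] AF0(5)
  have finA: "finite A" using AF(1) I finite_subset by blast
  have "card L \<le> card A"
    by (rule independent_gradients_card_le[OF finA L]) (rule AF(4)[OF G])
  moreover have "card (I - A) + card A = card I"
    using card_mono[OF I AF(1)] by (simp add: card_Diff_subset[OF finA AF(1)])
  ultimately show ?thesis using AF(5) by simp
qed

section \<open>Local parametrizations\<close>

definition polydisc :: "nat \<Rightarrow> real \<Rightarrow> (nat \<Rightarrow> complex) set" where
  "polydisc k e = {\<tau>. \<forall>i<k. norm (\<tau> i) < e}"

definition closed_polydisc :: "nat \<Rightarrow> real \<Rightarrow> (nat \<Rightarrow> complex) set" where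
  "closed_polydisc k e = {\<tau>. \<forall>i<k. norm (\<tau> i) \<le> e}"

text \<open>Locally uniform limits of polynomials: holomorphic functions on a polydisc, in a form that
  needs no topology on the space of parameters.\<close>

definition holomorphic_polydisc :: "nat \<Rightarrow> real \<Rightarrow> ((nat \<Rightarrow> complex) \<Rightarrow> complex) \<Rightarrow> bool" where
  "holomorphic_polydisc k \<epsilon> f \<longleftrightarrow> (\<exists>F. (\<forall>n. pfun {..<k} (F n)) \<and>
     (\<forall>e. 0 < e \<longrightarrow> e < \<epsilon> \<longrightarrow> uniform_limit (closed_polydisc k e) F f sequentially))"

lemma pfun_compose:
  assumes "pfun I f" "\<And>i. i \<in> I \<Longrightarrow> pfun K (\<lambda>\<tau>. z \<tau> i)"
  shows "pfun K (\<lambda>\<tau>. f (z \<tau>))"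
  using assms by (induction rule: pfun.induct) (auto intro: pfun.intros)

lemma pfun_tendsto:
  fixes f :: "('i \<Rightarrow> 'k::real_normed_field) \<Rightarrow> 'k"
  assumes "pfun I f" "\<And>i. i \<in> I \<Longrightarrow> ((\<lambda>n. z n i) \<longlongrightarrow> y i) F"
  shows "((\<lambda>n. f (z n)) \<longlongrightarrow> f y) F"
  using assms by (induction rule: pfun.induct) (auto intro: tendsto_intros)

lemma pfun_holomorphic:
  assumes "pfun I f" "\<And>i. i \<in> I \<Longrightarrow> (\<lambda>z. w z i) holomorphic_on \<Omega>"
  shows "(\<lambda>z. f (w z)) holomorphic_on \<Omega>"
  using assms by (induction rule: pfun.induct) (auto intro: holomorphic_intros)

lemma pfun_near_finite:
  fixes f :: "'a \<Rightarrow> ('i \<Rightarrow> complex) \<Rightarrow> complex"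
  assumes "finite A" "\<And>a. a \<in> A \<Longrightarrow> pfun I (f a)" "e > 0"
  shows "\<exists>\<delta>>0. \<forall>y. (\<forall>i\<in>I. norm (y i - x i) < \<delta>) \<longrightarrow> (\<forall>a\<in>A. norm (f a y - f a x) < e)"
  using assms(1,2)
proof (induction A)
  case empty
  show ?case by (intro exI[of _ 1]) auto
next
  case (insert a A)
  then obtain d1 where d1: "d1 > 0" "\<forall>y. (\<forall>i\<in>I. norm (y i - x i) < d1) \<longrightarrow> (\<forall>a\<in>A. norm (f a y - f a x) < e)"
    by auto
  obtain d2 where d2: "d2 > 0" "\<forall>y. (\<forall>i\<in>I. norm (y i - x i) < d2) \<longrightarrow> norm (f a y - f a x) < e"
    using pfun_near[OF insert.prems[OF insertI1] assms(3)] by blast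
  show ?case
    by (intro exI[of _ "min d1 d2"]) (use d1 d2 in auto)
qed

text \<open>The coordinates in \<open>B\<close> are changed one at a time; each change is estimated
  by the mean value inequality on a disc.\<close>

lemma newton_contraction:
  fixes G :: "('i \<Rightarrow> complex) \<Rightarrow> complex"
  assumes pG: "pfun I G" and B: "finite B" "B \<subseteq> I"
    and dG: "\<And>b y. b \<in> B \<Longrightarrow> (\<forall>i\<in>I. norm (y i - p i) < \<delta>) \<Longrightarrow> norm (partial b G y) \<le> \<kappa>"
    and z: "\<forall>i\<in>I. norm (z i - p i) < \<delta>" and z': "\<forall>i\<in>I. norm (z' i - p i) < \<delta>"
    and agree: "\<And>i. i \<notin> B \<Longrightarrow> z i = z' i"
  shows "norm (G z - G z') \<le> \<kappa> * (\<Sum>b\<in>B. norm (z b - z' b))"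
  using B dG z' agree
proof (induction B arbitrary: z')
  case empty
  then have "z = z'" by auto
  then show ?case by simp
next
  case (insert b B)
  let ?z = "z'(b := z b)"
  have bI: "b \<in> I" using insert.prems by simp
  have z2: "\<forall>i\<in>I. norm (?z i - p i) < \<delta>" using insert.prems(3) z by simp
  have 1: "norm (G z - G ?z) \<le> \<kappa> * (\<Sum>c\<in>B. norm (z c - ?z c))"
    by (rule insert.IH) (use insert.prems z2 in auto)
  have s: "(\<Sum>c\<in>B. norm (z c - ?z c)) = (\<Sum>c\<in>B. norm (z c - z' c))"
    by (rule sum.cong) (use insert.hyps in auto)
  have 2: "norm (G (z'(b := z b)) - G (z'(b := z' b))) \<le> \<kappa> * norm (z b - z' b)"
  proof (rule field_differentiable_bound[of "ball (p b) \<delta>" "\<lambda>t. G (z'(b := t))" "\<lambda>t. partial b G (z'(b := t))"])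
    show "((\<lambda>t. G (z'(b := t))) has_field_derivative partial b G (z'(b := t))) (at t within ball (p b) \<delta>)" for t
      using pfun_has_partial[OF pG] has_field_derivative_at_within by blast
    show "norm (partial b G (z'(b := t))) \<le> \<kappa>" if "t \<in> ball (p b) \<delta>" for t
    proof (rule insert.prems(2))
      show "\<forall>i\<in>I. norm ((z'(b := t)) i - p i) < \<delta>"
        using insert.prems(3) that by (auto simp: dist_norm norm_minus_commute)
    qed simp
    show "z b \<in> ball (p b) \<delta>" "z' b \<in> ball (p b) \<delta>"
      using z insert.prems(3) bI by (auto simp: dist_norm norm_minus_commute)
  qed simp
  have "norm (G z - G z') \<le> norm (G z - G ?z) + norm (G ?z - G z')"
    using norm_triangle_ineq[of "G z - G ?z" "G ?z - G z'"] by simp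
  also have "\<dots> \<le> \<kappa> * (\<Sum>c\<in>B. norm (z c - z' c)) + \<kappa> * norm (z b - z' b)"
    using 1 2 s by simp
  finally show ?case using insert.hyps by (simp add: algebra_simps)
qed

text \<open>The Newton iterates \<open>z n \<tau>\<close> below are polynomials in the parameter \<open>\<tau>\<close>.\<close>

lemma implicit_function_echelon:
  fixes F :: "'i \<Rightarrow> ('i \<Rightarrow> complex) \<Rightarrow> complex"
  assumes I: "finite I" and A: "A \<subseteq> I" and pF': "\<forall>a\<in>A. pfun I (F a)"
    and F0': "\<forall>a\<in>A. F a p = 0"
    and dF': "\<forall>a\<in>A. \<forall>b\<in>A. partial b (F a) p = (if a = b then 1 else 0)"
    and \<sigma>: "bij_betw \<sigma> {..<k} (I - A)" and \<eta>: "\<eta> > 0"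
  shows "\<exists>\<epsilon> \<rho> \<Psi>. 0 < \<epsilon> \<and> \<epsilon> \<le> \<eta> \<and> 0 < \<rho> \<and> \<rho> \<le> \<eta> \<and> (\<forall>i. holomorphic_polydisc k \<epsilon> (\<lambda>\<tau>. \<Psi> \<tau> i)) \<and>
    (\<forall>\<tau>\<in>polydisc k \<epsilon>. (\<forall>i<k. \<Psi> \<tau> (\<sigma> i) = p (\<sigma> i) + \<tau> i) \<and>
      (\<forall>a\<in>A. norm (\<Psi> \<tau> a - p a) < \<rho> \<and> F a (\<Psi> \<tau>) = 0) \<and> (\<forall>i. i \<notin> I \<longrightarrow> \<Psi> \<tau> i = p i)) \<and>
    (\<forall>\<tau>\<in>polydisc k \<epsilon>. \<forall>q. (\<forall>i<k. q (\<sigma> i) = p (\<sigma> i) + \<tau> i) \<longrightarrow>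
      (\<forall>a\<in>A. norm (q a - p a) < \<rho> \<and> F a q = 0) \<longrightarrow> (\<forall>i\<in>I. q i = \<Psi> \<tau> i))"
proof -
  note pF = pF'[rule_format] and F0 = F0'[rule_format] and dF = dF'[rule_format]
  have finA: "finite A" using A I finite_subset by blast
  \<comment> \<open>The added \<open>1\<close> keeps \<open>c\<close> positive for empty
    \<open>A\<close>; \<open>card A / c\<close> is still at most \<open>1\<close>, so partial
    derivatives bounded by \<open>1 / (2 * c)\<close> give the Lipschitz constant
    \<open>1 / 2\<close> in the sum norm.\<close>
  define c where "c = real (card A) + 1"
  have c: "c \<ge> 1" by (simp add: c_def)
  \<comment> \<open>Zeros of the \<open>F a\<close> are fixed points of \<open>G\<close>. Because
    \<open>F\<close> is in echelon form, the Jacobian of \<open>G\<close> on \<open>A\<close>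
    vanishes at \<open>p\<close>: Newton's method with the derivative frozen at
    \<open>p\<close>.\<close>
  define G where "G a = (\<lambda>z. z a - F a z)" for a
  have pG: "pfun I (G a)" if "a \<in> A" for a
    unfolding G_def using that A by (intro pfun_diff pfun.coord pF) auto
  have dG: "partial b (G a) y = (if a = b then 1 else 0) - partial b (F a) y" if "a \<in> A" for a b y
    unfolding G_def using that A by (subst partial_diff[OF pfun.coord pF]) (auto simp: partial_coord)
  have dG0: "partial b (G a) p = 0" if "a \<in> A" "b \<in> A" for a b
    using dG[OF that(1)] dF[OF that] by simp
  obtain \<delta> where \<delta>: "\<delta> > 0" and \<delta>G: "\<And>y a b. \<forall>i\<in>I. norm (y i - p i) < \<delta> \<Longrightarrow> a \<in> A \<Longrightarrow> b \<in> A \<Longrightarrow>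
      norm (partial b (G a) y) \<le> 1 / (2 * c)"
  proof -
    have "\<exists>\<delta>>0. \<forall>y. (\<forall>i\<in>I. norm (y i - p i) < \<delta>) \<longrightarrow> (\<forall>ab\<in>A \<times> A.
        norm (partial (snd ab) (G (fst ab)) y - partial (snd ab) (G (fst ab)) p) < 1 / (2 * c))"
      using finA c pG by (intro pfun_near_finite) (auto intro: pfun_partial)
    then show ?thesis using that dG0 by (fastforce intro: less_imp_le)
  qed
  have lip: "(\<Sum>a\<in>A. norm (G a z - G a z')) \<le> (1 / 2) * (\<Sum>a\<in>A. norm (z a - z' a))"
    if "\<forall>i\<in>I. norm (z i - p i) < \<delta>" "\<forall>i\<in>I. norm (z' i - p i) < \<delta>" "\<And>i. i \<notin> A \<Longrightarrow> z i = z' i" for z z'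
  proof -
    have "(\<Sum>a\<in>A. norm (G a z - G a z')) \<le> (\<Sum>a\<in>A. 1 / (2 * c) * (\<Sum>b\<in>A. norm (z b - z' b)))"
      by (rule sum_mono) (use \<delta>G that newton_contraction[OF pG finA A] in blast)
    also have "\<dots> = (real (card A) / c) * ((1 / 2) * (\<Sum>b\<in>A. norm (z b - z' b)))"
      by (simp add: field_simps)
    also have "\<dots> \<le> 1 * ((1 / 2) * (\<Sum>b\<in>A. norm (z b - z' b)))"
      using c by (intro mult_right_mono) (auto simp: c_def field_simps intro: sum_nonneg)
    finally show ?thesis by simp
  qed
  define \<rho> where "\<rho> = min \<eta> \<delta>"
  have \<rho>: "0 < \<rho>" "\<rho> \<le> \<eta>" "\<rho> \<le> \<delta>" using \<eta> \<delta> by (auto simp: \<rho>_def)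
  \<comment> \<open>This limits the first step to \<open>\<rho> / 4\<close> in the sum norm; with
    steps halving afterwards, the iterates stay within \<open>\<rho> / 2\<close> of
    \<open>p\<close>.\<close>
  obtain \<delta>' where \<delta>': "\<delta>' > 0" and \<delta>'F: "\<And>y. \<forall>i\<in>I. norm (y i - p i) < \<delta>' \<Longrightarrow> \<forall>a\<in>A. norm (F a y) < \<rho> / (4 * c)"
  proof -
    have "\<exists>\<delta>>0. \<forall>y. (\<forall>i\<in>I. norm (y i - p i) < \<delta>) \<longrightarrow> (\<forall>a\<in>A. norm (F a y - F a p) < \<rho> / (4 * c))"
      using \<rho> c by (intro pfun_near_finite[OF finA, where f = F] pF) auto
    then show ?thesis using that F0 by auto
  qed
  define \<epsilon> where "\<epsilon> = min \<rho> \<delta>'"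
  have \<epsilon>: "0 < \<epsilon>" "\<epsilon> \<le> \<rho>" "\<epsilon> \<le> \<delta>'" using \<rho> \<delta>' by (auto simp: \<epsilon>_def)
  define \<sigma>' where "\<sigma>' = inv_into {..<k} \<sigma>"
  have \<sigma>': "\<sigma>' i < k" "\<sigma> (\<sigma>' i) = i" if "i \<in> I - A" for i
    using bij_betw_apply[OF bij_betw_inv_into[OF \<sigma>] that] bij_betw_inv_into_right[OF \<sigma> that]
    unfolding \<sigma>'_def by auto
  have \<sigma>\<sigma>': "\<sigma>' (\<sigma> i) = i" "\<sigma> i \<in> I" "\<sigma> i \<notin> A" if "i < k" for i
    using bij_betw_inv_into_left[OF \<sigma>, of i] bij_betw_apply[OF \<sigma>, of i] that
    unfolding \<sigma>'_def by auto
  \<comment> \<open>Only the coordinates in \<open>A\<close> are iterated; the free ones are set to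
    \<open>p + \<tau>\<close> at the start and stay there.\<close>
  define z where "z n \<tau> = ((\<lambda>y i. if i \<in> A then G i y else y i) ^^ n) (\<lambda>i. if i \<in> I - A then p i + \<tau> (\<sigma>' i) else p i)" for n \<tau>
  have z0: "z 0 \<tau> i = (if i \<in> I - A then p i + \<tau> (\<sigma>' i) else p i)" for \<tau> i by (simp add: z_def)
  have zS: "z (Suc n) \<tau> i = (if i \<in> A then G i (z n \<tau>) else z n \<tau> i)" for n \<tau> i by (simp add: z_def)
  have zout: "z n \<tau> i = z 0 \<tau> i" if "i \<notin> A" for n \<tau> i
    using that by (induction n) (auto simp: zS)
  have pz: "pfun {..<k} (\<lambda>\<tau>. z n \<tau> i)" for n i
  proof (induction n arbitrary: i)
    case 0
    have "pfun {..<k} (\<lambda>\<tau>. p i + \<tau> (\<sigma>' i))" if "i \<in> I - A"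
      using \<sigma>'(1)[OF that] by (intro pfun.intros) auto
    then show ?case
      by (cases "i \<in> I - A") (simp_all only: z0 if_True if_False pfun.const not_False_eq_True)
  next
    case (Suc n)
    show ?case
    proof (cases "i \<in> A")
      case True
      then show ?thesis unfolding zS using pfun_compose[OF pG[OF True] Suc] by simp
    qed (simp add: zS Suc)
  qed
  define E where "E n \<tau> = (\<Sum>a\<in>A. norm (z n \<tau> a - p a))" for n \<tau>
  define D where "D n \<tau> = (\<Sum>a\<in>A. norm (z (Suc n) \<tau> a - z n \<tau> a))" for n \<tau>
  have comp: "norm (w a) \<le> (\<Sum>a\<in>A. norm (w a))" if "a \<in> A" for a and w :: "'i \<Rightarrow> complex"
    using member_le_sum[of a A "\<lambda>a. norm (w a)"] that finA by auto
  have free: "norm (z n \<tau> i - p i) < \<epsilon>" if "\<tau> \<in> polydisc k \<epsilon>" "i \<in> I - A" for n \<tau> i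
    using that \<sigma>'(1)[OF that(2)] by (simp add: zout z0 polydisc_def)
  have box: "\<forall>i\<in>I. norm (z n \<tau> i - p i) < \<delta>" if "\<tau> \<in> polydisc k \<epsilon>" "E n \<tau> < \<rho>" for n \<tau>
  proof
    fix i assume "i \<in> I"
    show "norm (z n \<tau> i - p i) < \<delta>"
    proof (cases "i \<in> A")
      case True
      then show ?thesis using comp[OF True, of "\<lambda>a. z n \<tau> a - p a"] that(2) \<rho>(3) unfolding E_def by linarith
    next
      case False
      then show ?thesis using free[OF that(1), of i n] \<open>i \<in> I\<close> \<epsilon> \<rho> by fastforce
    qed
  qed
  \<comment> \<open>Both bounds go together: the contraction is available only while the iterates
    stay in the box, and they do so by the geometric sum of the steps.\<close>
  have bound: "D n \<tau> \<le> \<rho> / 4 * (1 / 2) ^ n \<and> E n \<tau> \<le> \<rho> / 2 * (1 - (1 / 2) ^ n)" if \<tau>: "\<tau> \<in> polydisc k \<epsilon>" for n \<tau>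
  proof (induction n)
    case 0
    have E0: "E 0 \<tau> = 0" unfolding E_def z0 by (rule sum.neutral) auto
    have "\<forall>i\<in>I. norm (z 0 \<tau> i - p i) < \<delta>'"
    proof
      fix i assume "i \<in> I"
      then show "norm (z 0 \<tau> i - p i) < \<delta>'"
        using free[OF \<tau>, of i 0] \<epsilon> \<delta>' by (cases "i \<in> A") (auto simp: z0)
    qed
    then have F: "\<forall>a\<in>A. norm (F a (z 0 \<tau>)) < \<rho> / (4 * c)" by (rule \<delta>'F)
    have "D 0 \<tau> = (\<Sum>a\<in>A. norm (F a (z 0 \<tau>)))"
      unfolding D_def zS G_def by (rule sum.cong) (auto simp: z0)
    also have "\<dots> \<le> (\<Sum>a\<in>A. \<rho> / (4 * c))" using F by (intro sum_mono) auto
    also have "\<dots> = (real (card A) / c) * (\<rho> / 4)" by (simp add: field_simps)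
    also have "\<dots> \<le> 1 * (\<rho> / 4)"
      using c \<rho> by (intro mult_right_mono) (auto simp: c_def)
    finally show ?case using E0 by simp
  next
    case (Suc n)
    have pw: "0 < (1 / 2 :: real) ^ m" for m by simp
    have lt: "\<rho> / 2 * (1 - (1 / 2) ^ m) < \<rho>" for m
    proof -
      have "\<rho> / 2 * (1 - (1 / 2) ^ m) \<le> \<rho> / 2 * 1" using \<rho>(1) pw[of m] by (intro mult_left_mono) simp_all
      also have "\<rho> / 2 * 1 < \<rho>" using \<rho>(1) by simp
      finally show ?thesis .
    qed
    have "E (Suc n) \<tau> \<le> E n \<tau> + D n \<tau>"
      unfolding E_def D_def sum.distrib[symmetric]
    proof (rule sum_mono)
      fix a assume "a \<in> A"
      show "norm (z (Suc n) \<tau> a - p a) \<le> norm (z n \<tau> a - p a) + norm (z (Suc n) \<tau> a - z n \<tau> a)"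
        using norm_triangle_ineq[of "z n \<tau> a - p a" "z (Suc n) \<tau> a - z n \<tau> a"] by simp
    qed
    also have "\<dots> \<le> \<rho> / 2 * (1 - (1 / 2) ^ n) + \<rho> / 4 * (1 / 2) ^ n" using Suc by auto
    also have "\<dots> = \<rho> / 2 * (1 - (1 / 2) ^ Suc n)" by (simp add: field_simps)
    finally have E: "E (Suc n) \<tau> \<le> \<rho> / 2 * (1 - (1 / 2) ^ Suc n)" .
    have b1: "E (Suc n) \<tau> < \<rho>" "E n \<tau> < \<rho>" using E Suc lt[of "Suc n"] lt[of n] by linarith+
    have "D (Suc n) \<tau> = (\<Sum>a\<in>A. norm (G a (z (Suc n) \<tau>) - G a (z n \<tau>)))"
      unfolding D_def zS[of "Suc n"] by (rule sum.cong) (simp_all add: zS[of n])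
    also have "\<dots> \<le> 1 / 2 * D n \<tau>"
      unfolding D_def using box[OF \<tau>] b1 zout by (intro lip) metis+
    also have "\<dots> \<le> 1 / 2 * (\<rho> / 4 * (1 / 2) ^ n)" using Suc by simp
    finally show ?case using E by simp
  qed
  define \<Psi> where "\<Psi> \<tau> i = z 0 \<tau> i + suminf (\<lambda>m. z (Suc m) \<tau> i - z m \<tau> i)" for \<tau> i
  have unif: "uniform_limit (polydisc k \<epsilon>) (\<lambda>n \<tau>. z n \<tau> i) (\<lambda>\<tau>. \<Psi> \<tau> i) sequentially" for i
  proof -
    have "uniform_limit (polydisc k \<epsilon>) (\<lambda>n \<tau>. \<Sum>m<n. z (Suc m) \<tau> i - z m \<tau> i)
        (\<lambda>\<tau>. suminf (\<lambda>m. z (Suc m) \<tau> i - z m \<tau> i)) sequentially"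
    proof (rule Weierstrass_m_test)
      show "norm (z (Suc n) \<tau> i - z n \<tau> i) \<le> \<rho> / 4 * (1 / 2) ^ n" if "\<tau> \<in> polydisc k \<epsilon>" for n \<tau>
      proof (cases "i \<in> A")
        case True
        then show ?thesis
          using comp[OF True, of "\<lambda>a. z (Suc n) \<tau> a - z n \<tau> a"] bound[OF that, of n] unfolding D_def by linarith
      next
        case False
        then show ?thesis using \<rho> by (simp add: zS)
      qed
      show "summable (\<lambda>n. \<rho> / 4 * (1 / 2) ^ n)" by (intro summable_mult summable_geometric) simp
    qed
    then have "uniform_limit (polydisc k \<epsilon>) (\<lambda>n \<tau>. z 0 \<tau> i + (\<Sum>m<n. z (Suc m) \<tau> i - z m \<tau> i))
        (\<lambda>\<tau>. z 0 \<tau> i + suminf (\<lambda>m. z (Suc m) \<tau> i - z m \<tau> i)) sequentially"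
      by (intro uniform_limit_add uniform_limit_const)
    moreover have "(\<Sum>m<n. z (Suc m) \<tau> i - z m \<tau> i) = z n \<tau> i - z 0 \<tau> i" for n \<tau>
      by (rule sum_lessThan_telescope)
    ultimately show ?thesis unfolding \<Psi>_def by simp
  qed
  have lim: "(\<lambda>n. z n \<tau> i) \<longlonglongrightarrow> \<Psi> \<tau> i" if "\<tau> \<in> polydisc k \<epsilon>" for \<tau> i
    using tendsto_uniform_limitI[OF unif that] .
  have hol: "holomorphic_polydisc k \<epsilon> (\<lambda>\<tau>. \<Psi> \<tau> i)" for i
    unfolding holomorphic_polydisc_def
  proof (intro exI[of _ "\<lambda>n \<tau>. z n \<tau> i"] conjI allI impI)
    show "uniform_limit (closed_polydisc k e) (\<lambda>n \<tau>. z n \<tau> i) (\<lambda>\<tau>. \<Psi> \<tau> i) sequentially" if "e < \<epsilon>" for e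
      by (rule uniform_limit_on_subset[OF unif]) (use that in \<open>auto simp: polydisc_def closed_polydisc_def\<close>)
  qed (rule pz)
  have \<Psi>out: "\<Psi> \<tau> i = z 0 \<tau> i" if "i \<notin> A" for \<tau> i using that by (simp add: \<Psi>_def zS)
  have \<Psi>A: "norm (\<Psi> \<tau> a - p a) < \<rho>" "F a (\<Psi> \<tau>) = 0" if \<tau>: "\<tau> \<in> polydisc k \<epsilon>" and a: "a \<in> A" for \<tau> a
  proof -
    have "norm (z n \<tau> a - p a) \<le> \<rho> / 2" for n
    proof -
      have "E n \<tau> \<le> \<rho> / 2 * (1 - (1 / 2) ^ n)" using bound[OF \<tau>] by blast
      also have "\<dots> \<le> \<rho> / 2 * 1" using \<rho> by (intro mult_left_mono) auto
      finally show ?thesis using comp[OF a, of "\<lambda>a. z n \<tau> a - p a"] unfolding E_def by linarith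
    qed
    moreover have "(\<lambda>n. norm (z n \<tau> a - p a)) \<longlonglongrightarrow> norm (\<Psi> \<tau> a - p a)"
      by (intro tendsto_intros lim[OF \<tau>])
    ultimately have "norm (\<Psi> \<tau> a - p a) \<le> \<rho> / 2" by (intro LIMSEQ_le_const2) auto
    then show "norm (\<Psi> \<tau> a - p a) < \<rho>" using \<rho> by simp
    have "(\<lambda>n. z n \<tau> a - z (Suc n) \<tau> a) \<longlonglongrightarrow> \<Psi> \<tau> a - \<Psi> \<tau> a"
      using lim[OF \<tau>, of a] by (intro tendsto_diff LIMSEQ_Suc)
    moreover have "z n \<tau> a - z (Suc n) \<tau> a = F a (z n \<tau>)" for n using a by (simp add: zS G_def)
    moreover have "(\<lambda>n. F a (z n \<tau>)) \<longlonglongrightarrow> F a (\<Psi> \<tau>)"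
      by (rule pfun_tendsto[OF pF[OF a]]) (rule lim[OF \<tau>])
    ultimately have l: "(\<lambda>n. F a (z n \<tau>)) \<longlonglongrightarrow> F a (\<Psi> \<tau>)" "(\<lambda>n. F a (z n \<tau>)) \<longlonglongrightarrow> 0" by simp_all
    show "F a (\<Psi> \<tau>) = 0" by (rule LIMSEQ_unique[OF l])
  qed
  have \<Psi>S: "\<Psi> \<tau> (\<sigma> i) = p (\<sigma> i) + \<tau> i" if "i < k" for \<tau> i
    using \<sigma>\<sigma>'[OF that] by (simp add: \<Psi>out z0)
  have uniq: "\<forall>i\<in>I. q i = \<Psi> \<tau> i" if \<tau>: "\<tau> \<in> polydisc k \<epsilon>" and q: "\<forall>i<k. q (\<sigma> i) = p (\<sigma> i) + \<tau> i"
     "\<forall>a\<in>A. norm (q a - p a) < \<rho> \<and> F a q = 0" for \<tau> q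
  proof -
    define q' where "q' i = (if i \<in> I then q i else p i)" for i
    have Fq': "F a q' = 0" if "a \<in> A" for a
      using pfun_cong[OF pF[OF that], of q' q] q(2) that by (simp add: q'_def)
    have S: "q i = p i + \<tau> (\<sigma>' i)" if "i \<in> I - A" for i
      using q(1)[rule_format, of "\<sigma>' i"] \<sigma>'[OF that] by simp
    have agree: "q' i = \<Psi> \<tau> i" if "i \<notin> A" for i
      using that S by (simp add: q'_def \<Psi>out z0)
    have boxes: "\<forall>i\<in>I. norm (q' i - p i) < \<delta>" "\<forall>i\<in>I. norm (\<Psi> \<tau> i - p i) < \<delta>"
    proof -
      have *: "norm (\<Psi> \<tau> i - p i) < \<delta>" if "i \<in> I" for i
      proof (cases "i \<in> A")
        case True
        then show ?thesis using \<Psi>A(1)[OF \<tau> True] \<rho> by linarith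
      next
        case False
        then show ?thesis using free[OF \<tau>, of i 0] that \<epsilon> \<rho> \<Psi>out[OF False, of \<tau>] by fastforce
      qed
      then show "\<forall>i\<in>I. norm (\<Psi> \<tau> i - p i) < \<delta>" by blast
      show "\<forall>i\<in>I. norm (q' i - p i) < \<delta>"
      proof
        fix i assume i: "i \<in> I"
        show "norm (q' i - p i) < \<delta>"
        proof (cases "i \<in> A")
          case True
          then show ?thesis using q(2) \<rho> i by (fastforce simp: q'_def)
        next
          case False
          then show ?thesis using *[OF i] agree by simp
        qed
      qed
    qed
    have "(\<Sum>a\<in>A. norm (q' a - \<Psi> \<tau> a)) = (\<Sum>a\<in>A. norm (G a q' - G a (\<Psi> \<tau>)))"
      by (rule sum.cong) (auto simp: G_def Fq' \<Psi>A(2)[OF \<tau>])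
    also have "\<dots> \<le> 1 / 2 * (\<Sum>a\<in>A. norm (q' a - \<Psi> \<tau> a))"
      by (rule lip[OF boxes agree])
    finally have s0: "(\<Sum>a\<in>A. norm (q' a - \<Psi> \<tau> a)) \<le> 0" by simp
    have "q' a = \<Psi> \<tau> a" if "a \<in> A" for a
    proof -
      have "norm (q' a - \<Psi> \<tau> a) \<le> 0" using comp[OF that, of "\<lambda>a. q' a - \<Psi> \<tau> a"] s0 by linarith
      then show ?thesis by simp
    qed
    then have "q' i = \<Psi> \<tau> i" for i using agree by blast
    moreover have "q' i = q i" if "i \<in> I" for i using that by (simp add: q'_def)
    ultimately show ?thesis by simp
  qed
  show ?thesis
  proof (rule exI[of _ \<epsilon>], rule exI[of _ \<rho>], rule exI[of _ \<Psi>], intro conjI ballI allI impI)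
    show "\<epsilon> \<le> \<eta>" using \<epsilon> \<rho> by linarith
    show "\<Psi> \<tau> i = p i" if "i \<notin> I" for \<tau> i
    proof -
      have "i \<notin> A" using that A by blast
      then show ?thesis using that by (simp add: \<Psi>out z0)
    qed
  qed (use \<epsilon> \<rho> hol \<Psi>S \<Psi>A uniq in blast)+
qed

text \<open>The equations are replaced by linear combinations in echelon form. Independence of the
  gradients gives both systems the same length and the same zeros everywhere, so the chart of the
  echelon system serves.\<close>

lemma implicit_function:
  fixes G :: "'l \<Rightarrow> ('i \<Rightarrow> complex) \<Rightarrow> complex"
  assumes I: "finite I" and L: "finite L" and pG: "\<And>l. l \<in> L \<Longrightarrow> pfun I (G l)"
    and G0: "\<And>l. l \<in> L \<Longrightarrow> G l p = 0"
    and ind: "independent_gradients I L G p" and \<eta>: "\<eta> > 0"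
  shows "card L \<le> card I \<and> (\<exists>S \<sigma> \<epsilon> \<rho> \<Psi>. S \<subseteq> I \<and> bij_betw \<sigma> {..<card I - card L} S \<and>
    0 < \<epsilon> \<and> \<epsilon> \<le> \<eta> \<and> 0 < \<rho> \<and> \<rho> \<le> \<eta> \<and> (\<forall>i. holomorphic_polydisc (card I - card L) \<epsilon> (\<lambda>\<tau>. \<Psi> \<tau> i)) \<and>
    (\<forall>\<tau>\<in>polydisc (card I - card L) \<epsilon>. (\<forall>i<card I - card L. \<Psi> \<tau> (\<sigma> i) = p (\<sigma> i) + \<tau> i) \<and>
      (\<forall>a\<in>I - S. norm (\<Psi> \<tau> a - p a) < \<rho>) \<and> (\<forall>l\<in>L. G l (\<Psi> \<tau>) = 0) \<and> (\<forall>i. i \<notin> I \<longrightarrow> \<Psi> \<tau> i = p i)) \<and>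
    (\<forall>\<tau>\<in>polydisc (card I - card L) \<epsilon>. \<forall>q. (\<forall>i<card I - card L. q (\<sigma> i) = p (\<sigma> i) + \<tau> i) \<longrightarrow>
      (\<forall>a\<in>I - S. norm (q a - p a) < \<rho>) \<longrightarrow> (\<forall>l\<in>L. G l q = 0) \<longrightarrow> (\<forall>i\<in>I. q i = \<Psi> \<tau> i)))"
proof -
  define \<L> where "\<L> = {f. \<exists>\<beta>. f = (\<lambda>x. \<Sum>l\<in>L. \<beta> l * G l x)}"
  have pL: "pfun I f" if "f \<in> \<L>" for f
    using that pG unfolding \<L>_def by (auto intro!: pfun_sum pfun.mult pfun.const)
  have dL: "partial b (\<lambda>x. \<Sum>l\<in>L. \<beta> l * G l x) x = (\<Sum>l\<in>L. \<beta> l * partial b (G l) x)" for \<beta> b x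
  proof -
    have "partial b (\<lambda>x. \<Sum>l\<in>L. \<beta> l * G l x) x = (\<Sum>l\<in>L. partial b (\<lambda>x. \<beta> l * G l x) x)"
      by (rule partial_sum[of _ I]) (auto intro: pfun.mult pfun.const pG)
    also have "\<dots> = (\<Sum>l\<in>L. \<beta> l * partial b (G l) x)"
      by (rule sum.cong[OF refl]) (rule partial_cmult[OF pG])
    finally show ?thesis .
  qed
  have "\<exists>A F. A \<subseteq> I \<and> (\<forall>a\<in>A. F a \<in> \<L>) \<and>
    (\<forall>a\<in>A. \<forall>b\<in>A. partial b (F a) p = (if a = b then 1 else 0)) \<and>
    (\<forall>g\<in>\<L>. \<forall>b\<in>I. partial b g p = (\<Sum>a\<in>A. partial a g p * partial b (F a) p))"
  proof (rule gradient_echelon[OF I pL])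
    show "(\<lambda>x. 0) \<in> \<L>" unfolding \<L>_def by (intro CollectI exI[of _ "\<lambda>_. 0"]) simp
    fix f g c assume "f \<in> \<L>" "g \<in> \<L>"
    then obtain \<beta> \<gamma> where "f = (\<lambda>x. \<Sum>l\<in>L. \<beta> l * G l x)" "g = (\<lambda>x. \<Sum>l\<in>L. \<gamma> l * G l x)"
      by (auto simp: \<L>_def)
    then show "(\<lambda>x. f x + c * g x) \<in> \<L>" unfolding \<L>_def
      by (intro CollectI exI[of _ "\<lambda>l. \<beta> l + c * \<gamma> l"])
        (simp add: algebra_simps sum.distrib sum_distrib_left)
  qed
  then obtain A F where A: "A \<subseteq> I" and FL: "\<forall>a\<in>A. F a \<in> \<L>"
    and dF: "\<forall>a\<in>A. \<forall>b\<in>A. partial b (F a) p = (if a = b then 1 else 0)"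
    and gen: "\<forall>g\<in>\<L>. \<forall>b\<in>I. partial b g p = (\<Sum>a\<in>A. partial a g p * partial b (F a) p)"
    by (elim exE conjE)
  have finA: "finite A" using A I finite_subset by blast
  have "\<forall>a\<in>A. \<exists>\<beta>. F a = (\<lambda>x. \<Sum>l\<in>L. \<beta> l * G l x)" using FL unfolding \<L>_def by blast
  then have "\<exists>\<beta>. \<forall>a\<in>A. F a = (\<lambda>x. \<Sum>l\<in>L. \<beta> a l * G l x)" by (rule bchoice)
  then obtain \<beta> where \<beta>: "\<forall>a\<in>A. F a = (\<lambda>x. \<Sum>l\<in>L. \<beta> a l * G l x)" by (elim exE)
  have GL: "G l \<in> \<L>" if "l \<in> L" for l
    unfolding \<L>_def using that L
    by (intro CollectI exI[of _ "\<lambda>m. if m = l then 1 else 0"]) (simp add: if_distrib[of "\<lambda>c. c * _"] cong: if_cong)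
  have dFG: "partial b (F a) p = (\<Sum>l\<in>L. \<beta> a l * partial b (G l) p)" if "a \<in> A" for a b
    using \<beta> that dL by simp
  have card1: "card L \<le> card A"
    by (rule independent_gradients_card_le[OF finA L ind, where F = F]) (rule gen[rule_format, OF GL])
  have card2: "card A \<le> card L"
  proof (rule ccontr)
    assume "\<not> ?thesis"
    then obtain \<gamma> where \<gamma>: "\<exists>a\<in>A. \<gamma> a \<noteq> 0" "\<forall>l\<in>L. (\<Sum>a\<in>A. \<gamma> a * \<beta> a l) = 0"
      using homogeneous_system[OF L finA, of \<beta>] by auto
    from \<gamma>(1) obtain b where b: "b \<in> A" "\<gamma> b \<noteq> 0" by (elim bexE)
    have "(\<Sum>a\<in>A. \<gamma> a * partial b (F a) p) = (\<Sum>a\<in>A. \<Sum>l\<in>L. \<gamma> a * \<beta> a l * partial b (G l) p)"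
    proof (rule sum.cong[OF refl])
      fix a assume a: "a \<in> A"
      show "\<gamma> a * partial b (F a) p = (\<Sum>l\<in>L. \<gamma> a * \<beta> a l * partial b (G l) p)"
        by (subst dFG[OF a]) (simp add: sum_distrib_left mult.assoc)
    qed
    also have "\<dots> = (\<Sum>l\<in>L. (\<Sum>a\<in>A. \<gamma> a * \<beta> a l) * partial b (G l) p)"
      by (subst sum.swap) (simp only: sum_distrib_right)
    also have "\<dots> = 0" using \<gamma>(2) by (intro sum.neutral) simp
    finally have "(\<Sum>a\<in>A. \<gamma> a * partial b (F a) p) = 0" .
    moreover have "(\<Sum>a\<in>A. \<gamma> a * partial b (F a) p) = (\<Sum>a\<in>A. if a = b then \<gamma> b else 0)"
      by (rule sum.cong) (use dF b in auto)
    ultimately show False using b finA by simp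
  qed
  have FG: "F a q = 0" if "a \<in> A" "\<forall>l\<in>L. G l q = 0" for a q
    using \<beta> that by simp
  have GF: "G l q = 0" if l: "l \<in> L" and q: "\<forall>a\<in>A. F a q = 0" for l q
  proof -
    \<comment> \<open>\<open>G l\<close> and its expansion in the \<open>F a\<close> have the same
      gradient at \<open>p\<close>, so the coefficients of their difference are a relation among the
      gradients. Independence makes it trivial, and the expansion holds identically.\<close>
    define \<gamma> where "\<gamma> m = (if m = l then 1 else 0) - (\<Sum>a\<in>A. partial a (G l) p * \<beta> a m)" for m
    have e: "(\<Sum>m\<in>L. \<gamma> m * h m) = h l - (\<Sum>a\<in>A. partial a (G l) p * (\<Sum>m\<in>L. \<beta> a m * h m))" for h :: "'l \<Rightarrow> complex"
    proof -
      have "(\<Sum>m\<in>L. \<gamma> m * h m) = (\<Sum>m\<in>L. (if m = l then h m else 0)) - (\<Sum>m\<in>L. \<Sum>a\<in>A. partial a (G l) p * (\<beta> a m * h m))"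
        unfolding sum_subtractf[symmetric]
        by (rule sum.cong) (auto simp: \<gamma>_def algebra_simps sum_distrib_left)
      also have "(\<Sum>m\<in>L. \<Sum>a\<in>A. partial a (G l) p * (\<beta> a m * h m)) = (\<Sum>a\<in>A. partial a (G l) p * (\<Sum>m\<in>L. \<beta> a m * h m))"
        by (subst sum.swap) (simp add: sum_distrib_left)
      finally show ?thesis using l L by simp
    qed
    have "(\<Sum>m\<in>L. \<gamma> m * partial b (G m) p) = 0" if b: "b \<in> I" for b
    proof -
      have "(\<Sum>a\<in>A. partial a (G l) p * (\<Sum>m\<in>L. \<beta> a m * partial b (G m) p)) = partial b (G l) p"
        using gen GL[OF l] b by (simp add: dFG[symmetric])
      then show ?thesis unfolding e by simp
    qed
    then have "\<forall>m\<in>L. \<gamma> m = 0" using ind unfolding independent_gradients_def by blast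
    then have "(\<Sum>m\<in>L. \<gamma> m * G m q) = 0" by simp
    moreover have "(\<Sum>a\<in>A. partial a (G l) p * (\<Sum>m\<in>L. \<beta> a m * G m q)) = 0"
    proof (rule sum.neutral, intro ballI)
      fix a assume a: "a \<in> A"
      have "(\<Sum>m\<in>L. \<beta> a m * G m q) = F a q" using \<beta> a by simp
      then show "partial a (G l) p * (\<Sum>m\<in>L. \<beta> a m * G m q) = 0" using q a by simp
    qed
    ultimately show ?thesis unfolding e by simp
  qed
  have card: "card A = card L" using card1 card2 by simp
  have cardI: "card (I - A) = card I - card L" using card card_Diff_subset[OF finA A] by simp
  have "\<exists>\<sigma>. bij_betw \<sigma> {..<card I - card L} (I - A)"
    using ex_bij_betw_nat_finite[of "I - A"] I by (simp add: cardI atLeast0LessThan)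
  then obtain \<sigma> where \<sigma>: "bij_betw \<sigma> {..<card I - card L} (I - A)" by blast
  have pFA: "\<forall>a\<in>A. pfun I (F a)" "\<forall>a\<in>A. F a p = 0"
    using FL pL FG G0 by simp_all
  obtain \<epsilon> \<rho> \<Psi> where *: "0 < \<epsilon>" "\<epsilon> \<le> \<eta>" "0 < \<rho>" "\<rho> \<le> \<eta>"
    "\<forall>i. holomorphic_polydisc (card I - card L) \<epsilon> (\<lambda>\<tau>. \<Psi> \<tau> i)"
    "\<forall>\<tau>\<in>polydisc (card I - card L) \<epsilon>. (\<forall>i<card I - card L. \<Psi> \<tau> (\<sigma> i) = p (\<sigma> i) + \<tau> i) \<and>
      (\<forall>a\<in>A. norm (\<Psi> \<tau> a - p a) < \<rho> \<and> F a (\<Psi> \<tau>) = 0) \<and> (\<forall>i. i \<notin> I \<longrightarrow> \<Psi> \<tau> i = p i)"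
    "\<forall>\<tau>\<in>polydisc (card I - card L) \<epsilon>. \<forall>q. (\<forall>i<card I - card L. q (\<sigma> i) = p (\<sigma> i) + \<tau> i) \<longrightarrow>
      (\<forall>a\<in>A. norm (q a - p a) < \<rho> \<and> F a q = 0) \<longrightarrow> (\<forall>i\<in>I. q i = \<Psi> \<tau> i)"
    using implicit_function_echelon[OF I A pFA dF \<sigma> \<eta>] by (elim exE conjE)
  have IA: "I - (I - A) = A" using A by blast
  have "card L \<le> card I" using card card_mono[OF I A] by simp
  moreover have "\<forall>\<tau>\<in>polydisc (card I - card L) \<epsilon>. (\<forall>i<card I - card L. \<Psi> \<tau> (\<sigma> i) = p (\<sigma> i) + \<tau> i) \<and>
      (\<forall>a\<in>A. norm (\<Psi> \<tau> a - p a) < \<rho>) \<and> (\<forall>l\<in>L. G l (\<Psi> \<tau>) = 0) \<and> (\<forall>i. i \<notin> I \<longrightarrow> \<Psi> \<tau> i = p i)"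
    using *(6) GF by simp
  moreover have "\<forall>\<tau>\<in>polydisc (card I - card L) \<epsilon>. \<forall>q. (\<forall>i<card I - card L. q (\<sigma> i) = p (\<sigma> i) + \<tau> i) \<longrightarrow>
      (\<forall>a\<in>A. norm (q a - p a) < \<rho>) \<longrightarrow> (\<forall>l\<in>L. G l q = 0) \<longrightarrow> (\<forall>i\<in>I. q i = \<Psi> \<tau> i)"
    using *(7) FG by simp
  ultimately show ?thesis
    using *(1-5) \<sigma>
    by (intro conjI exI[of _ "I - A"] exI[of _ \<sigma>] exI[of _ \<epsilon>] exI[of _ \<rho>] exI[of _ \<Psi>]; (unfold IA)?) blast+
qed

text \<open>Any two parameters lie on a complex line whose part inside the polydisc is convex, hence
  connected; charts turn such lines into the curves that \<open>irreducible_closure_of\<close> asks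
  for.\<close>

lemma line_in_polydisc:
  assumes "e > 0" "\<tau>0 \<in> polydisc k e" "\<tau>1 \<in> polydisc k e"
  defines "w \<equiv> \<lambda>z i. \<tau>0 i + z * (\<tau>1 i - \<tau>0 i)"
  shows "open {z. w z \<in> polydisc k e}" "connected {z. w z \<in> polydisc k e}"
    "0 \<in> {z. w z \<in> polydisc k e}" "1 \<in> {z. w z \<in> polydisc k e}"
    "\<And>f. holomorphic_polydisc k e f \<Longrightarrow> (\<lambda>z. f (w z)) holomorphic_on {z. w z \<in> polydisc k e}"
proof -
  let ?\<Omega> = "{z. w z \<in> polydisc k e}"
  have \<Omega>: "?\<Omega> = (\<Inter>i\<in>{..<k}. {z. norm (w z i) < e})" by (auto simp: polydisc_def)
  have "open (\<Inter>i\<in>{..<k}. {z. norm (w z i) < e})"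
    unfolding w_def by (intro open_INT ballI open_Collect_less continuous_intros) auto
  then show op: "open ?\<Omega>" unfolding \<Omega> .
  have "convex {z. norm (w z i) < e}" for i
  proof (rule convexI)
    fix x y u v :: "real" and a b :: complex
    assume *: "a \<in> {z. norm (w z i) < e}" "b \<in> {z. norm (w z i) < e}" "0 \<le> u" "0 \<le> v" "u + v = 1"
    have "w (u *\<^sub>R a + v *\<^sub>R b) i = u *\<^sub>R w a i + v *\<^sub>R w b i"
    proof -
      have "u *\<^sub>R \<tau>0 i + v *\<^sub>R \<tau>0 i = \<tau>0 i" using *(5) by (simp add: scaleR_add_left[symmetric])
      then show ?thesis by (simp add: w_def scaleR_conv_of_real algebra_simps)
    qed
    then have "norm (w (u *\<^sub>R a + v *\<^sub>R b) i) \<le> u * norm (w a i) + v * norm (w b i)"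
      using *(3,4) norm_triangle_ineq[of "u *\<^sub>R w a i" "v *\<^sub>R w b i"] by simp
    also have "\<dots> < e" using * by (intro convex_bound_lt) auto
    finally show "u *\<^sub>R a + v *\<^sub>R b \<in> {z. norm (w z i) < e}" by simp
  qed
  then have "convex ?\<Omega>" unfolding \<Omega> by (intro convex_INT) auto
  then show "connected ?\<Omega>" by (rule convex_connected)
  show "0 \<in> ?\<Omega>" "1 \<in> ?\<Omega>" using assms by (auto simp: w_def polydisc_def)
  fix f assume "holomorphic_polydisc k e f"
  then obtain F where F: "\<forall>n. pfun {..<k} (F n)"
    "\<forall>r. 0 < r \<longrightarrow> r < e \<longrightarrow> uniform_limit (closed_polydisc k r) F f sequentially"
    unfolding holomorphic_polydisc_def by blast
  show "(\<lambda>z. f (w z)) holomorphic_on ?\<Omega>"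
  proof (rule holomorphic_uniform_sequence[OF op])
    show "(\<lambda>z. F n (w z)) holomorphic_on ?\<Omega>" for n
      by (rule pfun_holomorphic[OF F(1)[rule_format]]) (auto simp: w_def intro!: holomorphic_intros)
    fix z0 assume z0: "z0 \<in> ?\<Omega>"
    show "\<exists>d>0. cball z0 d \<subseteq> ?\<Omega> \<and> uniform_limit (cball z0 d) (\<lambda>n z. F n (w z)) (\<lambda>z. f (w z)) sequentially"
    proof -
      define m where "m = Max (insert 0 ((\<lambda>i. norm (w z0 i)) ` {..<k}))"
      have m: "0 \<le> m" "m < e" and mi: "norm (w z0 i) \<le> m" if "i < k" for i
        using z0 \<open>e > 0\<close> that unfolding m_def by (auto simp: polydisc_def)
      have m: "0 \<le> m" "m < e"
        using z0 \<open>e > 0\<close> unfolding m_def by (auto simp: polydisc_def)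
      define K where "K = (\<Sum>i<k. norm (\<tau>1 i - \<tau>0 i)) + 1"
      have K: "K \<ge> 1" unfolding K_def by (simp add: sum_nonneg)
      have Ki: "norm (\<tau>1 i - \<tau>0 i) \<le> K" if "i < k" for i
        using member_le_sum[of i "{..<k}" "\<lambda>i. norm (\<tau>1 i - \<tau>0 i)"] that unfolding K_def by auto
      \<comment> \<open>\<open>K\<close> bounds the speed of the line in each coordinate, so within
        distance \<open>d\<close> of \<open>z0\<close> no coordinate grows by more than
        \<open>(e - m) / 2\<close>, and the line stays in the closed polydisc of radius
        \<open>(m + e) / 2\<close>.\<close>
      define d where "d = (e - m) / (2 * K)"
      have d: "d > 0" using m K by (simp add: d_def)
      have "d * K = (e - m) / 2" using K by (simp add: d_def)
      have sub: "w z \<in> closed_polydisc k ((m + e) / 2)" if z: "z \<in> cball z0 d" for z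
        unfolding closed_polydisc_def
      proof (intro CollectI allI impI)
        fix i assume i: "i < k"
        have "w z i = w z0 i + (z - z0) * (\<tau>1 i - \<tau>0 i)" by (simp add: w_def algebra_simps)
        then have "norm (w z i) \<le> norm (w z0 i) + norm (z - z0) * norm (\<tau>1 i - \<tau>0 i)"
          by (metis norm_triangle_ineq norm_mult)
        also have "\<dots> \<le> m + d * K"
          using mi[OF i] Ki[OF i] z d by (intro add_mono mult_mono) (auto simp: dist_norm norm_minus_commute)
        also have "\<dots> = (m + e) / 2" using \<open>d * K = (e - m) / 2\<close> by (simp add: field_simps)
        finally show "norm (w z i) \<le> (m + e) / 2" .
      qed
      have "uniform_limit (closed_polydisc k ((m + e) / 2)) F f sequentially" using F(2) m by simp
      then have "uniform_limit (cball z0 d) (\<lambda>n z. F n (w z)) (\<lambda>z. f (w z)) sequentially"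
        by (rule uniform_limit_compose') (use sub in auto)
      moreover have "cball z0 d \<subseteq> ?\<Omega>"
        using sub m by (fastforce simp: closed_polydisc_def polydisc_def)
      ultimately show ?thesis using d by blast
    qed
  qed
qed

lemma holomorphic_zero_product:
  assumes "open \<Omega>" "connected \<Omega>" "f holomorphic_on \<Omega>" "g holomorphic_on \<Omega>"
    and "\<And>z. z \<in> \<Omega> \<Longrightarrow> f z * g z = 0" "z0 \<in> \<Omega>" "f z0 \<noteq> 0" "z \<in> \<Omega>"
  shows "g z = 0"
proof -
  have "continuous_on \<Omega> f" by (rule holomorphic_on_imp_continuous_on) fact
  then have "open (\<Omega> \<inter> f -` (- {0}))" using assms(1) by (intro continuous_open_preimage) auto
  moreover have "\<Omega> \<inter> f -` (- {0}) \<noteq> {}" using assms(6,7) by blast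
  ultimately show ?thesis
    using analytic_continuation_open[of "\<Omega> \<inter> f -` (- {0})" \<Omega> g "\<lambda>_. 0" z] assms by fastforce
qed

text \<open>A product of two polynomials vanishing on a connected holomorphic curve has a factor vanishing on
  it, so two points on such a curve are not separated by a decomposition.\<close>

lemma irreducible_closure_of:
  assumes I: "\<Gamma> \<subseteq> coord_space I" "\<exists>q\<in>\<Gamma>. \<exists>i. q i \<noteq> 0"
    and curve: "\<And>q r. q \<in> \<Gamma> \<Longrightarrow> r \<in> \<Gamma> \<Longrightarrow> \<exists>w \<Omega> z0 z1. open \<Omega> \<and> connected \<Omega> \<and>
      (\<forall>i\<in>I. (\<lambda>z. w z i) holomorphic_on \<Omega>) \<and> z0 \<in> \<Omega> \<and> z1 \<in> \<Omega> \<and> w z0 = q \<and> w z1 = r \<and> w ` \<Omega> \<subseteq> \<Gamma>"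
  shows "irreducible_in (zariski_proj I) (zariski_proj I closure_of {proj_pt q |q. q \<in> \<Gamma> \<and> (\<exists>i. q i \<noteq> 0)})"
    (is "irreducible_in ?T (?T closure_of ?Z)")
  unfolding irreducible_in_def
proof (intro conjI allI impI)
  have Z: "?Z \<subseteq> proj_space I" using I(1) by (auto intro: proj_pt_in_proj_space)
  then have Zc: "?Z \<subseteq> ?T closure_of ?Z" by (simp add: closure_of_subset)
  show "?T closure_of ?Z \<subseteq> topspace ?T" by (rule closure_of_subset_topspace)
  show "?T closure_of ?Z \<noteq> {}" using Zc I(2) by blast
  fix A B assume AB: "closedin ?T A \<and> closedin ?T B \<and> ?T closure_of ?Z \<subseteq> A \<union> B"
  have sep: "\<exists>q f. q \<in> \<Gamma> \<and> (\<exists>i. q i \<noteq> 0) \<and> pfun I f \<and> f q \<noteq> 0 \<and> (\<forall>r. proj_pt r \<in> A \<longrightarrow> f r = 0)"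
    if A: "closedin ?T A" and nA: "\<not> ?Z \<subseteq> A" for A
  proof -
    obtain q where q: "q \<in> \<Gamma>" "\<exists>i. q i \<noteq> 0" "proj_pt q \<notin> A" using nA by blast
    have U: "openin ?T (proj_space I - A)" "proj_pt q \<in> proj_space I - A"
      using A q Z by (auto simp: closedin_def)
    obtain D f where f: "hfun I D f" "\<forall>p\<in>proj_pt q. f p \<noteq> 0" "\<forall>y\<in>proj_space I - (proj_space I - A). \<forall>p\<in>y. f p = 0"
      using zariski_basic_neighbourhood[OF U] by (elim exE conjE)
    have "A \<subseteq> proj_space I" using A by (simp add: closedin_def)
    then have "f r = 0" if "proj_pt r \<in> A" for r using f(3) proj_pt_self[of r] that by blast
    moreover have "f q \<noteq> 0" using f(2) proj_pt_self[of q] by blast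
    ultimately show ?thesis using q hfun_imp_pfun[OF f(1)] by (intro exI[of _ q] exI[of _ f]) simp
  qed
  show "?T closure_of ?Z \<subseteq> A \<or> ?T closure_of ?Z \<subseteq> B"
  proof (rule ccontr)
    assume neg: "\<not> ?thesis"
    then have nA: "\<not> ?Z \<subseteq> A" and nB: "\<not> ?Z \<subseteq> B"
      using AB closure_of_minimal[of ?Z _ ?T] by blast+
    obtain q f where q: "q \<in> \<Gamma>" "\<exists>i. q i \<noteq> 0" "pfun I f" "f q \<noteq> 0" "\<forall>r. proj_pt r \<in> A \<longrightarrow> f r = 0"
      using sep[OF _ nA] AB by blast
    obtain r g where r: "r \<in> \<Gamma>" "pfun I g" "g r \<noteq> 0" "\<forall>r. proj_pt r \<in> B \<longrightarrow> g r = 0"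
      using sep[OF _ nB] AB by blast
    obtain w \<Omega> z0 z1 where w: "open \<Omega>" "connected \<Omega>" "\<forall>i\<in>I. (\<lambda>z. w z i) holomorphic_on \<Omega>"
      "z0 \<in> \<Omega>" "z1 \<in> \<Omega>" "w z0 = q" "w z1 = r" "w ` \<Omega> \<subseteq> \<Gamma>"
      using curve[OF q(1) r(1)] by (elim exE conjE)
    obtain j where j: "q j \<noteq> 0" using q(2) by blast
    then have jI: "j \<in> I" using q(1) I(1) by (auto simp: coord_space_def)
    have h: "(\<lambda>z. f (w z)) holomorphic_on \<Omega>" "(\<lambda>z. g (w z)) holomorphic_on \<Omega>" "(\<lambda>z. w z j) holomorphic_on \<Omega>"
      using pfun_holomorphic[OF q(3)] pfun_holomorphic[OF r(2)] w(3) jI by blast+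
    \<comment> \<open>The factor \<open>w z j\<close> takes care of parameters at which the curve
      may pass through the zero vector, which represents no point. It is nonzero at
      \<open>z0\<close>.\<close>
    have "f (w z) * w z j * g (w z) = 0" if z: "z \<in> \<Omega>" for z
    proof (cases "w z j = 0")
      case False
      then have "proj_pt (w z) \<in> ?Z" using w(8) z by blast
      then have "proj_pt (w z) \<in> A \<or> proj_pt (w z) \<in> B" using Zc AB by blast
      then show ?thesis using q(5) r(4) by auto
    qed simp
    then have "g (w z1) = 0"
      using holomorphic_zero_product[OF w(1,2) holomorphic_on_mult[OF h(1,3)] h(2) _ w(4) _ w(5)] w(6) q(4) j by auto
    then show False using r(3) w(7) by simp
  qed
qed

section \<open>Chains and local dimension from a chart\<close>

lemma hfun_1_zero: "hfun I 1 f \<Longrightarrow> f (\<lambda>_. 0) = (0::complex)"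
  using hfun_scale[of I 1 f 0 "\<lambda>_. 0"] by simp

text \<open>As \<open>lf\<close> is constant and nonzero along the chart, its vectors are nonzero
  and distinct parameters in the polydisc are not identified by rescaling; this keeps the slices
  apart in projective space.\<close>

lemma local_chain:
  fixes \<Psi> :: "(nat \<Rightarrow> complex) \<Rightarrow> 'i \<Rightarrow> complex"
  assumes V: "closedin (zariski_proj I) V" and lf: "hfun I 1 lf" "lf p \<noteq> 0" and e: "e > 0"
    and hol: "\<And>i. holomorphic_polydisc k e (\<lambda>\<tau>. \<Psi> \<tau> i)"
    and \<Psi>\<sigma>: "\<And>\<tau> i. \<tau> \<in> polydisc k e \<Longrightarrow> i < k \<Longrightarrow> \<Psi> \<tau> (\<sigma> i) = p (\<sigma> i) + \<tau> i"
    and \<sigma>: "\<And>i. i < k \<Longrightarrow> \<sigma> i \<in> I"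
    and \<Psi>: "\<And>\<tau>. \<tau> \<in> polydisc k e \<Longrightarrow> \<Psi> \<tau> \<in> coord_space I \<and> lf (\<Psi> \<tau>) = lf p \<and> proj_pt (\<Psi> \<tau>) \<in> V"
  shows "\<exists>Z. irreducible_chain (zariski_proj I) V k Z \<and> proj_pt (\<Psi> (\<lambda>_. 0)) \<in> Z 0"
proof -
  let ?T = "zariski_proj I"
  define P where "P s = {\<tau> \<in> polydisc k e. \<forall>i. s \<le> i \<longrightarrow> \<tau> i = 0}" for s
  define Z where "Z s = ?T closure_of {proj_pt q |q. q \<in> \<Psi> ` P s \<and> (\<exists>i. q i \<noteq> 0)}" for s
  have nz: "\<exists>i. \<Psi> \<tau> i \<noteq> 0" if "\<tau> \<in> polydisc k e" for \<tau>
  proof (rule ccontr)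
    assume "\<not> ?thesis"
    then have "\<Psi> \<tau> = (\<lambda>_. 0)" by auto
    then show False using hfun_1_zero[OF lf(1)] \<Psi>[OF that] lf(2) by simp
  qed
  have Ps: "P s \<subseteq> polydisc k e" for s by (auto simp: P_def)
  have sub: "{proj_pt q |q. q \<in> \<Psi> ` P s \<and> (\<exists>i. q i \<noteq> 0)} \<subseteq> V" for s using \<Psi> Ps by blast
  have sub': "{proj_pt q |q. q \<in> \<Psi> ` P s \<and> (\<exists>i. q i \<noteq> 0)} \<subseteq> Z s" for s
    unfolding Z_def by (rule closure_of_subset[OF subset_trans[OF sub closedin_subset[OF V]]])
  have inZ: "proj_pt (\<Psi> \<tau>) \<in> Z s" if "\<tau> \<in> P s" for s \<tau>
  proof (rule subsetD[OF sub'], intro CollectI exI conjI)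
    show "\<Psi> \<tau> \<in> \<Psi> ` P s" using that by simp
    show "\<Psi> \<tau> (SOME i. \<Psi> \<tau> i \<noteq> 0) \<noteq> 0" by (rule someI_ex[OF nz[OF subsetD[OF Ps that]]])
  qed simp
  have zero: "(\<lambda>_. 0) \<in> P s" for s using e by (auto simp: P_def polydisc_def)
  have irr: "irreducible_in ?T (Z s)" for s
    unfolding Z_def
  proof (rule irreducible_closure_of)
    show "\<Psi> ` P s \<subseteq> coord_space I" using \<Psi> subsetD[OF Ps] by (intro image_subsetI) simp
    show "\<exists>q\<in>\<Psi> ` P s. \<exists>i. q i \<noteq> 0" using nz[OF subsetD[OF Ps zero]] zero by (intro bexI[of _ "\<Psi> (\<lambda>_. 0)"]) simp_all
    fix q r assume "q \<in> \<Psi> ` P s" "r \<in> \<Psi> ` P s"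
    then obtain a b where ab: "a \<in> P s" "q = \<Psi> a" "b \<in> P s" "r = \<Psi> b" by blast
    have pd: "a \<in> polydisc k e" "b \<in> polydisc k e" using subsetD[OF Ps] ab by simp_all
    let ?w = "\<lambda>z i. a i + z * (b i - a i)"
    let ?\<Omega> = "{z. ?w z \<in> polydisc k e}"
    note L = line_in_polydisc[OF e pd]
    have "?w 0 = a" "?w 1 = b" by auto
    moreover have "?w z \<in> P s" if "z \<in> ?\<Omega>" for z using that ab by (auto simp: P_def)
    ultimately show "\<exists>w \<Omega> z0 z1. open \<Omega> \<and> connected \<Omega> \<and> (\<forall>i\<in>I. (\<lambda>z. w z i) holomorphic_on \<Omega>) \<and>
        z0 \<in> \<Omega> \<and> z1 \<in> \<Omega> \<and> w z0 = q \<and> w z1 = r \<and> w ` \<Omega> \<subseteq> \<Psi> ` P s"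
      using L(1-4) L(5)[OF hol] ab
      by (intro exI[of _ "\<lambda>z. \<Psi> (?w z)"] exI[of _ ?\<Omega>] exI[of _ 0] exI[of _ 1]) auto
  qed
  have "Z s \<subset> Z (Suc s)" if s: "s < k" for s
  proof
    have "P s \<subseteq> P (Suc s)" by (auto simp: P_def)
    then show "Z s \<subseteq> Z (Suc s)" unfolding Z_def by (intro closure_of_mono) blast
    \<comment> \<open>The homogeneous version of the parameter \<open>\<tau> s\<close>: on the chart
      it equals \<open>lf p * \<tau> s\<close>, so it vanishes on the slice \<open>s\<close> and not
      on the next one.\<close>
    define h where "h q = lf p * q (\<sigma> s) - p (\<sigma> s) * lf q" for q
    have h: "hfun I 1 h" unfolding h_def
      by (intro hfun_diff hfun_cmult lf(1) hfun.coord \<sigma> s)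
    have h\<Psi>: "h (\<Psi> \<tau>) = lf p * \<tau> s" if "\<tau> \<in> polydisc k e" for \<tau>
      using \<Psi>[OF that] \<Psi>\<sigma>[OF that s] by (simp add: h_def algebra_simps)
    let ?C = "{x \<in> proj_space I. \<forall>p\<in>x. h p = 0}"
    have "Z s \<subseteq> ?C"
      unfolding Z_def
    proof (rule closure_of_minimal[OF _ closedin_hfun[OF h]], safe)
      fix q i \<tau> assume \<tau>: "\<tau> \<in> P s" "\<Psi> \<tau> i \<noteq> 0"
      have pd: "\<tau> \<in> polydisc k e" by (rule subsetD[OF Ps \<tau>(1)])
      show "proj_pt (\<Psi> \<tau>) \<in> proj_space I" using \<Psi>[OF pd] \<tau>(2) by (intro proj_pt_in_proj_space) auto
      fix r assume "r \<in> proj_pt (\<Psi> \<tau>)"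
      moreover have "h (\<Psi> \<tau>) = 0" using h\<Psi>[OF pd] \<tau>(1) by (simp add: P_def)
      ultimately show "h r = 0"
        using hfun_zero_on_class[OF h \<open>proj_pt (\<Psi> \<tau>) \<in> proj_space I\<close> proj_pt_self] by blast
    qed
    moreover have "\<exists>x\<in>Z (Suc s). x \<notin> ?C"
    proof -
      define \<tau> where "\<tau> i = (if i = s then of_real (e / 2) else (0::complex))" for i
      have \<tau>: "\<tau> \<in> P (Suc s)" using e by (auto simp: P_def \<tau>_def polydisc_def)
      have "\<tau> s \<noteq> 0" using e by (simp add: \<tau>_def)
      then have "h (\<Psi> \<tau>) \<noteq> 0" using h\<Psi>[OF subsetD[OF Ps \<tau>]] lf(2) by simp
      then show ?thesis using inZ[OF \<tau>] proj_pt_self[of "\<Psi> \<tau>"] by blast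
    qed
    ultimately show "Z s \<noteq> Z (Suc s)" by blast
  qed
  moreover have "Z s \<subseteq> V" for s unfolding Z_def by (rule closure_of_minimal[OF sub V])
  moreover have "closedin ?T (Z s)" for s unfolding Z_def by (rule closedin_closure_of)
  ultimately have "irreducible_chain ?T V k Z"
    using irr unfolding irreducible_chain_def by simp
  then show ?thesis using inZ[OF zero] by blast
qed

lemma irreducible_chain_mono: "irreducible_chain T V m Z \<Longrightarrow> i \<le> m \<Longrightarrow> Z 0 \<subseteq> Z i"
proof (induction i)
  case (Suc i)
  then have "Z i \<subset> Z (Suc i)" by (simp add: irreducible_chain_def)
  then show ?case using Suc by fastforce
qed simp

text \<open>The extra equation \<open>lf q = lf p\<close> cuts the cone in a slice meeting each line
  near that of \<open>p\<close> once, so the number of parameters is the projective dimension. The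
  assumption \<open>loc\<close> says that near \<open>p\<close> the equations suffice for membership
  in \<open>V\<close>.\<close>

lemma local_dimension:
  fixes G :: "'l \<Rightarrow> ('i \<Rightarrow> complex) \<Rightarrow> complex"
  assumes I: "finite I" and V: "closedin (zariski_proj I) V" and x: "proj_pt p \<in> V"
    and p: "p \<in> coord_space I" and lf: "hfun I 1 lf" "lf p \<noteq> 0"
    and L: "finite L" and G: "\<And>l. l \<in> L \<Longrightarrow> G l \<in> vanishing_on I V"
    and ind: "independent_gradients I (insert None (Some ` L)) (case_option (\<lambda>q. lf q - lf p) G) p"
    and ind': "independent_gradients I L G p"
    and \<eta>: "\<eta> > 0" and loc: "\<And>q. q \<in> coord_space I \<Longrightarrow> (\<forall>i\<in>I. norm (q i - p i) < \<eta>) \<Longrightarrow>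
      lf q = lf p \<Longrightarrow> (\<forall>l\<in>L. G l q = 0) \<Longrightarrow> proj_pt q \<in> V"
  shows "Suc (card L) \<le> card I" "local_krull_dim (zariski_proj I) V (proj_pt p) = enat (card I - Suc (card L))"
    "vector_space.dim fun_scale (cone_tangent_space I V p) = card I - card L"
    "\<exists>Z. irreducible_chain (zariski_proj I) V (card I - Suc (card L)) Z \<and> proj_pt p \<in> Z 0"
proof -
  let ?L = "insert None (Some ` L)" and ?G = "case_option (\<lambda>q. lf q - lf p) G"
  have cL: "card ?L = Suc (card L)" using L by (simp add: card_insert_if card_image)
  have VP: "V \<subseteq> proj_space I" using closedin_subset[OF V] by simp
  have pG: "pfun I (?G l)" "?G l p = 0" if "l \<in> ?L" for l
    using that G x proj_pt_self[of p] pfun_diff[OF hfun_imp_pfun[OF lf(1)] pfun.const, of "lf p"]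
    by (auto simp: vanishing_on_def)
  define k where "k = card I - Suc (card L)"
  have "card ?L \<le> card I \<and> (\<exists>S \<sigma> \<epsilon> \<rho> \<Psi>. S \<subseteq> I \<and> bij_betw \<sigma> {..<k} S \<and>
    0 < \<epsilon> \<and> \<epsilon> \<le> \<eta> \<and> 0 < \<rho> \<and> \<rho> \<le> \<eta> \<and> (\<forall>i. holomorphic_polydisc k \<epsilon> (\<lambda>\<tau>. \<Psi> \<tau> i)) \<and>
    (\<forall>\<tau>\<in>polydisc k \<epsilon>. (\<forall>i<k. \<Psi> \<tau> (\<sigma> i) = p (\<sigma> i) + \<tau> i) \<and>
      (\<forall>a\<in>I - S. norm (\<Psi> \<tau> a - p a) < \<rho>) \<and> (\<forall>l\<in>?L. ?G l (\<Psi> \<tau>) = 0) \<and> (\<forall>i. i \<notin> I \<longrightarrow> \<Psi> \<tau> i = p i)) \<and>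
    (\<forall>\<tau>\<in>polydisc k \<epsilon>. \<forall>q. (\<forall>i<k. q (\<sigma> i) = p (\<sigma> i) + \<tau> i) \<longrightarrow>
      (\<forall>a\<in>I - S. norm (q a - p a) < \<rho>) \<longrightarrow> (\<forall>l\<in>?L. ?G l q = 0) \<longrightarrow> (\<forall>i\<in>I. q i = \<Psi> \<tau> i)))"
    unfolding k_def cL[symmetric]
    by (rule implicit_function[OF I _ pG ind \<eta>]) (use L in auto)
  then obtain S \<sigma> \<epsilon> \<rho> \<Psi> where c: "card ?L \<le> card I" and S: "S \<subseteq> I" "bij_betw \<sigma> {..<k} S"
    and \<epsilon>: "0 < \<epsilon>" "\<epsilon> \<le> \<eta>" "0 < \<rho>" "\<rho> \<le> \<eta>" and hol: "\<forall>i. holomorphic_polydisc k \<epsilon> (\<lambda>\<tau>. \<Psi> \<tau> i)"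
    and \<Psi>: "\<forall>\<tau>\<in>polydisc k \<epsilon>. (\<forall>i<k. \<Psi> \<tau> (\<sigma> i) = p (\<sigma> i) + \<tau> i) \<and>
      (\<forall>a\<in>I - S. norm (\<Psi> \<tau> a - p a) < \<rho>) \<and> (\<forall>l\<in>?L. ?G l (\<Psi> \<tau>) = 0) \<and> (\<forall>i. i \<notin> I \<longrightarrow> \<Psi> \<tau> i = p i)"
    and uniq: "\<forall>\<tau>\<in>polydisc k \<epsilon>. \<forall>q. (\<forall>i<k. q (\<sigma> i) = p (\<sigma> i) + \<tau> i) \<longrightarrow>
      (\<forall>a\<in>I - S. norm (q a - p a) < \<rho>) \<longrightarrow> (\<forall>l\<in>?L. ?G l q = 0) \<longrightarrow> (\<forall>i\<in>I. q i = \<Psi> \<tau> i)"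
    by (elim exE conjE)
  show c': "Suc (card L) \<le> card I" using c cL by simp
  have \<sigma>I: "\<sigma> i \<in> I" if "i < k" for i using bij_betw_apply[OF S(2)] S(1) that by auto
  have \<Psi>V: "\<Psi> \<tau> \<in> coord_space I \<and> lf (\<Psi> \<tau>) = lf p \<and> proj_pt (\<Psi> \<tau>) \<in> V" if \<tau>: "\<tau> \<in> polydisc k \<epsilon>" for \<tau>
  proof -
    have cs: "\<Psi> \<tau> \<in> coord_space I" using \<Psi> \<tau> p by (simp add: coord_space_def)
    have "?G None (\<Psi> \<tau>) = 0" using \<Psi> \<tau> by blast
    then have l: "lf (\<Psi> \<tau>) = lf p" by simp
    have g: "\<forall>l\<in>L. G l (\<Psi> \<tau>) = 0"
    proof
      fix l assume "l \<in> L"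
      then have "?G (Some l) (\<Psi> \<tau>) = 0" using \<Psi> \<tau> by blast
      then show "G l (\<Psi> \<tau>) = 0" by simp
    qed
    have "norm (\<Psi> \<tau> i - p i) < \<eta>" if i: "i \<in> I" for i
    proof (cases "i \<in> S")
      case True
      then obtain m where m: "m < k" "i = \<sigma> m" using S(2) by (auto simp: bij_betw_def)
      then have "\<Psi> \<tau> i - p i = \<tau> m" using \<Psi> \<tau> by simp
      then show ?thesis using \<tau> m(1) \<epsilon>(2) by (auto simp: polydisc_def)
    next
      case False
      then have "norm (\<Psi> \<tau> i - p i) < \<rho>" using \<Psi> \<tau> i by blast
      then show ?thesis using \<epsilon>(4) by simp
    qed
    then show ?thesis using loc[OF cs _ l g] cs l by blast
  qed
  have z: "(\<lambda>_. 0) \<in> polydisc k \<epsilon>" using \<epsilon> by (simp add: polydisc_def)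
  have "\<forall>i\<in>I. p i = \<Psi> (\<lambda>_. 0) i"
    using uniq[rule_format, OF z, of p] pG(2) \<epsilon>(3) by simp
  moreover have "\<Psi> (\<lambda>_. 0) i = p i" if "i \<notin> I" for i using \<Psi> z that by blast
  ultimately have \<Psi>0: "\<Psi> (\<lambda>_. 0) = p" by (intro ext) metis
  have \<Psi>\<sigma>: "\<Psi> \<tau> (\<sigma> i) = p (\<sigma> i) + \<tau> i" if "\<tau> \<in> polydisc k \<epsilon>" "i < k" for \<tau> i using \<Psi> that by blast
  show ch: "\<exists>Z. irreducible_chain (zariski_proj I) V (card I - Suc (card L)) Z \<and> proj_pt p \<in> Z 0"
    using local_chain[OF V lf \<epsilon>(1) hol[rule_format] \<Psi>\<sigma> \<sigma>I \<Psi>V] unfolding \<Psi>0 k_def by simp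
  let ?d = "vector_space.dim fun_scale (cone_tangent_space I V p)"
  \<comment> \<open>A squeeze: the equations bound the tangent space from above, every chain
    starting at the point bounds it from below, and the chain of the chart attains the
    bound.\<close>
  have d1: "?d + card L \<le> card I" by (rule dim_tangent_le[OF I VP L ind' G])
  have d2: "Suc m \<le> ?d" if "irreducible_chain (zariski_proj I) V m Z" "proj_pt p \<in> Z 0" for m Z
    using chain_le_dim_tangent[OF I VP that(1) _ proj_pt_self[of p]] irreducible_chain_mono[OF that(1), of m] that(2)
    by blast
  have d3: "Suc k \<le> ?d" using ch d2 unfolding k_def by blast
  show "?d = card I - card L" using d1 d3 c' by (simp add: k_def)
  show "local_krull_dim (zariski_proj I) V (proj_pt p) = enat (card I - Suc (card L))"
    unfolding local_krull_dim_def
  proof (rule antisym)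
    show "Sup {enat m |m. \<exists>Z. irreducible_chain (zariski_proj I) V m Z \<and> proj_pt p \<in> Z 0} \<le> enat (card I - Suc (card L))"
    proof (rule Sup_least, safe)
      fix m Z assume "irreducible_chain (zariski_proj I) V m Z" "proj_pt p \<in> Z 0"
      then have "Suc m \<le> ?d" by (rule d2)
      then show "enat m \<le> enat (card I - Suc (card L))" using d1 by simp
    qed
    show "enat (card I - Suc (card L)) \<le> Sup {enat m |m. \<exists>Z. irreducible_chain (zariski_proj I) V m Z \<and> proj_pt p \<in> Z 0}"
      by (rule Sup_upper) (use ch in blast)
  qed
qed

section \<open>Graphical models inside the torus\<close>

declare One_nat_def [simp del]

definition support :: "nat \<Rightarrow> (nat \<Rightarrow> nat) \<Rightarrow> nat set" where
  "support n j = {i \<in> {1..n}. j i \<noteq> 1}"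

definition reset :: "nat set \<Rightarrow> (nat \<Rightarrow> nat) \<Rightarrow> nat \<Rightarrow> nat" where
  "reset A j = (\<lambda>i. if i \<in> A then 1 else j i)"

text \<open>The coordinates of the torus part of the model: the profiles deviating from the all-ones
  profile on a clique.\<close>

definition clique_profiles :: "nat \<Rightarrow> (nat \<Rightarrow> nat) \<Rightarrow> nat set set \<Rightarrow> (nat \<Rightarrow> nat) set" where
  "clique_profiles n d E = {j \<in> profiles n d. clique (support n j) E}"

definition nonedge :: "nat \<Rightarrow> nat set set \<Rightarrow> (nat \<Rightarrow> nat) \<Rightarrow> nat \<times> nat" where
  "nonedge n E j = (SOME (a, b). a \<in> support n j \<and> b \<in> support n j \<and> a \<noteq> b \<and> {a, b} \<notin> E)"

text \<open>The pairwise Markov binomial at a non-adjacent pair in the support of \<open>j\<close>; meaningful only if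
  the support is not a clique.\<close>

definition markov :: "nat \<Rightarrow> nat set set \<Rightarrow> (nat \<Rightarrow> nat) \<Rightarrow> ((nat \<Rightarrow> nat) \<Rightarrow> complex) \<Rightarrow> complex" where
  "markov n E j p = (case nonedge n E j of (a, b) \<Rightarrow>
     p j * p (reset {a, b} j) - p (reset {a} j) * p (reset {b} j))"

locale game_model =
  fixes n :: nat and d :: "nat \<Rightarrow> nat" and E :: "nat set set"
  assumes strategies: "\<And>i. i \<in> {1..n} \<Longrightarrow> 1 \<le> d i"
begin

abbreviation "I \<equiv> profiles n d"
abbreviation "\<Theta> \<equiv> clique_profiles n d E"

lemma finite_profiles [simp]: "finite I"
  unfolding profiles_on_def by (intro finite_PiE) auto

lemma reset_profiles: "j \<in> I \<Longrightarrow> A \<subseteq> {1..n} \<Longrightarrow> reset A j \<in> I"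
  using strategies unfolding profiles_on_def reset_def by (auto simp: PiE_iff extensional_def)

lemma support_reset: "support n (reset A j) = support n j - A"
  by (auto simp: support_def reset_def)

lemma finite_support [simp]: "finite (support n j)"
  by (simp add: support_def)

lemma support_subset: "support n j \<subseteq> {1..n}"
  by (auto simp: support_def)

lemma nonedge:
  assumes "j \<in> I - \<Theta>" "nonedge n E j = (a, b)"
  shows "a \<in> support n j" "b \<in> support n j" "a \<noteq> b" "{a, b} \<notin> E"
proof -
  have "\<exists>x. case x of (a, b) \<Rightarrow> a \<in> support n j \<and> b \<in> support n j \<and> a \<noteq> b \<and> {a, b} \<notin> E"
    using assms(1) unfolding clique_profiles_def clique_def by auto
  then have "case nonedge n E j of (a, b) \<Rightarrow> a \<in> support n j \<and> b \<in> support n j \<and> a \<noteq> b \<and> {a, b} \<notin> E"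
    unfolding nonedge_def by (rule someI_ex)
  then show "a \<in> support n j" "b \<in> support n j" "a \<noteq> b" "{a, b} \<notin> E" using assms(2) by auto
qed

lemma markov_resets:
  assumes "j \<in> I - \<Theta>" "nonedge n E j = (a, b)"
  shows "reset {a, b} j \<in> I" "reset {a} j \<in> I" "reset {b} j \<in> I"
    "card (support n (reset {a, b} j)) < card (support n j)"
    "card (support n (reset {a} j)) < card (support n j)" "card (support n (reset {b} j)) < card (support n j)"
proof -
  note ne = nonedge[OF assms]
  have ab: "a \<in> {1..n}" "b \<in> {1..n}" using ne support_subset by blast+
  show "reset {a, b} j \<in> I" "reset {a} j \<in> I" "reset {b} j \<in> I"
    using assms(1) ab by (auto intro!: reset_profiles)
  show "card (support n (reset {a, b} j)) < card (support n j)"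
    "card (support n (reset {a} j)) < card (support n j)" "card (support n (reset {b} j)) < card (support n j)"
    unfolding support_reset by (rule psubset_card_mono[OF finite_support]; use ne in blast)+
qed

lemma hfun_markov: "j \<in> I - \<Theta> \<Longrightarrow> hfun I 2 (markov n E j)"
proof -
  assume j: "j \<in> I - \<Theta>"
  obtain a b where ab: "nonedge n E j = (a, b)" by fastforce
  note r = markov_resets(1-3)[OF j ab]
  have "hfun I (1 + 1) (\<lambda>p. p j * p (reset {a, b} j) - p (reset {a} j) * p (reset {b} j) :: complex)"
    using r j by (intro hfun_diff hfun.mult hfun.coord) auto
  then show ?thesis unfolding markov_def[abs_def] ab by simp
qed

lemma finite_max_cliques [simp]: "finite (max_cliques n E)"
  by (rule finite_subset[of _ "Pow {1..n}"]) (auto simp: max_cliques_def)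

text \<open>The two sides agree clique by clique: \<open>a\<close> and \<open>b\<close> are not
  adjacent, so each clique misses one of them, and resetting the missing one does not change the
  restriction to the clique.\<close>

lemma clique_param_markov: "j \<in> I - \<Theta> \<Longrightarrow> markov n E j (clique_param n d E \<sigma>) = 0"
proof -
  assume j: "j \<in> I - \<Theta>"
  obtain a b where ab: "nonedge n E j = (a, b)" by fastforce
  note r = markov_resets(1-3)[OF j ab] and ne = nonedge[OF j ab]
  have "\<sigma> C (restrict j C) * \<sigma> C (restrict (reset {a, b} j) C) =
      \<sigma> C (restrict (reset {a} j) C) * \<sigma> C (restrict (reset {b} j) C)" if "C \<in> max_cliques n E" for C
  proof -
    have "a \<notin> C \<or> b \<notin> C" using that ne by (auto simp: max_cliques_def clique_def)
    then show ?thesis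
    proof
      assume "a \<notin> C"
      then have "restrict j C = restrict (reset {a} j) C" "restrict (reset {a, b} j) C = restrict (reset {b} j) C"
        by (auto simp: restrict_def reset_def fun_eq_iff)
      then show ?thesis by simp
    next
      assume "b \<notin> C"
      then have "restrict j C = restrict (reset {b} j) C" "restrict (reset {a, b} j) C = restrict (reset {a} j) C"
        by (auto simp: restrict_def reset_def fun_eq_iff)
      then show ?thesis by simp
    qed
  qed
  then show ?thesis
    using j r unfolding markov_def ab clique_param_def by (simp add: prod.distrib[symmetric])
qed

lemma clique_param_coord_space: "clique_param n d E \<sigma> \<in> coord_space I"
  by (simp add: clique_param_def coord_space_def)

lemma clique_param_proj_space:
  "clique_param n d E \<sigma> j \<noteq> 0 \<Longrightarrow> proj_pt (clique_param n d E \<sigma>) \<in> proj_space I"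
  by (rule proj_pt_in_proj_space[OF clique_param_coord_space])

lemma closedin_graphical_model: "closedin (zariski_proj I) (graphical_model n d E)"
  unfolding graphical_model_def by (rule closedin_closure_of)

lemma graphical_model_markov:
  assumes "x \<in> graphical_model n d E" "p \<in> x" "j \<in> I - \<Theta>"
  shows "markov n E j p = 0"
proof -
  have "graphical_model n d E \<subseteq> {x \<in> proj_space I. \<forall>p\<in>x. markov n E j p = 0}"
    unfolding graphical_model_def
  proof (rule closure_of_minimal[OF _ closedin_hfun[OF hfun_markov[OF assms(3)]]], safe)
    fix \<sigma> i assume i: "clique_param n d E \<sigma> i \<noteq> 0"
    show ps: "proj_pt (clique_param n d E \<sigma>) \<in> proj_space I"
      by (rule clique_param_proj_space[OF i])
    show "markov n E j p = 0" if p: "p \<in> proj_pt (clique_param n d E \<sigma>)" for p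
    proof (rule hfun_zero_on_class[where f = "markov n E j" and p = "clique_param n d E \<sigma>"])
      show "hfun I 2 (markov n E j)" by (rule hfun_markov[OF assms(3)])
    qed (rule ps proj_pt_self clique_param_markov[OF assms(3)] p)+
  qed
  then show ?thesis using assms by blast
qed

lemma max_clique_extends:
  assumes "clique A E" "A \<subseteq> {1..n}"
  shows "\<exists>C\<in>max_cliques n E. A \<subseteq> C"
proof -
  have "finite {C. C \<subseteq> {1..n} \<and> clique C E}" by (rule finite_subset[of _ "Pow {1..n}"]) auto
  from finite_has_maximal2[OF this, of A] assms
  obtain C where "C \<subseteq> {1..n}" "clique C E" "A \<subseteq> C" "\<forall>B. B \<subseteq> {1..n} \<and> clique B E \<longrightarrow> C \<subseteq> B \<longrightarrow> C = B"
    by auto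
  then show ?thesis unfolding max_cliques_def by blast
qed

text \<open>Parameters realizing prescribed values at clique profiles are found one profile at a time, by
  increasing support: the factor at \<open>restrict \<theta> C\<close> only affects profiles above \<open>\<theta>\<close>.\<close>

lemma clique_param_surj:
  assumes "finite F" "F \<subseteq> \<Theta>" "\<And>j. j \<in> I \<Longrightarrow> p j \<noteq> 0"
  shows "\<exists>\<sigma>. (\<forall>C j. \<sigma> C j \<noteq> 0) \<and> (\<forall>j\<in>F. clique_param n d E \<sigma> j = p j)"
  using assms(1,2)
proof (induction F rule: finite_ranking_induct[where f = "\<lambda>j. card (support n j)"])
  case empty
  show ?case by (rule exI[of _ "\<lambda>_ _. 1"]) simp
next
  case (insert \<theta> S)
  then obtain \<sigma> where \<sigma>: "\<forall>C j. \<sigma> C j \<noteq> 0" "\<forall>j\<in>S. clique_param n d E \<sigma> j = p j" by auto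
  show ?case
  proof (cases "\<theta> \<in> S")
    case True
    then show ?thesis using \<sigma> by (auto simp: insert_absorb)
  next
    case False
    have \<theta>: "\<theta> \<in> I" "clique (support n \<theta>) E" using insert.prems by (auto simp: clique_profiles_def)
    obtain C where C: "C \<in> max_cliques n E" "support n \<theta> \<subseteq> C"
      using max_clique_extends[OF \<theta>(2) support_subset] by blast
    have nz: "clique_param n d E \<sigma> \<theta> \<noteq> 0" using \<theta>(1) \<sigma>(1) by (simp add: clique_param_def)
    define c where "c = p \<theta> / clique_param n d E \<sigma> \<theta>"
    define \<tau> where "\<tau> B j = (if B = C \<and> j = restrict \<theta> C then c * \<sigma> B j else \<sigma> B j)" for B j
    have \<tau>: "clique_param n d E \<tau> j = clique_param n d E \<sigma> j * (if restrict j C = restrict \<theta> C then c else 1)"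
      if "j \<in> I" for j
    proof -
      have "(\<Prod>B\<in>max_cliques n E. \<tau> B (restrict j B)) = \<tau> C (restrict j C) * (\<Prod>B\<in>max_cliques n E - {C}. \<tau> B (restrict j B))"
        using C(1) by (intro prod.remove) auto
      also have "(\<Prod>B\<in>max_cliques n E - {C}. \<tau> B (restrict j B)) = (\<Prod>B\<in>max_cliques n E - {C}. \<sigma> B (restrict j B))"
        by (rule prod.cong) (auto simp: \<tau>_def)
      also have "\<tau> C (restrict j C) = \<sigma> C (restrict j C) * (if restrict j C = restrict \<theta> C then c else 1)"
        by (simp add: \<tau>_def)
      finally have 1: "(\<Prod>B\<in>max_cliques n E. \<tau> B (restrict j B)) =
        \<sigma> C (restrict j C) * (if restrict j C = restrict \<theta> C then c else 1) * (\<Prod>B\<in>max_cliques n E - {C}. \<sigma> B (restrict j B))" .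
      have 2: "(\<Prod>B\<in>max_cliques n E. \<sigma> B (restrict j B)) =
        \<sigma> C (restrict j C) * (\<Prod>B\<in>max_cliques n E - {C}. \<sigma> B (restrict j B))"
        using C(1) by (intro prod.remove) auto
      show ?thesis unfolding clique_param_def using that by (simp only: if_True 1 2 mult_ac)
    qed
    have "clique_param n d E \<tau> \<theta> = p \<theta>" using \<tau>[OF \<theta>(1)] nz by (simp add: c_def)
    moreover have "clique_param n d E \<tau> j = p j" if j: "j \<in> S" for j
    proof -
      have jI: "j \<in> I" using j insert.prems by (auto simp: clique_profiles_def)
      \<comment> \<open>Equal restrictions to \<open>C\<close> would put the support of
        \<open>\<theta>\<close> inside that of \<open>j\<close>. Earlier profiles have no larger
        support, so the supports agree, and both profiles are \<open>1\<close> on the players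
        outside \<open>C\<close>: they would coincide.\<close>
      have "restrict j C \<noteq> restrict \<theta> C"
      proof
        assume eq: "restrict j C = restrict \<theta> C"
        then have agree: "j i = \<theta> i" if "i \<in> C" for i using that by (metis restrict_apply')
        have "support n \<theta> \<subseteq> support n j" using agree C(2) by (auto simp: support_def)
        then have s: "support n \<theta> = support n j"
          using insert.hyps(2)[OF j] by (intro card_seteq) auto
        have "j i = \<theta> i" for i
        proof (cases "i \<in> C")
          case True
          then show ?thesis by (rule agree)
        next
          case False
          then have "i \<notin> support n \<theta>" "i \<notin> support n j" using C(2) s by auto
          moreover have "i \<notin> {1..n} \<Longrightarrow> j i = undefined \<and> \<theta> i = undefined"
            using jI \<theta>(1) by (auto simp: profiles_on_def PiE_def extensional_def)
          ultimately show ?thesis by (auto simp: support_def)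
        qed
        then have "j = \<theta>" by (rule ext)
        then show False using j False by simp
      qed
      then show ?thesis using \<tau>[OF jI] \<sigma>(2) j by simp
    qed
    moreover have "\<tau> B j \<noteq> 0" for B j
      using \<sigma>(1) nz assms(3)[OF \<theta>(1)] by (simp add: \<tau>_def c_def)
    ultimately show ?thesis by (intro exI[of _ \<tau>]) auto
  qed
qed

text \<open>The binomial at \<open>j\<close> gives the value at \<open>j\<close> from values at
  profiles of smaller support, after division by a nonzero one; the clique profiles start the
  recursion.\<close>

lemma markov_determines:
  assumes p: "\<And>j. j \<in> I \<Longrightarrow> p j \<noteq> 0" and q: "\<And>j. j \<in> I \<Longrightarrow> q j \<noteq> 0"
    and pm: "\<And>j. j \<in> I - \<Theta> \<Longrightarrow> markov n E j p = 0" and qm: "\<And>j. j \<in> I - \<Theta> \<Longrightarrow> markov n E j q = 0"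
    and eq: "\<And>j. j \<in> \<Theta> \<Longrightarrow> p j = q j"
  shows "j \<in> I \<Longrightarrow> p j = q j"
proof (induction "card (support n j)" arbitrary: j rule: less_induct)
  case less
  show ?case
  proof (cases "j \<in> \<Theta>")
    case False
    then have j: "j \<in> I - \<Theta>" using less by blast
    obtain a b where ab: "nonedge n E j = (a, b)" by fastforce
    note r = markov_resets[OF j ab]
    have "p j * p (reset {a, b} j) = p (reset {a} j) * p (reset {b} j)"
      "q j * q (reset {a, b} j) = q (reset {a} j) * q (reset {b} j)"
      using pm[OF j] qm[OF j] by (simp_all add: markov_def ab)
    moreover have "p (reset {a, b} j) = q (reset {a, b} j)" "p (reset {a} j) = q (reset {a} j)"
      "p (reset {b} j) = q (reset {b} j)"
      using less.hyps r by auto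
    ultimately show ?thesis using q[OF r(1)] by (metis mult_right_cancel)
  qed (rule eq)
qed

text \<open>Parameters matching \<open>p\<close> on the clique profiles match it everywhere by
  \<open>markov_determines\<close>; the point lies even in the image of the parametrization, not
  merely in its closure.\<close>

lemma graphical_model_torus:
  assumes p: "p \<in> coord_space I" "\<And>j. j \<in> I \<Longrightarrow> p j \<noteq> 0" and m: "\<And>j. j \<in> I - \<Theta> \<Longrightarrow> markov n E j p = 0"
    and ne: "I \<noteq> {}"
  shows "proj_pt p \<in> graphical_model n d E"
proof -
  have \<Theta>I: "\<Theta> \<subseteq> I" by (auto simp: clique_profiles_def)
  have "\<exists>\<sigma>. (\<forall>C j. \<sigma> C j \<noteq> 0) \<and> (\<forall>j\<in>\<Theta>. clique_param n d E \<sigma> j = p j)"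
  proof (rule clique_param_surj)
    show "finite \<Theta>" by (rule finite_subset[OF \<Theta>I finite_profiles])
    show "p j \<noteq> 0" if "j \<in> I" for j by (rule p(2)[OF that])
  qed simp
  then obtain \<sigma> where \<sigma>: "\<forall>C j. \<sigma> C j \<noteq> 0" "\<forall>j\<in>\<Theta>. clique_param n d E \<sigma> j = p j"
    by (elim exE conjE)
  have nz: "clique_param n d E \<sigma> j \<noteq> 0" if "j \<in> I" for j using that \<sigma>(1) by (simp add: clique_param_def)
  have "clique_param n d E \<sigma> j = p j" if j: "j \<in> I" for j
  proof (rule markov_determines[where p = "clique_param n d E \<sigma>" and q = p])
    show "clique_param n d E \<sigma> j \<noteq> 0" if "j \<in> I" for j by (rule nz[OF that])
    show "p j \<noteq> 0" if "j \<in> I" for j by (rule p(2)[OF that])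
    show "markov n E j (clique_param n d E \<sigma>) = 0" if "j \<in> I - \<Theta>" for j by (rule clique_param_markov[OF that])
    show "markov n E j p = 0" if "j \<in> I - \<Theta>" for j by (rule m[OF that])
    show "clique_param n d E \<sigma> j = p j" if "j \<in> \<Theta>" for j using \<sigma>(2) that by blast
  qed (rule j)
  then have eq: "clique_param n d E \<sigma> = p"
    using p(1) by (intro ext) (auto simp: clique_param_def coord_space_def split: if_splits)
  obtain j where j: "j \<in> I" using ne by blast
  let ?Z = "{proj_pt (clique_param n d E \<sigma>) |\<sigma>. \<exists>j. clique_param n d E \<sigma> j \<noteq> 0}"
  have "proj_pt (clique_param n d E \<sigma>) \<in> ?Z" using nz[OF j] by blast
  moreover have "?Z \<subseteq> zariski_proj I closure_of ?Z"
  proof (rule closure_of_subset)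
    show "?Z \<subseteq> topspace (zariski_proj I)" by (auto intro: clique_param_proj_space)
  qed
  ultimately show ?thesis unfolding graphical_model_def eq by (rule rev_subsetD)
qed

text \<open>The parameters form a vector space, and the line between two of them maps to a
  holomorphic curve in the image.\<close>

lemma irreducible_graphical_model:
  assumes "I \<noteq> {}"
  shows "irreducible_in (zariski_proj I) (graphical_model n d E)"
proof -
  have eq: "{proj_pt (clique_param n d E \<sigma>) |\<sigma>. \<exists>j. clique_param n d E \<sigma> j \<noteq> 0} =
      {proj_pt q |q. q \<in> range (clique_param n d E) \<and> (\<exists>i. q i \<noteq> 0)}" by blast
  show ?thesis
    unfolding graphical_model_def eq
  proof (rule irreducible_closure_of)
    show "range (clique_param n d E) \<subseteq> coord_space I" using clique_param_coord_space by blast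
    obtain j where "j \<in> I" using assms by blast
    then have "clique_param n d E (\<lambda>_ _. 1) j \<noteq> 0" by (simp add: clique_param_def)
    then have "\<exists>i. clique_param n d E (\<lambda>_ _. 1) i \<noteq> 0" by (rule exI[of _ j])
    then show "\<exists>q\<in>range (clique_param n d E). \<exists>i. q i \<noteq> 0" by (intro bexI[of _ "clique_param n d E (\<lambda>_ _. 1)"] rangeI)
    fix q r assume "q \<in> range (clique_param n d E)" "r \<in> range (clique_param n d E)"
    then obtain \<sigma> \<tau> where st: "q = clique_param n d E \<sigma>" "r = clique_param n d E \<tau>" by (elim rangeE)
    define w where "w z = clique_param n d E (\<lambda>C j. \<sigma> C j + z * (\<tau> C j - \<sigma> C j))" for z
    have "(\<lambda>z. w z i) holomorphic_on UNIV" if "i \<in> I" for i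
      using that unfolding w_def clique_param_def by (auto intro!: holomorphic_intros)
    moreover have "w 0 = q" "w 1 = r" by (simp_all add: w_def st)
    moreover have "range w \<subseteq> range (clique_param n d E)" by (auto simp: w_def)
    ultimately show "\<exists>w \<Omega> z0 z1. open \<Omega> \<and> connected \<Omega> \<and> (\<forall>i\<in>I. (\<lambda>z. w z i) holomorphic_on \<Omega>) \<and>
        z0 \<in> \<Omega> \<and> z1 \<in> \<Omega> \<and> w z0 = q \<and> w z1 = r \<and> w ` \<Omega> \<subseteq> range (clique_param n d E)"
      by (intro exI[of _ w] exI[of _ UNIV] exI[of _ 0] exI[of _ 1]) auto
  qed
qed

end

section \<open>Regular points\<close>

lemma der_hfun_euler:
  assumes "finite I"
  shows "hfun I D f \<Longrightarrow> der I (\<lambda>i _. p i) f p = of_nat D * f p"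
proof (induction rule: hfun.induct)
  case (coord i)
  then show ?case using assms by (simp add: der_coord)
next
  case (add D f g)
  then show ?case using der_add[OF hfun_imp_pfun hfun_imp_pfun] by (fastforce simp: algebra_simps)
next
  case (mult D f D' g)
  then have "der I (\<lambda>i _. p i) (\<lambda>x. f x * g x) p = f p * (of_nat D' * g p) + of_nat D * f p * g p"
    using der_mult[OF hfun_imp_pfun hfun_imp_pfun, of I D f I D' g] by simp
  then show ?case by (simp add: algebra_simps)
qed simp_all

abbreviation dderiv :: "'i set \<Rightarrow> (('i \<Rightarrow> complex) \<Rightarrow> complex) \<Rightarrow> ('i \<Rightarrow> complex) \<Rightarrow> ('i \<Rightarrow> complex) \<Rightarrow> complex" where
  "dderiv I f p w \<equiv> der I (\<lambda>i _. w i) f p"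

context game_model
begin

lemma partial_markov_self:
  assumes "j \<in> I - \<Theta>" "\<And>i. i \<in> I \<Longrightarrow> p i \<noteq> 0"
  shows "partial j (markov n E j) p \<noteq> 0"
proof -
  obtain a b where ab: "nonedge n E j = (a, b)" by fastforce
  note r = markov_resets[OF assms(1) ab]
  have ne: "reset {a, b} j \<noteq> j" "reset {a} j \<noteq> j" "reset {b} j \<noteq> j" using r(4-6) by auto
  have c: "pfun I (\<lambda>p. p i :: complex)" if "i \<in> I" for i by (rule pfun.coord[OF that])
  have j: "j \<in> I" using assms(1) by blast
  have "partial j (markov n E j) p = p (reset {a, b} j)"
    unfolding markov_def[abs_def] ab prod.case
    by (subst partial_diff[OF pfun.mult[OF c c] pfun.mult[OF c c]],
        (rule j r(1-3))+, subst (1 2) partial_mult[OF c c], (rule j r(1-3))+)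
      (use ne in \<open>simp add: partial_coord\<close>)
  then show ?thesis using assms(2)[OF r(1)] by simp
qed

lemma partial_markov_other:
  assumes "j' \<in> I - \<Theta>" "j \<noteq> j'" "card (support n j') \<le> card (support n j)"
  shows "partial j (markov n E j') p = 0"
proof -
  obtain a b where ab: "nonedge n E j' = (a, b)" by fastforce
  note r = markov_resets[OF assms(1) ab]
  let ?K = "{j', reset {a, b} j', reset {a} j', reset {b} j'}"
  have "pfun ?K (markov n E j')"
    unfolding markov_def[abs_def] ab prod.case by (intro pfun_diff pfun.mult pfun.coord) auto
  moreover have "j \<notin> ?K" using r(4-6) assms(2,3) by auto
  ultimately show ?thesis by (rule partial_outside)
qed

text \<open>Among the profiles with nonzero coefficient take one of largest support: the derivative
  in its coordinate sees its own binomial and no other one in the relation.\<close>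

lemma independent_markov:
  assumes p: "\<And>i. i \<in> I \<Longrightarrow> p i \<noteq> 0" and z: "\<And>b. b \<in> I \<Longrightarrow> (\<Sum>j\<in>I - \<Theta>. \<alpha> j * partial b (markov n E j) p) = 0"
  shows "\<forall>j\<in>I - \<Theta>. \<alpha> j = 0"
proof (rule ccontr)
  let ?S = "{j \<in> I - \<Theta>. \<alpha> j \<noteq> 0}"
  assume "\<not> ?thesis"
  then have S: "(\<lambda>j. card (support n j)) ` ?S \<noteq> {}" "finite ((\<lambda>j. card (support n j)) ` ?S)" by auto
  from Max_in[OF S(2,1)] obtain j where j: "j \<in> ?S" "Max ((\<lambda>j. card (support n j)) ` ?S) = card (support n j)"
    by (elim imageE)
  have max: "card (support n i) \<le> card (support n j)" if "i \<in> ?S" for i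
    unfolding j(2)[symmetric] by (rule Max_ge[OF S(2) imageI[OF that]])
  have "(\<Sum>i\<in>I - \<Theta>. \<alpha> i * partial j (markov n E i) p) = (\<Sum>i\<in>I - \<Theta>. if i = j then \<alpha> j * partial j (markov n E j) p else 0)"
  proof (rule sum.cong[OF refl])
    fix i assume i: "i \<in> I - \<Theta>"
    show "\<alpha> i * partial j (markov n E i) p = (if i = j then \<alpha> j * partial j (markov n E j) p else 0)"
      using partial_markov_other[OF i, of j p] max[of i] i by (cases "\<alpha> i = 0") auto
  qed
  then have "\<alpha> j * partial j (markov n E j) p = 0" using z[of j] j(1) by simp
  then show False using partial_markov_self[of j p] p j(1) by auto
qed

text \<open>Independence of the gradients of the Markov binomials, of further homogeneous equations \<open>s\<close>
  and of a linear form: Euler's identity removes the linear form, and the directions \<open>w\<close> tangent to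
  the model remove the \<open>s\<close>.\<close>

lemma independent_equations:
  fixes s :: "'k \<Rightarrow> ((nat \<Rightarrow> nat) \<Rightarrow> complex) \<Rightarrow> complex"
  assumes p: "\<And>i. i \<in> I \<Longrightarrow> p i \<noteq> 0" and lf: "hfun I 1 lf" "lf p \<noteq> 0" and K: "finite K"
    and m: "\<And>j. j \<in> I - \<Theta> \<Longrightarrow> markov n E j p = 0"
    and s: "\<And>k. k \<in> K \<Longrightarrow> hfun I 2 (s k)" "\<And>k. k \<in> K \<Longrightarrow> s k p = 0"
    and reg: "\<And>k. k \<in> K \<Longrightarrow> \<exists>w. (\<forall>j\<in>I - \<Theta>. dderiv I (markov n E j) p w = 0) \<and>
      (\<forall>k'\<in>K. dderiv I (s k') p w = (if k' = k then 1 else 0))"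
  defines "L \<equiv> Inl ` (I - \<Theta>) \<union> Inr ` K" and "G \<equiv> case_sum (markov n E) s"
  shows "independent_gradients I (insert None (Some ` L)) (case_option (\<lambda>q. lf q - lf p) G) p"
    "independent_gradients I L G p" "card L = card (I - \<Theta>) + card K" "finite L"
proof -
  have finL: "finite L" using K by (simp add: L_def)
  then show "finite L" .
  have sumL: "(\<Sum>l\<in>L. f l) = (\<Sum>j\<in>I - \<Theta>. f (Inl j)) + (\<Sum>k\<in>K. f (Inr k))" for f :: "_ \<Rightarrow> complex"
    unfolding L_def using K by (subst sum.union_disjoint) (auto simp: sum.reindex)
  show "card L = card (I - \<Theta>) + card K"
    unfolding L_def using K by (subst card_Un_disjoint) (auto simp: card_image)
  have sumO: "(\<Sum>l\<in>insert None (Some ` L). f l) = f None + (\<Sum>l\<in>L. f (Some l))" for f :: "_ \<Rightarrow> complex"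
    using finL by (simp add: sum.reindex)
  have dlf: "partial b (\<lambda>q. lf q - lf p) x = partial b lf x" for b x
    using partial_diff[OF hfun_imp_pfun[OF lf(1)] pfun.const] by simp
  show main: "independent_gradients I (insert None (Some ` L)) (case_option (\<lambda>q. lf q - lf p) G) p"
    unfolding independent_gradients_def
  proof (intro allI impI)
    fix \<alpha> assume a: "\<forall>b\<in>I. (\<Sum>l\<in>insert None (Some ` L). \<alpha> l * partial b (case_option (\<lambda>q. lf q - lf p) G l) p) = 0"
    have pair: "\<alpha> None * dderiv I lf p w + (\<Sum>j\<in>I - \<Theta>. \<alpha> (Some (Inl j)) * dderiv I (markov n E j) p w)
        + (\<Sum>k\<in>K. \<alpha> (Some (Inr k)) * dderiv I (s k) p w) = 0" for w
    proof -
      have "0 = (\<Sum>b\<in>I. (\<Sum>l\<in>insert None (Some ` L). \<alpha> l * partial b (case_option (\<lambda>q. lf q - lf p) G l) p) * w b)"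
        using a by simp
      also have "\<dots> = (\<Sum>l\<in>insert None (Some ` L). \<alpha> l * (\<Sum>b\<in>I. partial b (case_option (\<lambda>q. lf q - lf p) G l) p * w b))"
        by (simp only: sum_distrib_right sum_distrib_left mult.assoc) (rule sum.swap)
      also have "\<dots> = \<alpha> None * dderiv I lf p w + (\<Sum>j\<in>I - \<Theta>. \<alpha> (Some (Inl j)) * dderiv I (markov n E j) p w)
        + (\<Sum>k\<in>K. \<alpha> (Some (Inr k)) * dderiv I (s k) p w)"
        unfolding sumO sumL by (simp add: G_def dlf der_def)
      finally show ?thesis by simp
    qed
    have e: "dderiv I (markov n E j) p p = 0" if "j \<in> I - \<Theta>" for j
      using der_hfun_euler[OF finite_profiles hfun_markov[OF that], of p] m[OF that] by simp
    have es: "dderiv I (s k) p p = 0" if "k \<in> K" for k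
      using der_hfun_euler[OF finite_profiles s(1)[OF that], of p] s(2)[OF that] by simp
    have "\<alpha> None * lf p = 0"
      using pair[of p] e es der_hfun_euler[OF finite_profiles lf(1), of p] by simp
    then have a0: "\<alpha> None = 0" using lf(2) by simp
    have ak: "\<alpha> (Some (Inr k)) = 0" if k: "k \<in> K" for k
    proof -
      obtain w where w: "\<forall>j\<in>I - \<Theta>. dderiv I (markov n E j) p w = 0"
        "\<forall>k'\<in>K. dderiv I (s k') p w = (if k' = k then 1 else 0)" using reg[OF k] by blast
      have "(\<Sum>k'\<in>K. \<alpha> (Some (Inr k')) * dderiv I (s k') p w) = (\<Sum>k'\<in>K. if k' = k then \<alpha> (Some (Inr k)) else 0)"
        by (rule sum.cong) (use w(2) in auto)
      then show ?thesis using pair[of w] a0 w(1) k K by simp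
    qed
    have "(\<Sum>j\<in>I - \<Theta>. \<alpha> (Some (Inl j)) * partial b (markov n E j) p) = 0" if "b \<in> I" for b
      using a that ak a0 unfolding sumO sumL by (simp add: G_def)
    note z = this
    have "\<forall>j\<in>I - \<Theta>. \<alpha> (Some (Inl j)) = 0"
    proof (rule independent_markov[where p = p and \<alpha> = "\<lambda>j. \<alpha> (Some (Inl j))"])
      show "p i \<noteq> 0" if "i \<in> I" for i by (rule p[OF that])
    qed (rule z)
    then show "\<forall>l\<in>insert None (Some ` L). \<alpha> l = 0" using a0 ak by (auto simp: L_def)
  qed
  show "independent_gradients I L G p"
    unfolding independent_gradients_def
  proof (intro allI impI)
    fix \<alpha> assume a: "\<forall>b\<in>I. (\<Sum>l\<in>L. \<alpha> l * partial b (G l) p) = 0"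
    have "\<forall>b\<in>I. (\<Sum>l\<in>insert None (Some ` L). case_option 0 \<alpha> l * partial b (case_option (\<lambda>q. lf q - lf p) G l) p) = 0"
      using a unfolding sumO by simp
    then have "\<forall>l\<in>insert None (Some ` L). case_option 0 \<alpha> l = 0"
      using main unfolding independent_gradients_def by blast
    then show "\<forall>l\<in>L. \<alpha> l = 0" by auto
  qed
qed

end

section \<open>Generic points\<close>

lemma pfun_on_line:
  assumes "pfun I (f :: ('i \<Rightarrow> complex) \<Rightarrow> complex)"
  shows "\<exists>q. \<forall>t. f (\<lambda>i. a i + t * b i) = poly q t"
  using assms
proof (induction rule: pfun.induct)
  case (const c)
  show ?case by (rule exI[of _ "[:c:]"]) simp
next
  case (coord i)
  show ?case by (rule exI[of _ "[:a i, b i:]"]) simp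
next
  case (add f g)
  then obtain q r where "\<forall>t. f (\<lambda>i. a i + t * b i) = poly q t" "\<forall>t. g (\<lambda>i. a i + t * b i) = poly r t" by blast
  then show ?case by (intro exI[of _ "q + r"]) simp
next
  case (mult f g)
  then obtain q r where "\<forall>t. f (\<lambda>i. a i + t * b i) = poly q t" "\<forall>t. g (\<lambda>i. a i + t * b i) = poly r t" by blast
  then show ?case by (intro exI[of _ "q * r"]) simp
qed

text \<open>On the line through a point where \<open>f\<close> is nonzero and one where
  \<open>g\<close> is, both restrict to nonzero univariate polynomials.\<close>

lemma pfun_times_nonzero:
  assumes f: "pfun I f" "f \<noteq> 0" and g: "pfun I g" "g \<noteq> (0 :: ('i \<Rightarrow> complex) \<Rightarrow> complex)"
  shows "f * g \<noteq> 0"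
proof
  assume z: "f * g = 0"
  obtain a where a: "f a \<noteq> 0" using f(2) by (auto simp: fun_eq_iff)
  obtain b where b: "g b \<noteq> 0" using g(2) by (auto simp: fun_eq_iff)
  obtain q r where qr: "\<forall>t. f (\<lambda>i. a i + t * (b i - a i)) = poly q t" "\<forall>t. g (\<lambda>i. a i + t * (b i - a i)) = poly r t"
    using pfun_on_line[OF f(1)] pfun_on_line[OF g(1)] by metis
  have "poly (q * r) t = 0" for t
    using fun_cong[OF z, of "\<lambda>i. a i + t * (b i - a i)"] qr by simp
  then have "q * r = 0" by (intro poly_vanishing_off_0)
  moreover have "q \<noteq> 0" using qr(1)[rule_format, of 0] a by auto
  moreover have "r \<noteq> 0" using qr(2)[rule_format, of 1] b by auto
  ultimately show False by simp
qed

text \<open>On the line from the real part of \<open>y\<close> in the direction of its imaginary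
  part, the function is a polynomial in \<open>t\<close> with all real numbers as zeros;
  \<open>y\<close> is reached at the imaginary unit.\<close>

lemma pfun_zero_on_reals:
  assumes f: "pfun I f" and z: "\<And>x. f (\<lambda>i. complex_of_real (x i)) = 0"
  shows "f y = 0"
proof -
  obtain q where q: "\<forall>t. f (\<lambda>i. of_real (Re (y i)) + t * of_real (Im (y i))) = poly q t"
    using pfun_on_line[OF f, of "\<lambda>i. of_real (Re (y i))" "\<lambda>i. of_real (Im (y i))"] by blast
  have "q = 0"
  proof (rule ccontr)
    assume "q \<noteq> 0"
    then have "finite {t. poly q t = 0}" by (rule poly_roots_finite)
    moreover have "range complex_of_real \<subseteq> {t. poly q t = 0}"
    proof safe
      fix t
      show "poly q (of_real t) = 0"
        using q[rule_format, of "of_real t"] z[of "\<lambda>i. Re (y i) + t * Im (y i)"] by simp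
    qed
    ultimately have "finite (range complex_of_real)" by (rule rev_finite_subset)
    then have "finite (UNIV :: real set)" using finite_imageD inj_of_real by blast
    then show False using infinite_UNIV_char_0 by blast
  qed
  then have "f (\<lambda>i. of_real (Re (y i)) + \<i> * of_real (Im (y i))) = 0" using q by simp
  then show ?thesis by (simp add: complex_eq[symmetric])
qed

text \<open>A set whose projection to the coordinates \<open>Y\<close> is Zariski dense contains a generic point of an
  irreducible component dominating \<open>Y\<close>, in the form of a prime ideal all of whose finite parts have
  zeros in the set. Zorn's lemma takes the place of the decomposition into components.\<close>

lemma generic_point:
  fixes C :: "('i \<Rightarrow> complex) set"
  assumes J: "finite J" and dense': "\<forall>Q. pfun Y Q \<longrightarrow> Q \<noteq> 0 \<longrightarrow> (\<exists>z\<in>C. Q z \<noteq> 0)" and Y: "Y \<subseteq> J"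
  shows "\<exists>P. prime_pfun J P \<and> prime_pfun.indep P Y \<and>
    (\<forall>F h. finite F \<longrightarrow> F \<subseteq> P \<longrightarrow> pfun J h \<longrightarrow> h \<notin> P \<longrightarrow> (\<exists>z\<in>C. (\<forall>f\<in>F. f z = 0) \<and> h z \<noteq> 0)) \<and>
    (\<forall>f. pfun J f \<longrightarrow> (\<forall>z\<in>C. f z = 0) \<longrightarrow> f \<in> P)"
proof -
  note dense = dense'[rule_format]
  \<comment> \<open>The common zeros in \<open>C\<close> of any finite part of \<open>A\<close>
    remain dense over \<open>Y\<close>. The condition concerns finite parts only, so it passes to
    unions of chains; for empty \<open>A\<close> it is the density assumption.\<close>
  define good where "good A \<longleftrightarrow> A \<subseteq> Collect (pfun J) \<and> (\<forall>F Q. finite F \<longrightarrow> F \<subseteq> A \<longrightarrow> pfun Y Q \<longrightarrow> Q \<noteq> 0 \<longrightarrow>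
    (\<exists>z\<in>C. (\<forall>f\<in>F. f z = 0) \<and> Q z \<noteq> 0))" for A
  have "\<exists>P\<in>Collect good. \<forall>A\<in>Collect good. P \<subseteq> A \<longrightarrow> A = P"
  proof (rule subset_Zorn')
    fix \<C> assume \<C>: "subset.chain (Collect good) \<C>"
    then have sub: "\<C> \<subseteq> Collect good" by (auto simp: subset_chain_def)
    show "\<Union>\<C> \<in> Collect good"
    proof (intro CollectI, unfold good_def, intro conjI allI impI)
      show "\<Union>\<C> \<subseteq> Collect (pfun J)"
      proof (rule Union_least)
        fix A assume "A \<in> \<C>"
        then have "good A" using sub by auto
        then show "A \<subseteq> Collect (pfun J)" unfolding good_def by (rule conjunct1)
      qed
      fix F and Q :: "('i \<Rightarrow> complex) \<Rightarrow> complex"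
      assume F: "finite F" "F \<subseteq> \<Union>\<C>" and Q: "pfun Y Q" "Q \<noteq> 0"
      show "\<exists>z\<in>C. (\<forall>f\<in>F. f z = 0) \<and> Q z \<noteq> 0"
      proof (cases "\<C> = {}")
        case True
        then have "F = {}" using F by auto
        then show ?thesis using dense[OF Q] by simp
      next
        case False
        obtain A where A: "A \<in> \<C>" "F \<subseteq> A"
          using finite_subset_Union_chain[OF F False \<C>] by metis
        then have "good A" using sub by auto
        then show ?thesis using F(1) A(2) Q unfolding good_def by (elim conjE allE impE) simp_all
      qed
    qed
  qed
  then obtain P where P: "good P" and max: "\<And>A. good A \<Longrightarrow> P \<subseteq> A \<Longrightarrow> A = P" by auto
  have Pp: "pfun J f" if "f \<in> P" for f using P that by (auto simp: good_def)
  have Pz: "\<exists>z\<in>C. (\<forall>f\<in>F. f z = 0) \<and> Q z \<noteq> 0" if "finite F" "F \<subseteq> P" "pfun Y Q" "Q \<noteq> 0" for F Q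
    using P that unfolding good_def by (elim conjE allE impE) simp_all
  \<comment> \<open>Adjoining \<open>f\<close> to the maximal \<open>P\<close> destroys density over
    \<open>Y\<close>, witnessed by some \<open>Q\<close>. This certificate is the only form in which
    maximality is used below.\<close>
  have key: "\<exists>F Q. finite F \<and> F \<subseteq> P \<and> pfun Y Q \<and> Q \<noteq> 0 \<and> (\<forall>z\<in>C. (\<forall>g\<in>F. g z = 0) \<longrightarrow> f z = 0 \<longrightarrow> Q z = 0)"
    if f: "pfun J f" "f \<notin> P" for f
  proof -
    have "\<not> good (insert f P)" using max[of "insert f P"] f(2) by blast
    moreover have "insert f P \<subseteq> Collect (pfun J)" using f(1) Pp by auto
    ultimately have "\<not> (\<forall>F Q. finite F \<longrightarrow> F \<subseteq> insert f P \<longrightarrow> pfun Y Q \<longrightarrow> Q \<noteq> 0 \<longrightarrow>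
        (\<exists>z\<in>C. (\<forall>f\<in>F. f z = 0) \<and> Q z \<noteq> 0))"
      unfolding good_def by (rule contrapos_nn[OF _ conjI])
    then obtain F Q where FQ: "finite F" "F \<subseteq> insert f P" "pfun Y Q" "Q \<noteq> 0"
      "\<not> (\<exists>z\<in>C. (\<forall>g\<in>F. g z = 0) \<and> Q z \<noteq> 0)"
      unfolding not_all not_imp by (elim exE conjE)
    show ?thesis
    proof (rule exI[of _ "F - {f}"], rule exI[of _ Q], intro conjI ballI impI)
      show "finite (F - {f})" "F - {f} \<subseteq> P" using FQ(1,2) by auto
      fix z assume z: "z \<in> C" "\<forall>g\<in>F - {f}. g z = 0" "f z = 0"
      have "g z = 0" if "g \<in> F" for g using z(2,3) that by (cases "g = f") simp_all
      then show "Q z = 0" using FQ(5) z(1) by blast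
    qed (fact FQ)+
  qed
  \<comment> \<open>A single closure property from which the ideal laws follow: consequences, on
    \<open>C\<close>, of finitely many elements of \<open>P\<close> belong to \<open>P\<close>.
    Otherwise the certificate for \<open>f\<close> would contradict density.\<close>
  have cl: "f \<in> P" if f: "pfun J f" and F0: "finite F0" "F0 \<subseteq> P"
    and z: "\<And>z. z \<in> C \<Longrightarrow> (\<forall>g\<in>F0. g z = 0) \<Longrightarrow> f z = 0" for f F0
  proof (rule ccontr)
    assume "f \<notin> P"
    obtain F Q where FQ: "finite F" "F \<subseteq> P" "pfun Y Q" "Q \<noteq> 0"
      "\<forall>z\<in>C. (\<forall>g\<in>F. g z = 0) \<longrightarrow> f z = 0 \<longrightarrow> Q z = 0" using key[OF f \<open>f \<notin> P\<close>] by (elim exE conjE)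
    obtain y where "y \<in> C" "\<forall>g\<in>F \<union> F0. g y = 0" "Q y \<noteq> 0"
      using Pz[of "F \<union> F0" Q] FQ F0 by auto
    then show False using FQ(5) z by auto
  qed
  have prime: "prime_pfun J P"
  proof
    show "0 \<in> P" by (rule cl[of _ "{}"]) (auto simp: pfun_0)
    show "f + g \<in> P" if "f \<in> P" "g \<in> P" for f g
      by (rule cl[of _ "{f, g}"]) (use that Pp in \<open>auto intro: pfun_plus\<close>)
    show "g * f \<in> P" if "f \<in> P" "pfun J g" for f g
      by (rule cl[of _ "{f}"]) (use that Pp in \<open>auto intro: pfun_times\<close>)
    show "1 \<notin> P"
    proof
      assume "1 \<in> P"
      moreover have "pfun Y (1 :: ('i \<Rightarrow> complex) \<Rightarrow> complex)" "(1 :: ('i \<Rightarrow> complex) \<Rightarrow> complex) \<noteq> 0"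
        by (simp_all add: pfun_1)
      ultimately show False using Pz[of "{1}" 1] by auto
    qed
    fix f g assume f: "pfun J f" and g: "pfun J g" and fg: "f * g \<in> P"
    show "f \<in> P \<or> g \<in> P"
    proof (rule ccontr)
      assume "\<not> ?thesis"
      then have "f \<notin> P" "g \<notin> P" by simp_all
      obtain F Q where F: "finite F" "F \<subseteq> P" "pfun Y Q" "Q \<noteq> 0"
        "\<forall>z\<in>C. (\<forall>h\<in>F. h z = 0) \<longrightarrow> f z = 0 \<longrightarrow> Q z = 0" using key[OF f \<open>f \<notin> P\<close>] by (elim exE conjE)
      obtain G R where G: "finite G" "G \<subseteq> P" "pfun Y R" "R \<noteq> 0"
        "\<forall>z\<in>C. (\<forall>h\<in>G. h z = 0) \<longrightarrow> g z = 0 \<longrightarrow> R z = 0" using key[OF g \<open>g \<notin> P\<close>] by (elim exE conjE)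
      have QR: "pfun Y (Q * R)" "Q * R \<noteq> 0"
        by (rule pfun_times[OF F(3) G(3)], rule pfun_times_nonzero[OF F(3,4) G(3,4)])
      have fin: "finite (insert (f * g) (F \<union> G))" "insert (f * g) (F \<union> G) \<subseteq> P" using F G fg by auto
      obtain z where z: "z \<in> C" "\<forall>h\<in>insert (f * g) (F \<union> G). h z = 0" "(Q * R) z \<noteq> 0"
        using Pz[OF fin QR] by auto
      then have "f z * g z = 0" "Q z \<noteq> 0" "R z \<noteq> 0" by auto
      then show False using F(5) G(5) z by auto
    qed
  qed (use J Pp in auto)
  moreover have "prime_pfun.indep P Y"
    unfolding prime_pfun.indep_def[OF prime]
  proof (intro allI impI)
    fix f assume f: "pfun Y f" "f \<in> P"
    show "f = 0"
    proof (rule ccontr)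
      assume "f \<noteq> 0"
      then obtain z where "f z = 0" "f z \<noteq> 0" using Pz[of "{f}" f] f by auto
      then show False by simp
    qed
  qed
  moreover have "\<exists>z\<in>C. (\<forall>f\<in>F. f z = 0) \<and> h z \<noteq> 0" if h: "finite F" "F \<subseteq> P" "pfun J h" "h \<notin> P" for F h
  proof -
    obtain G Q where G: "finite G" "G \<subseteq> P" "pfun Y Q" "Q \<noteq> 0"
      "\<forall>z\<in>C. (\<forall>g\<in>G. g z = 0) \<longrightarrow> h z = 0 \<longrightarrow> Q z = 0" using key[OF h(3,4)] by (elim exE conjE)
    obtain z where "z \<in> C" "\<forall>f\<in>F \<union> G. f z = 0" "Q z \<noteq> 0"
      using Pz[of "F \<union> G" Q] h(1,2) G by auto
    then show ?thesis using G(5) by (intro bexI[of _ z]) auto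
  qed
  moreover have "f \<in> P" if "pfun J f" "\<forall>z\<in>C. f z = 0" for f
    by (rule cl[of _ "{}"]) (use that in auto)
  ultimately show ?thesis by (intro exI[of _ P]) simp
qed

section \<open>The equations of the Spohn variety\<close>

lemma der_through_Inl:
  fixes f :: "('a \<Rightarrow> complex) \<Rightarrow> complex" and v :: "'a + 'b \<Rightarrow> ('a + 'b \<Rightarrow> complex) \<Rightarrow> complex"
  assumes "finite I" "finite M"
  shows "der (Inl ` I \<union> Inr ` M) v (\<lambda>z. f (z \<circ> Inl)) z = dderiv I f (z \<circ> Inl) (\<lambda>j. v (Inl j) z)"
proof -
  have "(z(Inl j := t)) \<circ> Inl = (z \<circ> Inl)(j := t)" "(z(Inr b := t)) \<circ> Inl = z \<circ> Inl" for j b and t :: complex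
    by (auto simp: fun_eq_iff)
  then have "partial (Inl j) (\<lambda>z. f (z \<circ> Inl)) z = partial j f (z \<circ> Inl)"
    "partial (Inr b) (\<lambda>z. f (z \<circ> Inl)) z = 0" for j b
    by (simp_all add: partial_def)
  moreover have "der (Inl ` I \<union> Inr ` M) v (\<lambda>z. f (z \<circ> Inl)) z =
      (\<Sum>j\<in>I. partial (Inl j) (\<lambda>z. f (z \<circ> Inl)) z * v (Inl j) z) + (\<Sum>b\<in>M. partial (Inr b) (\<lambda>z. f (z \<circ> Inl)) z * v (Inr b) z)"
    unfolding der_def using assms by (subst sum.union_disjoint) (auto simp: sum.reindex)
  ultimately show ?thesis by (simp add: der_def)
qed

lemma dderiv_section:
  fixes f :: "('a + 'b \<Rightarrow> complex) \<Rightarrow> complex"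
  assumes "finite I" "finite M"
  shows "dderiv I (\<lambda>p. f (case_sum p X)) p w =
    der (Inl ` I \<union> Inr ` M) (\<lambda>a _. case_sum w (\<lambda>_. 0) a) f (case_sum p X)"
proof -
  have "case_sum (p(j := t)) X = (case_sum p X)(Inl j := t)" for j t
    by (auto simp: fun_eq_iff split: sum.splits)
  then have "partial j (\<lambda>p. f (case_sum p X)) p = partial (Inl j) f (case_sum p X)" for j
    by (simp add: partial_def)
  moreover have "der (Inl ` I \<union> Inr ` M) (\<lambda>a _. case_sum w (\<lambda>_. 0) a) f (case_sum p X) =
      (\<Sum>j\<in>I. partial (Inl j) f (case_sum p X) * w j)"
    unfolding der_def using assms by (subst sum.union_disjoint) (auto simp: sum.reindex)
  ultimately show ?thesis by (simp add: der_def)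
qed

text \<open>A polynomial in the probabilities (\<open>Inl\<close>) and the payoffs
  (\<open>Inr\<close>) jointly, since payoffs are differentiated as well. Cleared of denominators,
  it equates the conditional expected payoff of strategy \<open>i\<close> with the expected payoff
  of the player.\<close>

definition spohn_poly :: "nat \<Rightarrow> (nat \<Rightarrow> nat) \<Rightarrow> nat \<times> nat \<Rightarrow>
    ((nat \<Rightarrow> nat) + nat \<times> (nat \<Rightarrow> nat) \<Rightarrow> complex) \<Rightarrow> complex" where
  "spohn_poly n d \<kappa> z = (case \<kappa> of (k, i) \<Rightarrow>
     (\<Sum>j\<in>{j \<in> profiles n d. j k = i}. z (Inr (k, j)) * z (Inl j)) * (\<Sum>j\<in>profiles n d. z (Inl j)) -
     (\<Sum>j\<in>{j \<in> profiles n d. j k = i}. z (Inl j)) * (\<Sum>j\<in>profiles n d. z (Inr (k, j)) * z (Inl j)))"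

definition spohn_eq :: "nat \<Rightarrow> (nat \<Rightarrow> nat) \<Rightarrow> game \<Rightarrow> nat \<times> nat \<Rightarrow> ((nat \<Rightarrow> nat) \<Rightarrow> complex) \<Rightarrow> complex" where
  "spohn_eq n d X \<kappa> p = spohn_poly n d \<kappa> (case_sum p (\<lambda>x. of_real (X x)))"

text \<open>The equation for \<open>i = 1\<close> is minus the sum of the others.\<close>

definition spohn_index :: "nat \<Rightarrow> (nat \<Rightarrow> nat) \<Rightarrow> (nat \<times> nat) set" where
  "spohn_index n d = (SIGMA k:{1..n}. {2..d k})"

text \<open>Here \<open>t\<close> and \<open>t'\<close> stand for the contributions of the moving
  payoff to the two payoff sums; the identity splits them off.\<close>

lemma spohn_expand:
  "a + (b + t) * c - (e * (f + t') + g) = (a + (b + 0) * c - (e * (f + 0) + g)) + (t * c - e * t')"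
  for a :: complex
  by (simp add: distrib_left distrib_right)

context game_model
begin

abbreviation "K \<equiv> spohn_index n d"
abbreviation "M \<equiv> game_index n d"
abbreviation "J \<equiv> Inl ` I \<union> Inr ` M"
abbreviation (input) "mass p \<equiv> (\<Sum>j\<in>I. p j)"

lemma finite_indices [simp]: "finite K" "finite M" "finite J" "finite {j \<in> I. Q j}"
  by (auto simp: spohn_index_def game_index_def)

lemma spohn_eq_alt:
  "spohn_eq n d X (k, i) p = payoff_sum n d X k i p * mass p -
     marginal n d k i p * (\<Sum>j\<in>I. of_real (X (k, j)) * p j)"
  by (simp add: spohn_eq_def spohn_poly_def payoff_sum_def marginal_def)

section \<open>The Spohn equations: degrees and derivatives\<close>

lemma hfun_marginal: "hfun I 1 (marginal n d k i)"
  unfolding marginal_def[abs_def] by (intro hfun_sum hfun.coord) auto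

lemma hfun_payoff: "hfun I 1 (payoff_sum n d X k i)"
  unfolding payoff_sum_def[abs_def] by (intro hfun_sum hfun_cmult hfun.coord) auto

lemma hfun_total: "hfun I 1 (\<lambda>p. mass p)"
  by (intro hfun_sum hfun.coord)

lemma hfun_spohn_eq: "hfun I 2 (spohn_eq n d X \<kappa>)"
proof -
  obtain k i where \<kappa>: "\<kappa> = (k, i)" by fastforce
  have "hfun I (1 + 1) (\<lambda>p. payoff_sum n d X k i p * mass p -
     marginal n d k i p * (\<Sum>j\<in>I. of_real (X (k, j)) * p j))"
    by (intro hfun_diff hfun.mult hfun_payoff hfun_marginal hfun_total hfun_sum hfun_cmult hfun.coord)
  then show ?thesis unfolding \<kappa> spohn_eq_alt[abs_def] by simp
qed

lemma pfun_spohn_poly: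
  assumes "\<kappa> \<in> K"
  shows "pfun J (spohn_poly n d \<kappa>)"
proof -
  obtain k i where \<kappa>: "\<kappa> = (k, i)" "k \<in> {1..n}" using assms by (auto simp: spohn_index_def)
  then show ?thesis unfolding spohn_poly_def[abs_def] \<kappa> prod.case
    by (intro pfun_diff pfun.mult pfun_sum pfun.coord) (auto simp: game_index_def)
qed

lemma der_spohn_poly:
  assumes k: "k \<in> {1..n}"
  shows "der J v (spohn_poly n d (k, i)) z =
    (\<Sum>j\<in>{j \<in> I. j k = i}. z (Inr (k, j)) * z (Inl j)) * (\<Sum>j\<in>I. v (Inl j) z) +
    (\<Sum>j\<in>{j \<in> I. j k = i}. z (Inr (k, j)) * v (Inl j) z + v (Inr (k, j)) z * z (Inl j)) * (\<Sum>j\<in>I. z (Inl j)) -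
    ((\<Sum>j\<in>{j \<in> I. j k = i}. z (Inl j)) * (\<Sum>j\<in>I. z (Inr (k, j)) * v (Inl j) z + v (Inr (k, j)) z * z (Inl j)) +
     (\<Sum>j\<in>{j \<in> I. j k = i}. v (Inl j) z) * (\<Sum>j\<in>I. z (Inr (k, j)) * z (Inl j)))"
proof -
  have c1: "pfun J (\<lambda>z. z (Inl j) :: complex)" if "j \<in> I" for j by (rule pfun.coord) (use that in simp)
  have c2: "pfun J (\<lambda>z. z (Inr (k, j)) :: complex)" if "j \<in> I" for j
    by (rule pfun.coord) (use that k in \<open>simp add: game_index_def\<close>)
  have d1: "der J v (\<lambda>z. z (Inl j)) z = v (Inl j) z" if "j \<in> I" for j
    by (rule der_coord) (use that in simp_all)
  have d2: "der J v (\<lambda>z. z (Inr (k, j))) z = v (Inr (k, j)) z" if "j \<in> I" for j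
    by (rule der_coord) (use that k in \<open>simp_all add: game_index_def\<close>)
  have p12: "pfun J (\<lambda>z. z (Inr (k, j)) * z (Inl j) :: complex)" if "j \<in> I" for j
    by (rule pfun.mult[OF c2[OF that] c1[OF that]])
  have d12: "der J v (\<lambda>z. z (Inr (k, j)) * z (Inl j)) z = z (Inr (k, j)) * v (Inl j) z + v (Inr (k, j)) z * z (Inl j)"
    if "j \<in> I" for j
    by (subst der_mult[OF c2[OF that] c1[OF that]]) (simp only: d1[OF that] d2[OF that])
  have S: "pfun J (\<lambda>z. \<Sum>j\<in>A. z (Inl j) :: complex)" "pfun J (\<lambda>z. \<Sum>j\<in>A. z (Inr (k, j)) * z (Inl j) :: complex)"
    "der J v (\<lambda>z. \<Sum>j\<in>A. z (Inl j)) z = (\<Sum>j\<in>A. v (Inl j) z)"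
    "der J v (\<lambda>z. \<Sum>j\<in>A. z (Inr (k, j)) * z (Inl j)) z = (\<Sum>j\<in>A. z (Inr (k, j)) * v (Inl j) z + v (Inr (k, j)) z * z (Inl j))"
    if A: "A \<subseteq> I" for A
  proof -
    show "pfun J (\<lambda>z. \<Sum>j\<in>A. z (Inl j) :: complex)" by (rule pfun_sum) (use A c1 in blast)
    show "pfun J (\<lambda>z. \<Sum>j\<in>A. z (Inr (k, j)) * z (Inl j) :: complex)" by (rule pfun_sum) (use A p12 in blast)
    show "der J v (\<lambda>z. \<Sum>j\<in>A. z (Inl j)) z = (\<Sum>j\<in>A. v (Inl j) z)"
      by (subst der_sum[of A J]) (use A c1 d1 in \<open>auto intro!: sum.cong\<close>)
    show "der J v (\<lambda>z. \<Sum>j\<in>A. z (Inr (k, j)) * z (Inl j)) z = (\<Sum>j\<in>A. z (Inr (k, j)) * v (Inl j) z + v (Inr (k, j)) z * z (Inl j))"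
      by (subst der_sum[of A J]) (use A p12 d12 in \<open>auto intro!: sum.cong\<close>)
  qed
  have sub: "{j \<in> I. j k = i} \<subseteq> I" by (rule Collect_subset)
  show ?thesis
    unfolding spohn_poly_def[abs_def] prod.case
    by (subst der_diff[OF pfun.mult[OF S(2)[OF sub] S(1)[OF order_refl]] pfun.mult[OF S(1)[OF sub] S(2)[OF order_refl]]],
        subst der_mult[OF S(2)[OF sub] S(1)[OF order_refl]], subst der_mult[OF S(1)[OF sub] S(2)[OF order_refl]])
      (simp only: S(3,4)[OF sub] S(3,4)[OF order_refl])
qed

text \<open>Along a vector field that moves a single payoff \<open>X (k0, j0)\<close>, only the equations of player
  \<open>k0\<close> feel the change of the game.\<close>

lemma der_spohn_poly_payoff:
  assumes \<kappa>: "(k, i) \<in> K" and y: "(k0, j0) \<in> M" and v: "\<And>x. x \<in> M \<Longrightarrow> x \<noteq> (k0, j0) \<Longrightarrow> v (Inr x) z = 0"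
  shows "der J v (spohn_poly n d (k, i)) z = der J (\<lambda>a _. case_sum (\<lambda>j. v (Inl j) z) (\<lambda>_. 0) a) (spohn_poly n d (k, i)) z +
    (if k = k0 then v (Inr (k0, j0)) z * z (Inl j0) *
       ((if j0 k0 = i then (\<Sum>j\<in>I. z (Inl j)) else 0) - (\<Sum>j\<in>{j \<in> I. j k = i}. z (Inl j))) else 0)"
proof -
  have k: "k \<in> {1..n}" using \<kappa> by (auto simp: spohn_index_def)
  have j0: "j0 \<in> I" using y by (auto simp: game_index_def)
  have sums: "(\<Sum>j\<in>A. v (Inr (k, j)) z * z (Inl j)) = (if k = k0 \<and> j0 \<in> A then v (Inr (k0, j0)) z * z (Inl j0) else 0)"
    if A: "A \<subseteq> I" for A
  proof -
    have "(\<Sum>j\<in>A. v (Inr (k, j)) z * z (Inl j)) = (\<Sum>j\<in>A. if j = j0 then (if k = k0 then v (Inr (k0, j0)) z * z (Inl j0) else 0) else 0)"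
    proof (rule sum.cong[OF refl])
      fix j assume "j \<in> A"
      then have "(k, j) \<in> M" using A k by (auto simp: game_index_def)
      then show "v (Inr (k, j)) z * z (Inl j) = (if j = j0 then (if k = k0 then v (Inr (k0, j0)) z * z (Inl j0) else 0) else 0)"
        using v[of "(k, j)"] by auto
    qed
    moreover have "finite A" by (rule finite_subset[OF A finite_profiles])
    ultimately show ?thesis by simp
  qed
  have sub: "{j \<in> I. j k = i} \<subseteq> I" by (rule Collect_subset)
  show ?thesis
  proof -
    have T: "(if k = k0 \<and> j0 \<in> {j \<in> I. j k = i} then c else 0) * P - D * (if k = k0 \<and> j0 \<in> I then c else 0) =
        (if k = k0 then c * ((if j0 k0 = i then P else 0) - D) else 0)" for c P D :: complex
    proof (cases "k = k0")
      case True
      then have e: "(k = k0 \<and> j0 \<in> {j \<in> I. j k = i}) = (j0 k0 = i)" "(k = k0 \<and> j0 \<in> I) = True" using j0 by auto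
      have r: "c * P - D * c = c * (P - D)" "0 * P - D * c = c * (0 - D)" by (simp_all add: right_diff_distrib mult.commute)
      show ?thesis unfolding e using True r by (cases "j0 k0 = i") simp_all
    next
      case False
      then show ?thesis by simp
    qed
    show ?thesis
      unfolding der_spohn_poly[OF k] sum.distrib sums[OF sub] sums[OF order_refl] sum.case mult_zero_left sum.neutral_const
      by (subst spohn_expand, subst T) (rule refl)
  qed
qed

text \<open>Independence in dual form: each Spohn equation has a direction tangent to the model
  along which it alone changes. With the triangular Markov gradients this gives independence of all
  gradients.\<close>

definition regular :: "game \<Rightarrow> ((nat \<Rightarrow> nat) \<Rightarrow> complex) \<Rightarrow> bool" where
  "regular X p \<longleftrightarrow> (\<forall>\<kappa>\<in>K. \<exists>w. (\<forall>j\<in>I - \<Theta>. dderiv I (markov n E j) p w = 0) \<and>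
     (\<forall>\<kappa>'\<in>K. dderiv I (spohn_eq n d X \<kappa>') p w = (if \<kappa>' = \<kappa> then 1 else 0)))"

text \<open>By \<open>CI_imp_candidate\<close> and \<open>candidate_imp_CI\<close> these are, within
  \<open>coord_space I\<close>, the coordinate vectors of the points of the Spohn CI variety off the
  special hyperplanes.\<close>

definition candidate :: "game \<Rightarrow> ((nat \<Rightarrow> nat) \<Rightarrow> complex) \<Rightarrow> bool" where
  "candidate X p \<longleftrightarrow> (\<forall>j\<in>I. p j \<noteq> 0) \<and> mass p \<noteq> 0 \<and>
     (\<forall>j\<in>I - \<Theta>. markov n E j p = 0) \<and> (\<forall>\<kappa>\<in>K. spohn_eq n d X \<kappa> p = 0)"

text \<open>Genericity is about real games, while the dense set is tested by complex polynomials; on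
  real games such a polynomial is a pair of real ones.\<close>

lemma pfun_real_parts:
  fixes Q :: "((nat \<Rightarrow> nat) + nat \<times> (nat \<Rightarrow> nat) \<Rightarrow> complex) \<Rightarrow> complex"
  assumes "pfun (Inr ` M) Q"
  shows "\<exists>R S :: game \<Rightarrow> real. pfun M R \<and> pfun M S \<and>
    (\<forall>X p. Q (case_sum p (\<lambda>x. of_real (X x))) = Complex (R X) (S X))"
  using assms
proof (induction rule: pfun.induct)
  case (const c)
  show ?case
    by (rule exI[of _ "\<lambda>_. Re c"], rule exI[of _ "\<lambda>_. Im c"]) (auto intro: pfun.const)
next
  case (coord y)
  then obtain x where "x \<in> M" "y = Inr x" by blast
  then show ?case
    by (intro exI[of _ "\<lambda>X. X x"] exI[of _ "\<lambda>_. 0"]) (auto intro: pfun.intros simp: complex_eq_iff)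
next
  case (add f g)
  then obtain R S R' S' where "pfun M R" "pfun M S" "pfun M R'" "pfun M S'"
    "\<forall>X p. f (case_sum p (\<lambda>x. of_real (X x))) = Complex (R X) (S X)"
    "\<forall>X p. g (case_sum p (\<lambda>x. of_real (X x))) = Complex (R' X) (S' X)" by metis
  then show ?case
    by (intro exI[of _ "\<lambda>X. R X + R' X"] exI[of _ "\<lambda>X. S X + S' X"] conjI pfun.add) (simp_all add: complex_eq_iff)
next
  case (mult f g)
  then obtain R S R' S' where "pfun M R" "pfun M S" "pfun M R'" "pfun M S'"
    "\<forall>X p. f (case_sum p (\<lambda>x. of_real (X x))) = Complex (R X) (S X)"
    "\<forall>X p. g (case_sum p (\<lambda>x. of_real (X x))) = Complex (R' X) (S' X)" by metis
  then show ?case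
    by (intro exI[of _ "\<lambda>X. R X * R' X - S X * S' X"] exI[of _ "\<lambda>X. R X * S' X + S X * R' X"] conjI pfun.add pfun.mult pfun_diff)
      (simp_all add: complex_eq_iff)
qed

lemma dderiv_linear: "dderiv I f p (\<lambda>i. a * w i + b * w' i) = a * dderiv I f p w + b * dderiv I f p w'"
  by (simp add: der_def algebra_simps sum.distrib sum_distrib_left)

text \<open>Generic smoothness: otherwise the derivations of a generic point of the critical set that move
  single payoffs provide the tangent directions that the critical set lacks by definition.\<close>

lemma generic_regular:
  "\<exists>Q :: game \<Rightarrow> real. pfun M Q \<and> (\<exists>X. Q X \<noteq> 0) \<and> (\<forall>X p. Q X \<noteq> 0 \<longrightarrow> candidate X p \<longrightarrow> regular X p)"
proof (rule ccontr)
  assume neg: "\<not> ?thesis"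
  define C where "C = {case_sum p (\<lambda>x. complex_of_real (X x)) |p X. candidate X p \<and> \<not> regular X p}"
  let ?Y = "Inr ` M :: ((nat \<Rightarrow> nat) + nat \<times> (nat \<Rightarrow> nat)) set"
  have dense: "\<exists>z\<in>C. Q z \<noteq> 0" if Q: "pfun ?Y Q" "Q \<noteq> 0" for Q
  proof -
    obtain R S :: "game \<Rightarrow> real" where RS: "pfun M R" "pfun M S"
      "\<forall>X p. Q (case_sum p (\<lambda>x. of_real (X x))) = Complex (R X) (S X)"
      using pfun_real_parts[OF Q(1)] by blast
    have "\<exists>x. Q (\<lambda>i. complex_of_real (x i)) \<noteq> 0"
    proof (rule ccontr)
      assume "\<not> ?thesis"
      then have "Q y = 0" for y using pfun_zero_on_reals[OF Q(1)] by blast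
      then show False using Q(2) by (auto simp: fun_eq_iff)
    qed
    then obtain x where x: "Q (\<lambda>i. complex_of_real (x i)) \<noteq> 0" by blast
    have eq: "(\<lambda>i. complex_of_real (x i)) = case_sum (\<lambda>j. of_real (x (Inl j))) (\<lambda>y. of_real ((x \<circ> Inr) y))"
      by (auto simp: fun_eq_iff split: sum.splits)
    have "Q (\<lambda>i. complex_of_real (x i)) = Complex (R (x \<circ> Inr)) (S (x \<circ> Inr))"
      unfolding eq by (rule RS(3)[rule_format])
    \<comment> \<open>The negated claim speaks of real polynomials. It is applied to whichever part
      of \<open>Q\<close> is nonzero somewhere, and \<open>Q\<close> is nonzero wherever that part
      is.\<close>
    then have "R (x \<circ> Inr) \<noteq> 0 \<or> S (x \<circ> Inr) \<noteq> 0" using x by (auto simp: complex_eq_iff)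
    then obtain T :: "game \<Rightarrow> real" where T: "T \<in> {R, S}" "pfun M T" "\<exists>X. T X \<noteq> 0" using RS(1,2) by blast
    then obtain X p where Xp: "T X \<noteq> 0" "candidate X p" "\<not> regular X p" using neg by blast
    have "Q (case_sum p (\<lambda>x. of_real (X x))) \<noteq> 0"
      using RS(3) T(1) Xp(1) by (auto simp: complex_eq_iff)
    moreover have "case_sum p (\<lambda>x. of_real (X x)) \<in> C" unfolding C_def using Xp(2,3) by blast
    ultimately show ?thesis by (rule bexI)
  qed
  then have dense': "\<forall>Q. pfun ?Y Q \<longrightarrow> Q \<noteq> 0 \<longrightarrow> (\<exists>z\<in>C. Q z \<noteq> 0)" by (intro allI impI)
  have YJ: "?Y \<subseteq> J" by (rule Un_upper2)
  obtain P where P: "prime_pfun J P" "prime_pfun.indep P ?Y"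
    and Pz: "\<forall>F h. finite F \<longrightarrow> F \<subseteq> P \<longrightarrow> pfun J h \<longrightarrow> h \<notin> P \<longrightarrow> (\<exists>z\<in>C. (\<forall>f\<in>F. f z = 0) \<and> h z \<noteq> 0)"
    and PC: "\<forall>f. pfun J f \<longrightarrow> (\<forall>z\<in>C. f z = 0) \<longrightarrow> f \<in> P"
    using generic_point[OF finite_indices(3) dense' YJ] by (elim exE conjE)
  interpret prime_pfun J P by fact
  obtain v H where H: "pfun J H" "H \<notin> P" "\<forall>q. H q \<noteq> 0 \<longrightarrow> (\<forall>y\<in>?Y. v y y q \<noteq> 0)"
    and v: "\<forall>y\<in>?Y. (\<forall>x\<in>?Y - {y}. v y x = 0) \<and> (\<forall>f\<in>P. der J (v y) f \<in> P)"
    using derivations_exist[OF YJ P(2)] by (elim exE conjE)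
  define B where "B = (\<lambda>j z. markov n E j (z \<circ> Inl)) ` (I - \<Theta>) \<union> spohn_poly n d ` K"
  have BP: "f \<in> P" if f: "f \<in> B" for f
  proof -
    consider j where "j \<in> I - \<Theta>" "f = (\<lambda>z. markov n E j (z \<circ> Inl))" | \<kappa> where "\<kappa> \<in> K" "f = spohn_poly n d \<kappa>"
      using f unfolding B_def by blast
    then show ?thesis
    proof cases
      case (1 j)
      have "pfun J f" unfolding 1(2)
        by (rule pfun_compose[OF hfun_imp_pfun[OF hfun_markov[OF 1(1)]]]) (auto intro: pfun.coord)
      moreover have "\<forall>z\<in>C. f z = 0"
        using 1 by (auto simp: C_def candidate_def comp_def)
      ultimately show ?thesis using PC by blast
    next
      case (2 \<kappa>)
      have "pfun J f" unfolding 2(2) by (rule pfun_spohn_poly[OF 2(1)])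
      moreover have "\<forall>z\<in>C. f z = 0"
        using 2 by (auto simp: C_def candidate_def spohn_eq_def)
      ultimately show ?thesis using PC by blast
    qed
  qed
  \<comment> \<open>The derivatives of all equations along all vector fields are finitely many
    elements of \<open>P\<close>, so one actual irregular pair annihilates them while
    \<open>H\<close> is nonzero there.\<close>
  define F where "F = (\<lambda>(y, f). der J (v y) f) ` (?Y \<times> B)"
  have "finite F" unfolding F_def B_def by simp
  moreover have "F \<subseteq> P" unfolding F_def using v BP by auto
  ultimately obtain z where z: "z \<in> C" "\<forall>f\<in>F. f z = 0" "H z \<noteq> 0" using Pz H(1,2) by blast
  obtain p X where pX: "z = case_sum p (\<lambda>x. complex_of_real (X x))" "candidate X p" "\<not> regular X p"
    using z(1) unfolding C_def by blast
  have zl: "z \<circ> Inl = p" "\<And>j. z (Inl j) = p j" by (auto simp: pX(1) fun_eq_iff)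
  have vz: "der J (v y) f z = 0" if "y \<in> ?Y" "f \<in> B" for y f using z(2) that by (auto simp: F_def)
  \<comment> \<open>The part of the vector field in the probabilities. The Markov binomials do not
    involve the payoffs, so \<open>W y\<close> is tangent to the model.\<close>
  define W where "W y j = v y (Inl j) z" for y j
  have Wm: "dderiv I (markov n E j) p (W y) = 0" if "j \<in> I - \<Theta>" "y \<in> ?Y" for j y
    using vz[OF that(2), of "\<lambda>z. markov n E j (z \<circ> Inl)"] der_through_Inl[OF finite_profiles finite_indices(2), of "v y" "markov n E j" z] that(1)
    by (auto simp: B_def zl W_def[abs_def])
  have Ws: "dderiv I (spohn_eq n d X (k, i)) p (W (Inr (k0, j0))) =
      - (if k = k0 then v (Inr (k0, j0)) (Inr (k0, j0)) z * p j0 * ((if j0 k0 = i then mass p else 0) - (\<Sum>j\<in>{j \<in> I. j k = i}. p j)) else 0)"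
    if \<kappa>: "(k, i) \<in> K" and y: "(k0, j0) \<in> M" for k i k0 j0
  proof -
    let ?y = "Inr (k0, j0) :: (nat \<Rightarrow> nat) + nat \<times> (nat \<Rightarrow> nat)"
    have yY: "?y \<in> ?Y" by (rule imageI[OF y])
    have z0: "der J (v ?y) (spohn_poly n d (k, i)) z = 0"
    proof (rule vz[OF yY])
      show "spohn_poly n d (k, i) \<in> B" unfolding B_def by (rule UnI2[OF imageI[OF \<kappa>]])
    qed
    have off: "v ?y (Inr x) z = 0" if "x \<in> M" "x \<noteq> (k0, j0)" for x
    proof -
      have "Inr x \<in> ?Y - {?y}" by (rule DiffI[OF imageI[OF that(1)]]) (use that(2) in simp)
      then have "v ?y (Inr x) = 0" by (rule bspec[OF conjunct1[OF bspec[OF v yY]]])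
      then show ?thesis by simp
    qed
    have e1: "der J (v ?y) (spohn_poly n d (k, i)) z = der J (\<lambda>a _. case_sum (\<lambda>j. v ?y (Inl j) z) (\<lambda>_. 0) a) (spohn_poly n d (k, i)) z +
        (if k = k0 then v ?y ?y z * z (Inl j0) *
        ((if j0 k0 = i then (\<Sum>j\<in>I. z (Inl j)) else 0) - (\<Sum>j\<in>{j \<in> I. j k = i}. z (Inl j))) else 0)"
    proof (rule der_spohn_poly_payoff[where v = "v ?y" and z = z, OF \<kappa> y])
      fix x assume "x \<in> M" "x \<noteq> (k0, j0)"
      then show "v ?y (Inr x) z = 0" by (rule off)
    qed
    have e2: "dderiv I (spohn_eq n d X (k, i)) p (W ?y) = der J (\<lambda>a _. case_sum (W ?y) (\<lambda>_. 0) a) (spohn_poly n d (k, i)) z"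
      unfolding spohn_eq_def[abs_def] pX(1) by (rule dderiv_section) simp_all
    have e3: "W ?y = (\<lambda>j. v ?y (Inl j) z)" unfolding W_def[abs_def] by (rule refl)
    have "dderiv I (spohn_eq n d X (k, i)) p (W ?y) +
        (if k = k0 then v ?y ?y z * z (Inl j0) *
        ((if j0 k0 = i then (\<Sum>j\<in>I. z (Inl j)) else 0) - (\<Sum>j\<in>{j \<in> I. j k = i}. z (Inl j))) else 0) = 0"
      unfolding e3 unfolding e2[unfolded e3] unfolding e1[symmetric] by (rule z0)
    then show ?thesis unfolding zl(2) by (rule iffD2[OF eq_neg_iff_add_eq_0])
  qed
  have "regular X p"
    unfolding regular_def
  proof
    fix \<kappa> assume \<kappa>: "\<kappa> \<in> K"
    then obtain k0 i0 where k0: "\<kappa> = (k0, i0)" "k0 \<in> {1..n}" "2 \<le> i0" "i0 \<le> d k0" by (auto simp: spohn_index_def)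
    \<comment> \<open>Two profiles differing only at player \<open>k0\<close>: one plays strategy
      \<open>1\<close>, which has no equation, the other \<open>i0\<close>.\<close>
    define j1 where "j1 = (\<lambda>i\<in>{1..n}. 1 :: nat)"
    define j2 where "j2 = j1(k0 := i0)"
    have jI: "j1 \<in> I" "j2 \<in> I" using strategies k0
      by (auto simp: j1_def j2_def profiles_on_def PiE_iff extensional_def)
    have jM: "(k0, j1) \<in> M" "(k0, j2) \<in> M" using jI k0 by (auto simp: game_index_def)
    have jk: "j1 k0 = 1" "j2 k0 = i0" using k0 by (auto simp: j1_def j2_def)
    define c1 where "c1 = v (Inr (k0, j1)) (Inr (k0, j1)) z"
    define c2 where "c2 = v (Inr (k0, j2)) (Inr (k0, j2)) z"
    have c: "c1 \<noteq> 0" "c2 \<noteq> 0" unfolding c1_def c2_def using H(3) z(3) jM by blast+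
    have t: "mass p \<noteq> 0" and pj: "p j1 \<noteq> 0" "p j2 \<noteq> 0" using pX(2) jI by (auto simp: candidate_def)
    \<comment> \<open>Divided by the speed of the payoff, the probability and the mass, the
      direction for \<open>j1\<close> changes the equation of strategy \<open>i\<close> by its
      marginal over the mass; the one for \<open>j2\<close> does the same, minus \<open>1\<close> if
      \<open>i = i0\<close>. The difference isolates \<open>i0\<close>.\<close>
    define w where "w = (\<lambda>i. (1 / (mass p * c1 * p j1)) * W (Inr (k0, j1)) i + (- 1 / (mass p * c2 * p j2)) * W (Inr (k0, j2)) i)"
    have "dderiv I (markov n E j) p w = 0" if "j \<in> I - \<Theta>" for j
      unfolding w_def dderiv_linear using Wm[OF that] jM by simp
    moreover have "dderiv I (spohn_eq n d X \<kappa>') p w = (if \<kappa>' = \<kappa> then 1 else 0)" if "\<kappa>' \<in> K" for \<kappa>'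
    proof -
      obtain k i where ki0: "\<kappa>' = (k, i)" by fastforce
      have ki: "\<kappa>' = (k, i)" "(k, i) \<in> K" "2 \<le> i" using that ki0 by (auto simp: spohn_index_def)
      show ?thesis
      proof (cases "k = k0")
        case True
        let ?m = "\<Sum>j\<in>{j \<in> I. j k = i}. p j"
        have 1: "dderiv I (spohn_eq n d X (k, i)) p (W (Inr (k0, j1))) = c1 * p j1 * ?m"
          using Ws[OF ki(2) jM(1)] True jk ki(3) by (simp add: c1_def)
        have 2: "dderiv I (spohn_eq n d X (k, i)) p (W (Inr (k0, j2))) = - (c2 * p j2 * ((if i0 = i then mass p else 0) - ?m))"
          using Ws[OF ki(2) jM(2)] True jk by (simp add: c2_def)
        have "dderiv I (spohn_eq n d X \<kappa>') p w = ?m / mass p + ((if i0 = i then mass p else 0) - ?m) / mass p"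
          unfolding ki(1) w_def dderiv_linear 1 2 using c pj by simp
        also have "\<dots> = (if i0 = i then 1 else 0)" using t by (simp add: diff_divide_distrib)
        finally show ?thesis using True ki(1) k0(1) by auto
      next
        case False
        then show ?thesis
          unfolding ki(1) w_def dderiv_linear using Ws[OF ki(2) jM(1)] Ws[OF ki(2) jM(2)] k0(1) by simp
      qed
    qed
    ultimately show "\<exists>w. (\<forall>j\<in>I - \<Theta>. dderiv I (markov n E j) p w = 0) \<and>
     (\<forall>\<kappa>'\<in>K. dderiv I (spohn_eq n d X \<kappa>') p w = (if \<kappa>' = \<kappa> then 1 else 0))" by (intro exI[of _ w]) simp
  qed
  then show False using pX(3) by simp
qed

end

section \<open>Smooth functions\<close>

lemma pfun_C_k_on:
  fixes f :: "('i \<Rightarrow> real) \<Rightarrow> real"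
  shows "pfun J f \<Longrightarrow> C_k_on m I U f"
proof (induction m arbitrary: f)
  case 0
  then show ?case by (simp add: pfun_continuous_on)
next
  case (Suc m)
  have "(\<lambda>t. f (x(i := t))) differentiable (at (x i))" for x i
    unfolding real_differentiable_def using pfun_has_partial[OF Suc.prems, of x i "x i"] by blast
  then show ?case
    unfolding C_k_on.simps by (intro conjI ballI pfun_continuous_on[OF Suc.prems] Suc.IH pfun_partial[OF Suc.prems])
qed

lemma pfun_C_infinity_on: "pfun J f \<Longrightarrow> C_infinity_on I U f"
  unfolding C_infinity_on_def by (intro allI pfun_C_k_on)

section \<open>Holomorphic functions on polydiscs and their derivatives\<close>

lemma polydisc_shrink:
  assumes "\<tau> \<in> polydisc k \<epsilon>" "\<epsilon> > 0"
  shows "\<exists>e. 0 < e \<and> e < \<epsilon> \<and> \<tau> \<in> polydisc k e"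
proof -
  define m where "m = Max (insert 0 ((\<lambda>i. norm (\<tau> i)) ` {..<k}))"
  have mi: "norm (\<tau> i) \<le> m" if "i < k" for i using that unfolding m_def by auto
  have m: "0 \<le> m" "m < \<epsilon>" using assms unfolding m_def by (auto simp: polydisc_def)
  then have "\<tau> \<in> polydisc k ((m + \<epsilon>) / 2)"
    unfolding polydisc_def
  proof (intro CollectI allI impI)
    fix i assume "i < k"
    then have "norm (\<tau> i) \<le> m" by (rule mi)
    moreover have "m < (m + \<epsilon>) / 2" using m(2) by simp
    ultimately show "norm (\<tau> i) < (m + \<epsilon>) / 2" by (rule order.strict_trans1)
  qed
  then show ?thesis using m by (intro exI[of _ "(m + \<epsilon>) / 2"]) simp
qed

lemma open_polydisc: "open (polydisc k e)"
proof -
  have eq: "polydisc k e = (\<Inter>i\<in>{..<k}. {\<tau>. norm (\<tau> i) < e})" by (auto simp: polydisc_def)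
  show ?thesis unfolding eq
    by (intro open_INT ballI open_Collect_less continuous_intros continuous_on_product_coordinates) auto
qed

lemma holomorphic_polydisc_continuous_on:
  assumes "holomorphic_polydisc k \<epsilon> f" "\<epsilon> > 0"
  shows "continuous_on (polydisc k \<epsilon>) f"
proof -
  obtain F where F: "\<forall>n. pfun {..<k} (F n)"
    "\<forall>e. 0 < e \<longrightarrow> e < \<epsilon> \<longrightarrow> uniform_limit (closed_polydisc k e) F f sequentially"
    using assms(1) unfolding holomorphic_polydisc_def by (elim exE conjE)
  have "continuous_on (polydisc k e) f" if e: "0 < e" "e < \<epsilon>" for e
  proof (rule continuous_on_subset)
    show "continuous_on (closed_polydisc k e) f"
    proof (rule uniform_limit_theorem)
      show "\<forall>\<^sub>F n in sequentially. continuous_on (closed_polydisc k e) (F n)"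
        by (intro always_eventually allI pfun_continuous_on[OF F(1)[rule_format]])
      show "uniform_limit (closed_polydisc k e) F f sequentially" by (rule F(2)[rule_format, OF e])
    qed simp
    show "polydisc k e \<subseteq> closed_polydisc k e" by (auto simp: polydisc_def closed_polydisc_def less_imp_le)
  qed
  then have "continuous_on (\<Union>e\<in>{0<..<\<epsilon>}. polydisc k e) f"
    by (intro continuous_on_open_UN open_polydisc) auto
  then show ?thesis
    by (rule continuous_on_subset) (use polydisc_shrink assms(2) in fastforce)
qed

lemma holomorphic_polydisc_slice:
  assumes F: "\<forall>n. pfun {..<k} (F n)" and lim: "uniform_limit (closed_polydisc k e') F f sequentially"
    and \<tau>: "\<tau> \<in> closed_polydisc k e" and e: "e < e'"
  shows "continuous_on (cball (\<tau> i) (e' - e)) (\<lambda>z. f (\<tau>(i := z))) \<and> (\<lambda>z. f (\<tau>(i := z))) holomorphic_on ball (\<tau> i) (e' - e)"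
proof (rule holomorphic_uniform_limit)
  have sub: "\<tau>(i := z) \<in> closed_polydisc k e'" if z: "z \<in> cball (\<tau> i) (e' - e)" for z
    unfolding closed_polydisc_def
  proof (intro CollectI allI impI)
    fix j assume j: "j < k"
    have \<tau>j: "norm (\<tau> j) \<le> e" using \<tau> j by (simp add: closed_polydisc_def)
    have "norm z \<le> norm (\<tau> i) + norm (z - \<tau> i)" by (rule norm_triangle_sub)
    then show "norm ((\<tau>(i := z)) j) \<le> e'"
      using \<tau>j e z by (cases "j = i") (auto simp: dist_norm norm_minus_commute)
  qed
  show "uniform_limit (cball (\<tau> i) (e' - e)) (\<lambda>n z. F n (\<tau>(i := z))) (\<lambda>z. f (\<tau>(i := z))) sequentially"
    by (rule uniform_limit_compose'[OF lim]) (use sub in auto)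
  have d: "(\<lambda>z. F n (\<tau>(i := z))) field_differentiable (at z)" for n z
    by (rule pfun_field_differentiable[OF F[rule_format]])
  have h: "(\<lambda>z. F n (\<tau>(i := z))) holomorphic_on S" for n S
    unfolding holomorphic_on_def using d field_differentiable_at_within by blast
  show "\<forall>\<^sub>F n in sequentially. continuous_on (cball (\<tau> i) (e' - e)) (\<lambda>z. F n (\<tau>(i := z))) \<and>
      (\<lambda>z. F n (\<tau>(i := z))) holomorphic_on ball (\<tau> i) (e' - e)"
    by (rule always_eventually) (intro allI conjI h holomorphic_on_imp_continuous_on[OF h])
qed simp_all

lemma holomorphic_polydisc_has_partial:
  assumes f: "holomorphic_polydisc k \<epsilon> f" and \<epsilon>: "\<epsilon> > 0" and \<tau>: "\<tau> \<in> polydisc k \<epsilon>"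
  shows "((\<lambda>z. f (\<tau>(i := z))) has_field_derivative partial i f \<tau>) (at (\<tau> i))"
proof -
  obtain F where F: "\<forall>n. pfun {..<k} (F n)"
    "\<forall>e. 0 < e \<longrightarrow> e < \<epsilon> \<longrightarrow> uniform_limit (closed_polydisc k e) F f sequentially"
    using f unfolding holomorphic_polydisc_def by (elim exE conjE)
  obtain e where e: "0 < e" "e < \<epsilon>" "\<tau> \<in> polydisc k e" using polydisc_shrink[OF \<tau> \<epsilon>] by (elim exE conjE)
  define e' where "e' = (e + \<epsilon>) / 2"
  have e': "0 < e'" "e' < \<epsilon>" "e < e'" using e by (auto simp: e'_def)
  have "\<tau> \<in> closed_polydisc k e" using e(3) by (auto simp: polydisc_def closed_polydisc_def less_imp_le)
  from holomorphic_polydisc_slice[OF F(1) F(2)[rule_format, OF e'(1,2)] this e'(3), of i]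
  have "(\<lambda>z. f (\<tau>(i := z))) holomorphic_on ball (\<tau> i) (e' - e)" by (rule conjunct2)
  then have "(\<lambda>z. f (\<tau>(i := z))) field_differentiable (at (\<tau> i))"
    by (rule holomorphic_on_imp_differentiable_at) (use e' in auto)
  then show ?thesis unfolding partial_def by (rule field_differentiable_derivI)
qed

text \<open>Cauchy's inequality on discs of radius \<open>r = e' - e\<close> bounds the derivative
  of the difference by its supremum on the larger polydisc divided by \<open>r\<close>, so the
  derivatives of the approximating polynomials converge uniformly on the smaller one.\<close>

lemma holomorphic_polydisc_partial:
  assumes f: "holomorphic_polydisc k \<epsilon> f"
  shows "holomorphic_polydisc k \<epsilon> (partial i f)"
proof -
  obtain F where F: "\<forall>n. pfun {..<k} (F n)"
    "\<forall>e. 0 < e \<longrightarrow> e < \<epsilon> \<longrightarrow> uniform_limit (closed_polydisc k e) F f sequentially"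
    using f unfolding holomorphic_polydisc_def by (elim exE conjE)
  have "uniform_limit (closed_polydisc k e) (\<lambda>n. partial i (F n)) (partial i f) sequentially"
    if e: "0 < e" "e < \<epsilon>" for e
  proof (rule uniform_limitI)
    fix \<delta> :: real assume \<delta>: "\<delta> > 0"
    define e' where "e' = (e + \<epsilon>) / 2"
    have e': "0 < e'" "e' < \<epsilon>" "e < e'" using e by (auto simp: e'_def)
    define r where "r = e' - e"
    have r: "r > 0" using e' by (simp add: r_def)
    note lim = F(2)[rule_format, OF e'(1,2)]
    have "\<forall>\<^sub>F n in sequentially. \<forall>\<tau>\<in>closed_polydisc k e'. dist (F n \<tau>) (f \<tau>) < \<delta> * r / 2"
      using lim by (rule uniform_limitD) (use \<delta> r in simp)
    then show "\<forall>\<^sub>F n in sequentially. \<forall>\<tau>\<in>closed_polydisc k e. dist (partial i (F n) \<tau>) (partial i f \<tau>) < \<delta>"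
    proof (rule eventually_mono, intro ballI)
      fix n \<tau> assume n: "\<forall>\<tau>\<in>closed_polydisc k e'. dist (F n \<tau>) (f \<tau>) < \<delta> * r / 2"
        and \<tau>: "\<tau> \<in> closed_polydisc k e"
      let ?g = "\<lambda>z. F n (\<tau>(i := z)) - f (\<tau>(i := z))"
      have dF: "(\<lambda>z. F n (\<tau>(i := z))) field_differentiable (at z)" for z
        by (rule pfun_field_differentiable[OF F(1)[rule_format]])
      have hF: "(\<lambda>z. F n (\<tau>(i := z))) holomorphic_on S" for S
        unfolding holomorphic_on_def using dF field_differentiable_at_within by blast
      have s: "continuous_on (cball (\<tau> i) r) (\<lambda>z. f (\<tau>(i := z))) \<and> (\<lambda>z. f (\<tau>(i := z))) holomorphic_on ball (\<tau> i) r"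
        unfolding r_def by (rule holomorphic_polydisc_slice[OF F(1) lim \<tau> e'(3)])
      have "norm ((deriv ^^ Suc 0) ?g (\<tau> i)) \<le> fact (Suc 0) * (\<delta> * r / 2) / r ^ Suc 0"
      proof (rule Cauchy_inequality)
        show "?g holomorphic_on ball (\<tau> i) r" by (intro holomorphic_on_diff hF conjunct2[OF s])
        show "continuous_on (cball (\<tau> i) r) ?g"
          by (intro continuous_on_diff holomorphic_on_imp_continuous_on[OF hF] conjunct1[OF s])
        fix z assume z: "norm (\<tau> i - z) = r"
        have "\<tau>(i := z) \<in> closed_polydisc k e'"
          unfolding closed_polydisc_def
        proof (intro CollectI allI impI)
          fix j assume j: "j < k"
          have \<tau>j: "norm (\<tau> j) \<le> e" using \<tau> j by (simp add: closed_polydisc_def)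
          have "norm z \<le> norm (\<tau> i) + norm (z - \<tau> i)" by (rule norm_triangle_sub)
          then show "norm ((\<tau>(i := z)) j) \<le> e'"
            using \<tau>j e' z by (cases "j = i") (auto simp: r_def norm_minus_commute)
        qed
        then show "norm (?g z) \<le> \<delta> * r / 2" using n by (auto simp: dist_norm less_imp_le)
      qed (rule r)
      moreover have "(deriv ^^ Suc 0) ?g (\<tau> i) = partial i (F n) \<tau> - partial i f \<tau>"
      proof -
        have "(\<lambda>z. f (\<tau>(i := z))) field_differentiable (at (\<tau> i))"
          by (rule holomorphic_on_imp_differentiable_at[OF conjunct2[OF s]]) (use r in auto)
        then show ?thesis unfolding partial_def using deriv_diff[OF dF[of "\<tau> i"]] by simp
      qed
      ultimately have "norm (partial i (F n) \<tau> - partial i f \<tau>) \<le> \<delta> / 2" using r by simp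
      then show "dist (partial i (F n) \<tau>) (partial i f \<tau>) < \<delta>" using \<delta> by (simp add: dist_norm)
    qed
  qed
  moreover have "\<forall>n. pfun {..<k} (partial i (F n))" by (intro allI pfun_partial F(1)[rule_format])
  ultimately show ?thesis
    unfolding holomorphic_polydisc_def by (intro exI[of _ "\<lambda>n. partial i (F n)"] conjI allI impI) simp_all
qed

text \<open>Differentiation along a real parameter commutes with taking real parts, which reduces
  order \<open>m + 1\<close> to \<open>m\<close>. The claim concerns any \<open>g\<close> agreeing
  with the real part on the box, since \<open>partial i g\<close> is identified only there.\<close>

lemma holomorphic_polydisc_C_k_on:
  fixes g :: "(nat \<Rightarrow> real) \<Rightarrow> real"
  assumes "\<epsilon> > 0" and T: "T \<subseteq> {t. \<forall>i<k. \<bar>t i\<bar> < \<epsilon>}"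
  shows "holomorphic_polydisc k \<epsilon> f \<Longrightarrow> (\<forall>t. (\<forall>i<k. \<bar>t i\<bar> < \<epsilon>) \<longrightarrow> g t = Re (f (\<lambda>i. of_real (t i)))) \<Longrightarrow>
    C_k_on m {..<k} T g"
proof (induction m arbitrary: f g)
  case (0 f g)
  have "continuous_on T (\<lambda>t. Re (f (\<lambda>i. of_real (t i))))"
  proof (rule continuous_on_Re, rule continuous_on_compose2[OF holomorphic_polydisc_continuous_on[OF 0(1) assms(1)]])
    show "continuous_on T (\<lambda>t i. complex_of_real (t i))"
      by (intro continuous_on_coordinatewise_then_product continuous_on_of_real
        continuous_on_subset[OF continuous_on_product_coordinates]) auto
    show "(\<lambda>t i. complex_of_real (t i)) ` T \<subseteq> polydisc k \<epsilon>" using T by (auto simp: polydisc_def)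
  qed
  then have "continuous_on T g"
    by (rule continuous_on_eq) (use 0(2) T in auto)
  then show ?case by simp
next
  case (Suc m f g)
  have 1: "((\<lambda>s. g (t(i := s))) has_real_derivative Re (partial i f (\<lambda>i. of_real (t i)))) (at (t i))"
    if t: "\<forall>i<k. \<bar>t i\<bar> < \<epsilon>" and i: "i < k" for t i
  proof -
    let ?\<tau> = "\<lambda>i. complex_of_real (t i)"
    have "?\<tau> \<in> polydisc k \<epsilon>" using t by (auto simp: polydisc_def)
    then have "((\<lambda>z. f (?\<tau>(i := z))) has_field_derivative partial i f ?\<tau>) (at (of_real (t i)))"
      by (rule holomorphic_polydisc_has_partial[OF Suc(2) assms(1)])
    then have "((\<lambda>s. f (?\<tau>(i := of_real s))) has_vector_derivative partial i f ?\<tau>) (at (t i))"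
      by (rule has_vector_derivative_real_field)
    then have "((\<lambda>s. Re (f (?\<tau>(i := of_real s)))) has_vector_derivative Re (partial i f ?\<tau>)) (at (t i))"
      by (rule bounded_linear.has_vector_derivative[OF bounded_linear_Re])
    then have "((\<lambda>s. Re (f (?\<tau>(i := of_real s)))) has_real_derivative Re (partial i f ?\<tau>)) (at (t i))"
      by (simp add: has_real_derivative_iff_has_vector_derivative)
    then show ?thesis
    proof (rule has_field_derivative_transform_within_open)
      show "open {-\<epsilon><..<\<epsilon>}" by simp
      show "t i \<in> {-\<epsilon><..<\<epsilon>}" using t i by (simp add: abs_less_iff) fastforce
      fix s assume "s \<in> {-\<epsilon><..<\<epsilon>}"
      then have "\<forall>j<k. \<bar>(t(i := s)) j\<bar> < \<epsilon>" using t by auto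
      moreover have "(\<lambda>j. complex_of_real ((t(i := s)) j)) = ?\<tau>(i := of_real s)" by auto
      ultimately show "Re (f (?\<tau>(i := of_real s))) = g (t(i := s))" using Suc(3) by simp
    qed
  qed
  have 2: "C_k_on m {..<k} T (partial i g)" if i: "i < k" for i
  proof (rule Suc.IH)
    show "holomorphic_polydisc k \<epsilon> (partial i f)" by (rule holomorphic_polydisc_partial[OF Suc(2)])
    show "\<forall>t. (\<forall>i<k. \<bar>t i\<bar> < \<epsilon>) \<longrightarrow> partial i g t = Re (partial i f (\<lambda>i. of_real (t i)))"
      unfolding partial_def[of i g] by (intro allI impI DERIV_imp_deriv 1) (use i in auto)
  qed
  have 3: "continuous_on T g"
    using Suc.IH[OF Suc(2,3)] by (cases m) simp_all
  show ?case
    unfolding C_k_on.simps real_differentiable_def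
    using 1 2 3 T by fastforce
qed

lemma holomorphic_polydisc_C_infinity_on:
  assumes "\<epsilon> > 0" "T \<subseteq> {t. \<forall>i<k. \<bar>t i\<bar> < \<epsilon>}" "holomorphic_polydisc k \<epsilon> f"
  shows "C_infinity_on {..<k} T (\<lambda>t. Re (f (\<lambda>i. of_real (t i))))"
  unfolding C_infinity_on_def
  by (intro allI holomorphic_polydisc_C_k_on[OF assms]) simp

section \<open>The Spohn CI variety\<close>

context game_model
begin

lemma profiles_nonempty: "I \<noteq> {}"
proof -
  have "(\<lambda>i\<in>{1..n}. 1) \<in> I" using strategies by (auto simp: profiles_on_def)
  then show ?thesis by blast
qed

section \<open>Minors against expected-payoff equations\<close>

lemma sum_by_strategy:
  assumes "k \<in> {1..n}"
  shows "(\<Sum>i\<in>{1..d k}. \<Sum>j\<in>{j \<in> I. j k = i}. f j) = (\<Sum>j\<in>I. f j)"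
proof (rule sum.group[OF finite_profiles finite_atLeastAtMost])
  show "(\<lambda>j. j k) ` I \<subseteq> {1..d k}" using assms by (auto simp: profiles_on_def PiE_iff)
qed

lemma sum_marginal: "k \<in> {1..n} \<Longrightarrow> (\<Sum>i\<in>{1..d k}. marginal n d k i p) = mass p"
  unfolding marginal_def by (rule sum_by_strategy)

lemma sum_payoff: "k \<in> {1..n} \<Longrightarrow> (\<Sum>i\<in>{1..d k}. payoff_sum n d X k i p) = (\<Sum>j\<in>I. of_real (X (k, j)) * p j)"
  unfolding payoff_sum_def by (rule sum_by_strategy)

text \<open>Summing the minors over the strategies \<open>i'\<close> replaces the row of
  \<open>i'\<close> by the sum of all rows.\<close>

lemma spohn_variety_imp_eq:
  assumes x: "x \<in> spohn_variety n d X" "p \<in> x" and \<kappa>: "\<kappa> \<in> K"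
  shows "spohn_eq n d X \<kappa> p = 0"
proof -
  obtain k i where ki0: "\<kappa> = (k, i)" by fastforce
  have k: "k \<in> {1..n}" "i \<in> {1..d k}" using \<kappa> ki0 by (auto simp: spohn_index_def)
  have min: "marginal n d k i' p * payoff_sum n d X k i p = marginal n d k i p * payoff_sum n d X k i' p"
    if "i' \<in> {1..d k}" for i' using x k that by (auto simp: spohn_variety_def)
  have "payoff_sum n d X k i p * mass p = (\<Sum>i'\<in>{1..d k}. marginal n d k i' p * payoff_sum n d X k i p)"
    unfolding sum_marginal[OF k(1), symmetric] by (simp add: sum_distrib_left mult.commute)
  also have "\<dots> = marginal n d k i p * (\<Sum>j\<in>I. of_real (X (k, j)) * p j)"
    unfolding sum_payoff[OF k(1), symmetric] sum_distrib_left by (rule sum.cong[OF refl min])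
  finally show ?thesis unfolding ki0 spohn_eq_alt by simp
qed

text \<open>The equations for \<open>i\<close> from \<open>2\<close> on make the corresponding rows
  multiples of \<open>(1, c)\<close>, where \<open>c\<close> is the expected payoff. The sum of all
  rows is such a multiple too, hence also the row of strategy \<open>1\<close>, and all minors
  vanish.\<close>

lemma eq_imp_spohn_variety:
  assumes q: "q \<in> coord_space I" "mass q \<noteq> 0" and e: "\<And>\<kappa>. \<kappa> \<in> K \<Longrightarrow> spohn_eq n d X \<kappa> q = 0"
  shows "proj_pt q \<in> spohn_variety n d X"
proof -
  have "\<exists>j. q j \<noteq> 0" using q(2) by (metis sum.neutral)
  then have P: "proj_pt q \<in> proj_space I" using proj_pt_in_proj_space[OF q(1)] by blast
  have proportional: "payoff_sum n d X k i q = ((\<Sum>j\<in>I. of_real (X (k, j)) * q j) / mass q) * marginal n d k i q"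
    if k: "k \<in> {1..n}" and i: "i \<in> {1..d k}" for k i
  proof -
    define c where "c = (\<Sum>j\<in>I. of_real (X (k, j)) * q j) / mass q"
    have c: "(\<Sum>j\<in>I. of_real (X (k, j)) * q j) = c * mass q" using q(2) by (simp add: c_def)
    have 2: "payoff_sum n d X k i q = c * marginal n d k i q" if "i \<in> {2..d k}" for i
    proof -
      have "(k, i) \<in> K" using k that by (simp add: spohn_index_def)
      then have "payoff_sum n d X k i q * mass q - marginal n d k i q * (c * mass q) = 0"
        using e[of "(k, i)"] unfolding spohn_eq_alt c by simp
      then have "(payoff_sum n d X k i q - c * marginal n d k i q) * mass q = 0" by (simp add: algebra_simps)
      then show ?thesis using q(2) by simp
    qed
    have split: "{1..d k} = insert 1 {2..d k}" using strategies[OF k] by auto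
    have "payoff_sum n d X k 1 q + (\<Sum>i\<in>{2..d k}. payoff_sum n d X k i q) = c * mass q"
      using sum_payoff[OF k, of X q] unfolding split c by simp
    moreover have "c * mass q = c * marginal n d k 1 q + (\<Sum>i\<in>{2..d k}. c * marginal n d k i q)"
      unfolding sum_marginal[OF k, symmetric] split by (simp add: distrib_left sum_distrib_left)
    moreover have "(\<Sum>i\<in>{2..d k}. payoff_sum n d X k i q) = (\<Sum>i\<in>{2..d k}. c * marginal n d k i q)"
      by (rule sum.cong[OF refl 2])
    ultimately have 1: "payoff_sum n d X k 1 q = c * marginal n d k 1 q" by simp
    show ?thesis using 1 2 i unfolding split c_def by auto
  qed
  have "marginal n d k i p * payoff_sum n d X k i' p - marginal n d k i' p * payoff_sum n d X k i p = 0"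
    if p: "p \<in> proj_pt q" and k: "k \<in> {1..n}" "i \<in> {1..d k}" "i' \<in> {1..d k}" for p k i i'
  proof -
    have h: "hfun I (1 + 1) (\<lambda>p. marginal n d k i p * payoff_sum n d X k i' p - marginal n d k i' p * payoff_sum n d X k i p)"
      by (intro hfun_diff hfun.mult hfun_marginal hfun_payoff)
    have z: "marginal n d k i q * payoff_sum n d X k i' q - marginal n d k i' q * payoff_sum n d X k i q = 0"
      unfolding proportional[OF k(1,2)] proportional[OF k(1,3)] by simp
    show ?thesis by (rule hfun_zero_on_class[OF h, OF P proj_pt_self z p])
  qed
  then show ?thesis using P by (simp add: spohn_variety_def)
qed

lemma vanishing_on_CI:
  assumes h: "hfun I D f"
    and z: "\<And>x p. x \<in> spohn_variety n d X \<Longrightarrow> x \<in> graphical_model n d E \<Longrightarrow> p \<in> x \<Longrightarrow> f p = 0"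
  shows "f \<in> vanishing_on I (spohn_CI_variety n d E X)"
proof -
  have "spohn_CI_variety n d E X \<subseteq> {x \<in> proj_space I. \<forall>p\<in>x. f p = 0}"
    unfolding spohn_CI_variety_def
    by (rule closure_of_minimal[OF _ closedin_hfun[OF h]]) (use z in \<open>auto simp: spohn_variety_def\<close>)
  then show ?thesis using hfun_imp_pfun[OF h] unfolding vanishing_on_def by blast
qed

lemma equations_vanish_on_CI:
  "j \<in> I - \<Theta> \<Longrightarrow> markov n E j \<in> vanishing_on I (spohn_CI_variety n d E X)"
  "\<kappa> \<in> K \<Longrightarrow> spohn_eq n d X \<kappa> \<in> vanishing_on I (spohn_CI_variety n d E X)"
proof -
  show "j \<in> I - \<Theta> \<Longrightarrow> markov n E j \<in> vanishing_on I (spohn_CI_variety n d E X)"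
    by (rule vanishing_on_CI[OF hfun_markov]) (assumption, rule graphical_model_markov)
  show "\<kappa> \<in> K \<Longrightarrow> spohn_eq n d X \<kappa> \<in> vanishing_on I (spohn_CI_variety n d E X)"
    by (rule vanishing_on_CI[OF hfun_spohn_eq]) (rule spohn_variety_imp_eq)
qed

section \<open>Points off the special hyperplanes, their dimension and smoothness\<close>

lemma off_special_hyperplanes:
  assumes "x \<in> proj_space I" "x \<notin> special_hyperplanes n d" "p \<in> x"
  shows "\<forall>j\<in>I. p j \<noteq> 0" "mass p \<noteq> 0"
proof -
  have "x \<in> special_hyperplanes n d" if j: "j \<in> I" "p j = 0" for j
  proof -
    have "\<forall>q\<in>x. q j = 0"
      by (intro ballI hfun_zero_on_class[OF hfun.coord[OF j(1)], OF assms(1,3) j(2)])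
    then have "x \<in> {x \<in> proj_space I. \<forall>q\<in>x. q j = 0}" using assms(1) by simp
    then show ?thesis unfolding special_hyperplanes_def by (intro UnI1 UN_I[OF j(1)])
  qed
  then show "\<forall>j\<in>I. p j \<noteq> 0" using assms(2) by blast
  have "x \<in> special_hyperplanes n d" if m: "mass p = 0"
  proof -
    have "\<forall>q\<in>x. mass q = 0"
      by (intro ballI hfun_zero_on_class[OF hfun_total, OF assms(1,3) m])
    then have "x \<in> {x \<in> proj_space I. \<forall>q\<in>x. mass q = 0}" using assms(1) by simp
    then show ?thesis unfolding special_hyperplanes_def by (rule UnI2)
  qed
  then show "mass p \<noteq> 0" using assms(2) by blast
qed

lemma CI_imp_candidate:
  assumes "x \<in> spohn_CI_variety n d E X" "x \<notin> special_hyperplanes n d" "p \<in> x"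
  shows "p \<in> coord_space I" "x = proj_pt p" "candidate X p"
proof -
  have x: "x \<in> proj_space I"
    using assms(1) closure_of_subset_topspace[of "zariski_proj I"] unfolding spohn_CI_variety_def by auto
  show "p \<in> coord_space I" "x = proj_pt p" by (rule proj_space_rep[OF x assms(3)])+
  have "markov n E j p = 0" if "j \<in> I - \<Theta>" for j
    using equations_vanish_on_CI(1)[OF that, of X] assms(1,3) unfolding vanishing_on_def by blast
  moreover have "spohn_eq n d X \<kappa> p = 0" if "\<kappa> \<in> K" for \<kappa>
    using equations_vanish_on_CI(2)[OF that, of X] assms(1,3) unfolding vanishing_on_def by blast
  ultimately show "candidate X p"
    using off_special_hyperplanes[OF x assms(2,3)] unfolding candidate_def by blast
qed

lemma torus_not_special:
  assumes "\<forall>j\<in>I. p j \<noteq> 0" "mass p \<noteq> 0"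
  shows "proj_pt p \<notin> special_hyperplanes n d"
  using assms proj_pt_self[of p] unfolding special_hyperplanes_def by blast

lemma candidate_imp_CI:
  assumes q: "q \<in> coord_space I" "candidate X q"
  shows "proj_pt q \<in> spohn_CI_variety n d E X" "proj_pt q \<notin> special_hyperplanes n d"
proof -
  note c = q(2)[unfolded candidate_def]
  have s: "proj_pt q \<in> spohn_variety n d X" by (rule eq_imp_spohn_variety) (use q(1) c in auto)
  have g: "proj_pt q \<in> graphical_model n d E"
    by (rule graphical_model_torus) (use q(1) c profiles_nonempty in auto)
  show n: "proj_pt q \<notin> special_hyperplanes n d" by (rule torus_not_special) (use c in blast)+
  have "spohn_variety n d X \<inter> graphical_model n d E - special_hyperplanes n d \<subseteq> topspace (zariski_proj I)"
    by (auto simp: spohn_variety_def)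
  from closure_of_subset[OF this] show "proj_pt q \<in> spohn_CI_variety n d E X"
    unfolding spohn_CI_variety_def using s g n by blast
qed

lemma torus_near:
  assumes "\<forall>j\<in>I. (p j :: complex) \<noteq> 0"
  shows "\<exists>\<eta>>0. \<forall>q. (\<forall>i\<in>I. norm (q i - p i) < \<eta>) \<longrightarrow> (\<forall>i\<in>I. q i \<noteq> 0)"
proof -
  let ?\<eta> = "Min ((\<lambda>j. norm (p j)) ` I)"
  have "?\<eta> > 0" using assms profiles_nonempty by simp
  moreover have "q i \<noteq> 0" if "\<forall>i\<in>I. norm (q i - p i) < ?\<eta>" "i \<in> I" for q i
  proof
    assume "q i = 0"
    then have "norm (p i) < ?\<eta>" using that by force
    moreover have "?\<eta> \<le> norm (p i)" using that(2) by simp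
    ultimately show False by simp
  qed
  ultimately show ?thesis by (intro exI[of _ ?\<eta>]) simp
qed

lemma regular_independent:
  assumes p: "candidate X p" "regular X p"
  defines "L \<equiv> Inl ` (I - \<Theta>) \<union> Inr ` K" and "G \<equiv> case_sum (markov n E) (spohn_eq n d X)"
  shows "independent_gradients I (insert None (Some ` L)) (case_option (\<lambda>q. mass q - mass p) G) p"
    "independent_gradients I L G p" "card L = card (I - \<Theta>) + card K" "finite L"
proof -
  note c = p(1)[unfolded candidate_def]
  have 1: "p i \<noteq> 0" if "i \<in> I" for i using c that by blast
  have 2: "mass p \<noteq> 0" using c by blast
  have 3: "markov n E j p = 0" if "j \<in> I - \<Theta>" for j using c that by blast
  have 4: "hfun I 2 (spohn_eq n d X \<kappa>)" "spohn_eq n d X \<kappa> p = 0" if "\<kappa> \<in> K" for \<kappa>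
    using c that hfun_spohn_eq by blast+
  have 5: "\<exists>w. (\<forall>j\<in>I - \<Theta>. dderiv I (markov n E j) p w = 0) \<and>
      (\<forall>\<kappa>'\<in>K. dderiv I (spohn_eq n d X \<kappa>') p w = (if \<kappa>' = \<kappa> then 1 else 0))" if "\<kappa> \<in> K" for \<kappa>
    by (rule p(2)[unfolded regular_def, rule_format, OF that])
  note ie = independent_equations[where lf = "\<lambda>p. mass p" and s = "spohn_eq n d X" and K = K and p = p,
      OF 1 hfun_total 2 finite_indices(1) 3 4 5]
  show "independent_gradients I (insert None (Some ` L)) (case_option (\<lambda>q. mass q - mass p) G) p"
    "independent_gradients I L G p" "card L = card (I - \<Theta>) + card K" "finite L"
    unfolding L_def G_def by (rule ie; assumption)+
qed

lemma CI_local_dimension: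
  assumes p: "p \<in> coord_space I" "candidate X p" "regular X p"
  shows "Suc (card (I - \<Theta>) + card K) \<le> card I"
    "local_krull_dim (zariski_proj I) (spohn_CI_variety n d E X) (proj_pt p) = enat (card I - Suc (card (I - \<Theta>) + card K))"
    "vector_space.dim fun_scale (cone_tangent_space I (spohn_CI_variety n d E X) p) = card I - (card (I - \<Theta>) + card K)"
proof -
  let ?V = "spohn_CI_variety n d E X"
  let ?L = "Inl ` (I - \<Theta>) \<union> Inr ` K" and ?G = "case_sum (markov n E) (spohn_eq n d X)"
  note ind = regular_independent[OF p(2,3)]
  note c = p(2)[unfolded candidate_def]
  obtain \<eta> where \<eta>: "\<eta> > 0" "\<forall>q. (\<forall>i\<in>I. norm (q i - p i) < \<eta>) \<longrightarrow> (\<forall>i\<in>I. q i \<noteq> 0)"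
    using torus_near[OF conjunct1[OF c]] by (elim exE conjE)
  have V: "closedin (zariski_proj I) ?V" unfolding spohn_CI_variety_def by (rule closedin_closure_of)
  have G: "?G l \<in> vanishing_on I ?V" if "l \<in> ?L" for l
    using that equations_vanish_on_CI by (elim UnE imageE) simp_all
  have loc: "proj_pt q \<in> ?V" if q: "q \<in> coord_space I" "\<forall>i\<in>I. norm (q i - p i) < \<eta>" "mass q = mass p"
    "\<forall>l\<in>?L. ?G l q = 0" for q
  proof (rule candidate_imp_CI(1)[OF q(1)])
    have "markov n E j q = 0" if "j \<in> I - \<Theta>" for j using q(4)[rule_format, of "Inl j"] that by simp
    moreover have "spohn_eq n d X \<kappa> q = 0" if "\<kappa> \<in> K" for \<kappa> using q(4)[rule_format, of "Inr \<kappa>"] that by simp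
    ultimately show "candidate X q" using \<eta>(2) q(2,3) c unfolding candidate_def by simp
  qed
  have mp: "mass p \<noteq> 0" using c by simp
  note ld = local_dimension[OF finite_profiles V candidate_imp_CI(1)[OF p(1,2)] p(1) hfun_total mp ind(4) _ ind(1,2) \<eta>(1)]
  show "Suc (card (I - \<Theta>) + card K) \<le> card I" unfolding ind(3)[symmetric] by (rule ld(1)) (erule G | (rule loc; assumption))+
  show "local_krull_dim (zariski_proj I) ?V (proj_pt p) = enat (card I - Suc (card (I - \<Theta>) + card K))"
    unfolding ind(3)[symmetric] by (rule ld(2)) (erule G | (rule loc; assumption))+
  show "vector_space.dim fun_scale (cone_tangent_space I ?V p) = card I - (card (I - \<Theta>) + card K)"
    unfolding ind(3)[symmetric] by (rule ld(3)) (erule G | (rule loc; assumption))+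
qed

lemma CI_smooth_at:
  assumes reg: "\<And>p. candidate X p \<Longrightarrow> regular X p"
    and x: "x \<in> spohn_CI_variety n d E X - special_hyperplanes n d"
  shows "smooth_at I (spohn_CI_variety n d E X) x"
  unfolding smooth_at_def
proof (intro conjI ballI)
  show "x \<in> spohn_CI_variety n d E X" using x by blast
  fix p assume p: "p \<in> x"
  have xD: "x \<in> spohn_CI_variety n d E X" "x \<notin> special_hyperplanes n d" using x by blast+
  note c = CI_imp_candidate[OF xD p]
  note l = CI_local_dimension[OF c(1,3) reg[OF c(3)]]
  show "enat (vector_space.dim fun_scale (cone_tangent_space I (spohn_CI_variety n d E X) p)) =
      local_krull_dim (zariski_proj I) (spohn_CI_variety n d E X) x + 1"
    unfolding c(2) l(2,3) using l(1) by (simp add: one_enat_def)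
qed

section \<open>The dimension of the graphical model\<close>

lemma card_profiles: "card I = card \<Theta> + card (I - \<Theta>)"
proof -
  have "\<Theta> \<subseteq> I" by (auto simp: clique_profiles_def)
  then show ?thesis
    using card_Diff_subset[of \<Theta> I] card_mono[OF finite_profiles, of \<Theta>] finite_subset[OF _ finite_profiles, of \<Theta>] by linarith
qed

text \<open>The point with all coordinates equal satisfies every binomial and lies in the torus, so
  \<open>local_dimension\<close> applies there with the Markov binomials alone; irreducibility
  extends the bound to chains elsewhere.\<close>

lemma krull_dim_graphical_model:
  "krull_dim (zariski_proj I) (graphical_model n d E) = enat (card \<Theta> - 1)" "card \<Theta> \<ge> 1"
proof -
  let ?GM = "graphical_model n d E"
  define p :: "(nat \<Rightarrow> nat) \<Rightarrow> complex" where "p = (\<lambda>j. if j \<in> I then 1 else 0)"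
  have p: "p \<in> coord_space I" "\<forall>j\<in>I. p j \<noteq> 0" by (auto simp: p_def coord_space_def)
  have mp: "mass p \<noteq> 0" using profiles_nonempty by (simp add: p_def)
  have mk: "markov n E j p = 0" if j: "j \<in> I - \<Theta>" for j
  proof -
    obtain a b where ab: "nonedge n E j = (a, b)" by fastforce
    show ?thesis using markov_resets(1-3)[OF j ab] j by (simp add: markov_def ab p_def)
  qed
  have x: "proj_pt p \<in> ?GM" by (rule graphical_model_torus[OF p(1) _ _ profiles_nonempty]) (use p mk in auto)
  \<comment> \<open>There are no Spohn equations here; an empty family over a dummy index type makes
    \<open>independent_equations\<close> applicable.\<close>
  let ?s = "\<lambda>_::unit. \<lambda>_. 0"
  let ?L = "Inl ` (I - \<Theta>) \<union> Inr ` ({} :: unit set)" and ?G = "case_sum (markov n E) ?s"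
  have ind: "independent_gradients I (insert None (Some ` ?L)) (case_option (\<lambda>q. mass q - mass p) ?G) p"
    "independent_gradients I ?L ?G p" "card ?L = card (I - \<Theta>) + card ({} :: unit set)" "finite ?L"
  proof -
    have 1: "p i \<noteq> 0" if "i \<in> I" for i using p(2) that by blast
    note ie = independent_equations[where lf = "\<lambda>p. mass p" and s = ?s and K = "{}" and p = p,
        OF 1 hfun_total mp finite.emptyI mk]
    show "independent_gradients I (insert None (Some ` ?L)) (case_option (\<lambda>q. mass q - mass p) ?G) p"
      "independent_gradients I ?L ?G p" "card ?L = card (I - \<Theta>) + card ({} :: unit set)" "finite ?L"
      by (rule ie; (assumption | simp))+
  qed
  obtain \<eta> where \<eta>: "\<eta> > 0" "\<forall>q. (\<forall>i\<in>I. norm (q i - p i) < \<eta>) \<longrightarrow> (\<forall>i\<in>I. q i \<noteq> 0)"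
    using torus_near[OF p(2)] by (elim exE conjE)
  have G: "?G l \<in> vanishing_on I ?GM" if l: "l \<in> ?L" for l
  proof -
    obtain j where j: "j \<in> I - \<Theta>" "l = Inl j" using l by auto
    show ?thesis unfolding j(2) sum.case vanishing_on_def
      by (intro CollectI conjI ballI hfun_imp_pfun[OF hfun_markov[OF j(1)]] graphical_model_markov[OF _ _ j(1)])
  qed
  have loc: "proj_pt q \<in> ?GM" if q: "q \<in> coord_space I" "\<forall>i\<in>I. norm (q i - p i) < \<eta>"
    "mass q = mass p" "\<forall>l\<in>?L. ?G l q = 0" for q
  proof (rule graphical_model_torus[OF q(1) _ _ profiles_nonempty])
    show "q j \<noteq> 0" if "j \<in> I" for j using \<eta>(2) q(2) that by simp
    show "markov n E j q = 0" if "j \<in> I - \<Theta>" for j using q(4)[rule_format, of "Inl j"] that by simp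
  qed
  note ld = local_dimension[OF finite_profiles closedin_graphical_model x p(1) hfun_total mp ind(4) _ ind(1,2) \<eta>(1)]
  have cL: "card ?L = card (I - \<Theta>)" using ind(3) by simp
  have "Suc (card ?L) \<le> card I" by (rule ld(1)) (erule G | (rule loc; assumption))+
  then show c1: "card \<Theta> \<ge> 1" unfolding cL card_profiles by simp
  have dim: "vector_space.dim fun_scale (cone_tangent_space I ?GM p) = card \<Theta>"
  proof -
    have "vector_space.dim fun_scale (cone_tangent_space I ?GM p) = card I - card ?L"
      by (rule ld(3)) (erule G | (rule loc; assumption))+
    then show ?thesis unfolding cL card_profiles by simp
  qed
  have "\<exists>Z. irreducible_chain (zariski_proj I) ?GM (card I - Suc (card ?L)) Z \<and> proj_pt p \<in> Z 0"
    by (rule ld(4)) (erule G | (rule loc; assumption))+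
  moreover have "card I - Suc (card ?L) = card \<Theta> - 1" unfolding cL card_profiles by arith
  ultimately have "\<exists>Z. irreducible_chain (zariski_proj I) ?GM (card \<Theta> - 1) Z \<and> proj_pt p \<in> Z 0" by (simp only:)
  then have low: "\<exists>Z. irreducible_chain (zariski_proj I) ?GM (card \<Theta> - 1) Z"
    by (elim exE conjE) (rule exI)
  \<comment> \<open>The tangent bound at \<open>p\<close> needs \<open>p\<close> only in the top
    member. The model is irreducible and contains \<open>p\<close>, so any chain not ending in it
    can be topped by it.\<close>
  have up: "m \<le> card \<Theta> - 1" if ch: "irreducible_chain (zariski_proj I) ?GM m Z" for m :: nat and Z
  proof (cases "Z m = ?GM")
    case True
    have "Suc m \<le> card \<Theta>"
      unfolding dim[symmetric]
      by (rule chain_le_dim_tangent[OF finite_profiles _ ch _ proj_pt_self])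
        (use True x closedin_subset[OF closedin_graphical_model] in auto)
    then show ?thesis by simp
  next
    case False
    have ch': "irreducible_chain (zariski_proj I) ?GM (Suc m) (Z(Suc m := ?GM))"
      using ch False closedin_graphical_model irreducible_graphical_model[OF profiles_nonempty]
      unfolding irreducible_chain_def by (auto simp: le_Suc_eq less_Suc_eq)
    have "Suc (Suc m) \<le> card \<Theta>"
      unfolding dim[symmetric]
      by (rule chain_le_dim_tangent[OF finite_profiles _ ch' _ proj_pt_self])
        (use x closedin_subset[OF closedin_graphical_model] in auto)
    then show ?thesis by simp
  qed
  show "krull_dim (zariski_proj I) ?GM = enat (card \<Theta> - 1)"
    unfolding krull_dim_def
  proof (rule antisym)
    show "Sup {enat m |m. \<exists>Z. irreducible_chain (zariski_proj I) ?GM m Z} \<le> enat (card \<Theta> - 1)"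
      by (rule Sup_least) (use up in auto)
    show "enat (card \<Theta> - 1) \<le> Sup {enat m |m. \<exists>Z. irreducible_chain (zariski_proj I) ?GM m Z}"
      by (rule Sup_upper) (use low in blast)
  qed
qed

lemma card_spohn_index: "card K = (\<Sum>i=1..n. d i) - n"
proof -
  have "card K = (\<Sum>k\<in>{1..n}. card {2..d k})" unfolding spohn_index_def by (rule card_SigmaI) auto
  also have "\<dots> = (\<Sum>k\<in>{1..n}. d k - 1)" by (rule sum.cong) auto
  also have "\<dots> = (\<Sum>i=1..n. d i) - (\<Sum>i=1..n. 1)" by (rule sum_subtractf_nat) (use strategies in auto)
  finally show ?thesis by simp
qed

section \<open>The manifold of equilibria\<close>

lemma equilibrium_iff:
  "p \<in> totally_mixed_CI_equilibria n d E X \<longleftrightarrow> p \<in> open_simplex n d \<and> candidate X (\<lambda>j. of_real (p j))"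
proof -
  let ?P = "\<lambda>j. complex_of_real (p j)"
  have "proj_pt ?P \<in> spohn_CI_variety n d E X \<longleftrightarrow> candidate X ?P" if p: "p \<in> open_simplex n d"
  proof
    have P: "?P \<in> coord_space I" using p by (auto simp: open_simplex_def coord_space_def)
    show "candidate X ?P \<Longrightarrow> proj_pt ?P \<in> spohn_CI_variety n d E X" by (rule candidate_imp_CI(1)[OF P])
    have nz: "\<forall>j\<in>I. ?P j \<noteq> 0" using p by (auto simp: open_simplex_def)
    have "mass ?P = complex_of_real (\<Sum>j\<in>I. p j)" by simp
    then have "mass ?P \<noteq> 0" using p by (simp add: open_simplex_def del: of_real_sum)
    with nz have n: "proj_pt ?P \<notin> special_hyperplanes n d" by (rule torus_not_special)
    show "candidate X ?P" if "proj_pt ?P \<in> spohn_CI_variety n d E X"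
      by (rule CI_imp_candidate(3)[OF that n proj_pt_self])
  qed
  then show ?thesis unfolding totally_mixed_CI_equilibria_def by blast
qed

text \<open>All coefficients are real, so the solution set is stable under conjugation; this makes
  the charts real at real points.\<close>

lemma cnj_equations:
  "markov n E j (\<lambda>i. cnj (p i)) = cnj (markov n E j p)"
  "spohn_eq n d X \<kappa> (\<lambda>i. cnj (p i)) = cnj (spohn_eq n d X \<kappa> p)"
proof -
  show "markov n E j (\<lambda>i. cnj (p i)) = cnj (markov n E j p)" by (simp add: markov_def split: prod.split)
  obtain k i where \<kappa>: "\<kappa> = (k, i)" by fastforce
  show "spohn_eq n d X \<kappa> (\<lambda>i. cnj (p i)) = cnj (spohn_eq n d X \<kappa> p)"
    unfolding \<kappa> spohn_eq_alt by (simp add: payoff_sum_def marginal_def)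
qed

text \<open>The complex chart of all equations together with total mass \<open>1\<close>, restricted
  to real parameters. Its smooth inverse is the projection to the free coordinates, shifted by
  \<open>p\<close>.\<close>

lemma equilibria_chart:
  fixes p :: "(nat \<Rightarrow> nat) \<Rightarrow> real"
  assumes p: "p \<in> totally_mixed_CI_equilibria n d E X"
    and reg: "\<And>p. candidate X p \<Longrightarrow> regular X p"
    and k: "k = card I - Suc (card (I - \<Theta>) + card K)"
  shows "\<exists>U T (\<phi> :: ((nat \<Rightarrow> nat) \<Rightarrow> real) \<Rightarrow> nat \<Rightarrow> real) \<psi>.
        openin (top_of_set (coord_space I)) U \<and> p \<in> U \<and>
        openin (top_of_set (coord_space {..<k})) T \<and>
        (\<forall>a<k. C_infinity_on I U (\<lambda>x. \<phi> x a)) \<and>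
        (\<forall>i\<in>I. C_infinity_on {..<k} T (\<lambda>t. \<psi> t i)) \<and>
        \<psi> ` T = totally_mixed_CI_equilibria n d E X \<inter> U \<and> (\<forall>t\<in>T. \<phi> (\<psi> t) = t)"
proof -
  let ?S = "totally_mixed_CI_equilibria n d E X"
  define P where "P = (\<lambda>j. complex_of_real (p j))"
  have ps: "p \<in> open_simplex n d" and cP: "candidate X P" using p unfolding equilibrium_iff P_def by blast+
  have pI: "p \<in> coord_space I" "\<And>j. j \<in> I \<Longrightarrow> p j > 0" "(\<Sum>j\<in>I. p j) = 1"
    using ps by (auto simp: open_simplex_def)
  have P0: "P i = 0" if "i \<notin> I" for i using pI(1) that by (simp add: P_def coord_space_def)
  have mP: "mass P = 1" unfolding P_def of_real_sum[symmetric] pI(3) by simp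
  let ?L = "Inl ` (I - \<Theta>) \<union> Inr ` K" and ?G = "case_sum (markov n E) (spohn_eq n d X)"
  let ?L' = "insert None (Some ` ?L)" and ?G' = "case_option (\<lambda>q. mass q - mass P) ?G"
  note ind = regular_independent[OF cP reg[OF cP]]
  have cL: "card ?L' = Suc (card (I - \<Theta>) + card K)"
    using ind(3,4) by (simp add: card_insert_if card_image)
  have G_iff: "(\<forall>l\<in>?L'. ?G' l q = 0) \<longleftrightarrow> mass q = 1 \<and> (\<forall>j\<in>I - \<Theta>. markov n E j q = 0) \<and> (\<forall>\<kappa>\<in>K. spohn_eq n d X \<kappa> q = 0)" for q
    unfolding mP by (simp add: ball_Un image_image)
  have GP: "\<forall>l\<in>?L'. ?G' l P = 0" unfolding G_iff using cP mP unfolding candidate_def by blast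
  have pG: "pfun I (?G' l)" if "l \<in> ?L'" for l
    using that hfun_imp_pfun[OF hfun_markov] hfun_imp_pfun[OF hfun_spohn_eq]
      pfun_diff[OF hfun_imp_pfun[OF hfun_total] pfun.const]
    by (elim insertE imageE UnE) simp_all
  \<comment> \<open>Closer than this to \<open>p\<close> all coordinates stay positive, so the chart
    remains in the open simplex.\<close>
  define \<eta> where "\<eta> = Min (p ` I)"
  have \<eta>: "\<eta> > 0" unfolding \<eta>_def using pI(2) profiles_nonempty by simp
  have \<eta>p: "\<eta> \<le> p i" if "i \<in> I" for i unfolding \<eta>_def using that by simp
  have finL: "finite ?L'" using ind(4) by simp
  have "card ?L' \<le> card I \<and> (\<exists>S \<sigma> \<epsilon> \<rho> \<Psi>. S \<subseteq> I \<and> bij_betw \<sigma> {..<card I - card ?L'} S \<and>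
    0 < \<epsilon> \<and> \<epsilon> \<le> \<eta> \<and> 0 < \<rho> \<and> \<rho> \<le> \<eta> \<and> (\<forall>i. holomorphic_polydisc (card I - card ?L') \<epsilon> (\<lambda>\<tau>. \<Psi> \<tau> i)) \<and>
    (\<forall>\<tau>\<in>polydisc (card I - card ?L') \<epsilon>. (\<forall>i<card I - card ?L'. \<Psi> \<tau> (\<sigma> i) = P (\<sigma> i) + \<tau> i) \<and>
      (\<forall>a\<in>I - S. norm (\<Psi> \<tau> a - P a) < \<rho>) \<and> (\<forall>l\<in>?L'. ?G' l (\<Psi> \<tau>) = 0) \<and> (\<forall>i. i \<notin> I \<longrightarrow> \<Psi> \<tau> i = P i)) \<and>
    (\<forall>\<tau>\<in>polydisc (card I - card ?L') \<epsilon>. \<forall>q. (\<forall>i<card I - card ?L'. q (\<sigma> i) = P (\<sigma> i) + \<tau> i) \<longrightarrow>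
      (\<forall>a\<in>I - S. norm (q a - P a) < \<rho>) \<longrightarrow> (\<forall>l\<in>?L'. ?G' l q = 0) \<longrightarrow> (\<forall>i\<in>I. q i = \<Psi> \<tau> i)))"
  proof (rule implicit_function[OF finite_profiles finL _ _ ind(1) \<eta>])
    show "pfun I (?G' l)" if "l \<in> ?L'" for l by (rule pG[OF that])
    show "?G' l P = 0" if "l \<in> ?L'" for l by (rule GP[rule_format, OF that])
  qed
  from conjunct2[OF this, unfolded cL k[symmetric]]
  obtain S \<sigma> \<epsilon> \<rho> \<Psi> where S: "S \<subseteq> I" "bij_betw \<sigma> {..<k} S" and \<epsilon>: "0 < \<epsilon>" "\<epsilon> \<le> \<eta>" and \<rho>: "0 < \<rho>" "\<rho> \<le> \<eta>"
    and hol: "\<forall>i. holomorphic_polydisc k \<epsilon> (\<lambda>\<tau>. \<Psi> \<tau> i)"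
    and \<Psi>: "\<forall>\<tau>\<in>polydisc k \<epsilon>. (\<forall>i<k. \<Psi> \<tau> (\<sigma> i) = P (\<sigma> i) + \<tau> i) \<and>
      (\<forall>a\<in>I - S. norm (\<Psi> \<tau> a - P a) < \<rho>) \<and> (\<forall>l\<in>?L'. ?G' l (\<Psi> \<tau>) = 0) \<and> (\<forall>i. i \<notin> I \<longrightarrow> \<Psi> \<tau> i = P i)"
    and uniq: "\<forall>\<tau>\<in>polydisc k \<epsilon>. \<forall>q. (\<forall>i<k. q (\<sigma> i) = P (\<sigma> i) + \<tau> i) \<longrightarrow>
      (\<forall>a\<in>I - S. norm (q a - P a) < \<rho>) \<longrightarrow> (\<forall>l\<in>?L'. ?G' l q = 0) \<longrightarrow> (\<forall>i\<in>I. q i = \<Psi> \<tau> i)"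
    by (elim exE conjE)
  have \<sigma>: "\<sigma> a \<in> S" if "a < k" for a using S(2) that by (auto simp: bij_betw_def)
  have \<sigma>': "\<exists>a<k. i = \<sigma> a" if "i \<in> S" for i using S(2) that by (auto simp: bij_betw_def)
  define \<psi> where "\<psi> t i = Re (\<Psi> (\<lambda>a. of_real (t a)) i)" for t i
  define B where "B = {t :: nat \<Rightarrow> real. \<forall>i<k. \<bar>t i\<bar> < \<epsilon>}"
  \<comment> \<open>The conjugate of a chart point solves the same equations with the same real
    parameters at the same distance from \<open>p\<close>; by uniqueness it is the chart point
    itself.\<close>
  have real: "\<Psi> (\<lambda>a. of_real (t a)) i = of_real (\<psi> t i)" if t: "t \<in> B" for t i
  proof -
    let ?\<tau> = "\<lambda>a. complex_of_real (t a)"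
    have \<tau>: "?\<tau> \<in> polydisc k \<epsilon>" using t by (simp add: polydisc_def B_def)
    note \<Psi>\<tau> = bspec[OF \<Psi> \<tau>]
    have e: "mass (\<Psi> ?\<tau>) = 1" "\<forall>j\<in>I - \<Theta>. markov n E j (\<Psi> ?\<tau>) = 0" "\<forall>\<kappa>\<in>K. spohn_eq n d X \<kappa> (\<Psi> ?\<tau>) = 0"
      using \<Psi>\<tau> unfolding G_iff by simp_all
    show ?thesis
    proof (cases "i \<in> I")
      case True
      have 1: "\<forall>i<k. cnj (\<Psi> ?\<tau> (\<sigma> i)) = P (\<sigma> i) + ?\<tau> i" using \<Psi>\<tau> by (simp add: P_def)
      have 2: "\<forall>a\<in>I - S. norm (cnj (\<Psi> ?\<tau> a) - P a) < \<rho>"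
      proof
        fix a assume "a \<in> I - S"
        then have "norm (\<Psi> ?\<tau> a - P a) < \<rho>" using \<Psi>\<tau> by blast
        moreover have "cnj (\<Psi> ?\<tau> a) - P a = cnj (\<Psi> ?\<tau> a - P a)" by (simp add: P_def)
        ultimately show "norm (cnj (\<Psi> ?\<tau> a) - P a) < \<rho>" by (simp only: complex_mod_cnj)
      qed
      have "mass (\<lambda>i. cnj (\<Psi> ?\<tau> i)) = 1" unfolding cnj_sum[symmetric] e(1) by simp
      then have 3: "\<forall>l\<in>?L'. ?G' l (\<lambda>i. cnj (\<Psi> ?\<tau> i)) = 0"
        unfolding G_iff cnj_equations using e by simp
      have "cnj (\<Psi> ?\<tau> i) = \<Psi> ?\<tau> i"
        using bspec[OF uniq \<tau>, rule_format, of "\<lambda>i. cnj (\<Psi> ?\<tau> i)"] 1 2 3 True by blast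
      then show ?thesis unfolding \<psi>_def by (simp add: complex_eq_iff)
    next
      case False
      then have "\<Psi> ?\<tau> i = P i" using \<Psi>\<tau> by blast
      then show ?thesis using P0[OF False] by (simp add: \<psi>_def)
    qed
  qed
  define T where "T = coord_space {..<k} \<inter> B"
  \<comment> \<open>The box matches the uniqueness clause of the chart, so every equilibrium inside
    it is a chart point.\<close>
  define U where "U = {x \<in> coord_space I. (\<forall>i<k. \<bar>x (\<sigma> i) - p (\<sigma> i)\<bar> < \<epsilon>) \<and> (\<forall>a\<in>I - S. \<bar>x a - p a\<bar> < \<rho>)}"
  define \<phi> where "\<phi> x a = (if a < k then x (\<sigma> a) - p (\<sigma> a) else 0)" for x :: "(nat \<Rightarrow> nat) \<Rightarrow> real" and a
  have \<psi>: "(\<forall>i<k. \<psi> t (\<sigma> i) = p (\<sigma> i) + t i) \<and> (\<forall>a\<in>I - S. \<bar>\<psi> t a - p a\<bar> < \<rho>) \<and> (\<forall>i. i \<notin> I \<longrightarrow> \<psi> t i = 0) \<and>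
      \<psi> t \<in> ?S" if t: "t \<in> B" for t
  proof -
    let ?\<tau> = "\<lambda>a. complex_of_real (t a)"
    have \<tau>: "?\<tau> \<in> polydisc k \<epsilon>" using t by (simp add: polydisc_def B_def)
    have eq: "\<Psi> ?\<tau> = (\<lambda>i. of_real (\<psi> t i))" using real[OF t] by (rule ext)
    note \<Psi>\<tau> = bspec[OF \<Psi> \<tau>, unfolded eq]
    have 1: "\<forall>i<k. \<psi> t (\<sigma> i) = p (\<sigma> i) + t i"
    proof (intro allI impI)
      fix i assume "i < k"
      then have "complex_of_real (\<psi> t (\<sigma> i)) = of_real (p (\<sigma> i) + t i)" using \<Psi>\<tau> by (simp add: P_def)
      then show "\<psi> t (\<sigma> i) = p (\<sigma> i) + t i" by (simp only: of_real_eq_iff)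
    qed
    have 2: "\<forall>a\<in>I - S. \<bar>\<psi> t a - p a\<bar> < \<rho>"
    proof
      fix a assume "a \<in> I - S"
      then have "norm (complex_of_real (\<psi> t a - p a)) < \<rho>" using \<Psi>\<tau> by (simp add: P_def)
      then show "\<bar>\<psi> t a - p a\<bar> < \<rho>" by (simp only: norm_of_real)
    qed
    have 3: "\<forall>i. i \<notin> I \<longrightarrow> \<psi> t i = 0" using \<Psi>\<tau> P0 by simp
    have e: "mass (\<lambda>i. complex_of_real (\<psi> t i)) = 1" "\<forall>j\<in>I - \<Theta>. markov n E j (\<lambda>i. of_real (\<psi> t i)) = 0"
      "\<forall>\<kappa>\<in>K. spohn_eq n d X \<kappa> (\<lambda>i. of_real (\<psi> t i)) = 0"
      using \<Psi>\<tau> unfolding G_iff by simp_all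
    have pos: "\<psi> t i > 0" if i: "i \<in> I" for i
    proof -
      have "\<bar>\<psi> t i - p i\<bar> < \<eta>"
      proof (cases "i \<in> S")
        case True
        then obtain a where "a < k" "i = \<sigma> a" using \<sigma>' by blast
        then show ?thesis using 1 t \<epsilon> by (simp add: B_def) fastforce
      next
        case False
        then have "\<bar>\<psi> t i - p i\<bar> < \<rho>" using 2 i by blast
        then show ?thesis using \<rho>(2) by linarith
      qed
      then show ?thesis using \<eta>p[OF i] by linarith
    qed
    have "complex_of_real (\<Sum>i\<in>I. \<psi> t i) = of_real 1" using e(1) by simp
    then have m: "(\<Sum>i\<in>I. \<psi> t i) = 1" by (simp only: of_real_eq_iff)
    have "\<psi> t \<in> open_simplex n d" using pos m 3 by (simp add: open_simplex_def coord_space_def)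
    moreover have "candidate X (\<lambda>i. of_real (\<psi> t i))"
      unfolding candidate_def e(1) using e(2,3) pos by fastforce
    ultimately have "\<psi> t \<in> ?S" unfolding equilibrium_iff by blast
    with 1 2 3 show ?thesis by blast
  qed
  have oU: "openin (top_of_set (coord_space I)) U"
  proof -
    have eq: "U = coord_space I \<inter> ((\<Inter>i\<in>{..<k}. {x. \<bar>x (\<sigma> i) - p (\<sigma> i)\<bar> < \<epsilon>}) \<inter> (\<Inter>a\<in>I - S. {x. \<bar>x a - p a\<bar> < \<rho>}))"
      unfolding U_def by auto
    have "open ((\<Inter>i\<in>{..<k}. {x. \<bar>x (\<sigma> i) - p (\<sigma> i)\<bar> < \<epsilon>}) \<inter> (\<Inter>a\<in>I - S. {x. \<bar>x a - p a\<bar> < \<rho>}))"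
      by (intro open_Int open_INT ballI open_Collect_less continuous_intros continuous_on_product_coordinates) auto
    then show ?thesis unfolding eq by (rule openin_open_Int)
  qed
  have oT: "openin (top_of_set (coord_space {..<k})) T"
  proof -
    have eq: "B = (\<Inter>i\<in>{..<k}. {t. \<bar>t i\<bar> < \<epsilon>})" unfolding B_def by auto
    have "open B" unfolding eq
      by (intro open_INT ballI open_Collect_less continuous_intros continuous_on_product_coordinates) auto
    then show ?thesis unfolding T_def by (rule openin_open_Int)
  qed
  have pU: "p \<in> U" using pI(1) \<epsilon> \<rho> by (simp add: U_def)
  have \<phi>U: "\<forall>a<k. C_infinity_on I U (\<lambda>x. \<phi> x a)"
  proof (intro allI impI)
    fix a assume a: "a < k"
    have "pfun I (\<lambda>x. x (\<sigma> a) - p (\<sigma> a))" by (intro pfun_diff pfun.coord pfun.const) (use \<sigma>[OF a] S(1) in blast)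
    then show "C_infinity_on I U (\<lambda>x. \<phi> x a)" unfolding \<phi>_def using a by (simp add: pfun_C_infinity_on)
  qed
  have \<psi>T: "\<forall>i\<in>I. C_infinity_on {..<k} T (\<lambda>t. \<psi> t i)"
    unfolding \<psi>_def
    by (intro ballI holomorphic_polydisc_C_infinity_on[OF \<epsilon>(1) _ hol[rule_format]]) (simp add: T_def B_def)
  have \<phi>\<psi>: "\<forall>t\<in>T. \<phi> (\<psi> t) = t"
  proof (intro ballI ext)
    fix t a assume "t \<in> T"
    then show "\<phi> (\<psi> t) a = t a" using \<psi>[of t] by (auto simp: \<phi>_def T_def coord_space_def)
  qed
  have "\<psi> ` T = ?S \<inter> U"
  proof
    show "\<psi> ` T \<subseteq> ?S \<inter> U"
    proof
      fix x assume "x \<in> \<psi> ` T"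
      then obtain t where t: "t \<in> B" "x = \<psi> t" unfolding T_def by blast
      show "x \<in> ?S \<inter> U" using \<psi>[OF t(1)] t(1) unfolding t(2) by (simp add: U_def coord_space_def B_def)
    qed
    show "?S \<inter> U \<subseteq> \<psi> ` T"
    proof
      fix x assume x: "x \<in> ?S \<inter> U"
      let ?t = "\<phi> x" and ?x = "\<lambda>i. complex_of_real (x i)"
      have tB: "?t \<in> B" using x by (simp add: B_def U_def \<phi>_def)
      have tT: "?t \<in> T" using tB by (simp add: T_def coord_space_def \<phi>_def)
      have \<tau>: "(\<lambda>a. complex_of_real (?t a)) \<in> polydisc k \<epsilon>" using tB by (simp add: polydisc_def B_def)
      have "x \<in> ?S" using x by blast
      then have xS: "x \<in> open_simplex n d" "candidate X ?x" unfolding equilibrium_iff by blast+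
      have 1: "\<forall>i<k. ?x (\<sigma> i) = P (\<sigma> i) + of_real (?t i)" by (simp add: P_def \<phi>_def)
      have 2: "\<forall>a\<in>I - S. norm (?x a - P a) < \<rho>"
        unfolding P_def of_real_diff[symmetric] norm_of_real using x by (simp add: U_def)
      have "mass ?x = 1" unfolding of_real_sum[symmetric] using xS(1) by (simp add: open_simplex_def del: of_real_sum)
      then have 3: "\<forall>l\<in>?L'. ?G' l ?x = 0" unfolding G_iff using xS(2) unfolding candidate_def by blast
      have 4: "\<forall>i\<in>I. ?x i = \<Psi> (\<lambda>a. of_real (?t a)) i"
        using bspec[OF uniq \<tau>, rule_format, of ?x] 1 2 3 by blast
      have "x i = \<psi> ?t i" for i
      proof (cases "i \<in> I")
        case True
        then show ?thesis using 4[rule_format, OF True] unfolding real[OF tB] by (simp only: of_real_eq_iff)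
      next
        case False
        then show ?thesis using \<psi>[OF tB] xS(1) by (simp add: open_simplex_def coord_space_def)
      qed
      then have "x = \<psi> ?t" by (rule ext)
      then show "x \<in> \<psi> ` T" using tT by (rule image_eqI)
    qed
  qed
  with oU pU oT \<phi>U \<psi>T \<phi>\<psi> show ?thesis
    by (intro exI[of _ U] exI[of _ T] exI[of _ \<phi>] exI[of _ \<psi>] conjI)
qed

lemma generic_gamesI:
  assumes Q: "pfun M Q" "Q X0 \<noteq> 0" and P: "\<And>X. Q X \<noteq> 0 \<Longrightarrow> P X"
  shows "for_generic_games n d P"
proof -
  obtain F where F: "F \<in> polys_in M" "mpoly_eval F = Q" using pfun_imp_mpoly[OF Q(1)] by blast
  let ?U = "{X \<in> coord_space M. mpoly_eval F X \<noteq> 0}"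
  have "openin (zariski_affine M) ?U"
    unfolding zariski_affine_def by (rule topology_generated_by_Basis) (use F(1) in blast)
  moreover have "?U \<noteq> {}"
  proof -
    \<comment> \<open>\<open>Q\<close> depends on the coordinates in \<open>M\<close> only, so its
      witness may be truncated to the coordinate space.\<close>
    let ?X = "\<lambda>m. if m \<in> M then X0 m else 0"
    have "Q ?X = Q X0" by (rule pfun_cong[OF Q(1)]) simp
    then have "?X \<in> ?U" using Q(2) F(2) by (simp add: coord_space_def)
    then show ?thesis by blast
  qed
  moreover have "\<forall>X\<in>?U. P X" using P F(2) by blast
  ultimately show ?thesis unfolding for_generic_games_def by blast
qed

end

theorem theorem3p7:
  fixes n :: nat and d :: "nat \<Rightarrow> nat" and E :: "nat set set"
  assumes graph: "E \<subseteq> {e. e \<subseteq> {1..n} \<and> card e = 2}"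
    and strategies: "\<And>i. i \<in> {1..n} \<Longrightarrow> 1 \<le> d i"
  shows "for_generic_games n d (\<lambda>X.
           \<forall>x \<in> spohn_CI_variety n d E X - special_hyperplanes n d.
             smooth_at (profiles n d) (spohn_CI_variety n d E X) x)
       \<and> (for_generic_games n d (\<lambda>X. totally_mixed_CI_equilibria n d E X = {})
          \<or> for_generic_games n d (\<lambda>X. \<exists>k.
               smooth_submanifold (profiles n d) k (totally_mixed_CI_equilibria n d E X) \<and>
               enat (k + ((\<Sum>i=1..n. d i) - n)) =
                 krull_dim (zariski_proj (profiles n d)) (graphical_model n d E)))"
proof -
  interpret game_model n d E by (unfold_locales) (rule strategies)
  obtain Q :: "game \<Rightarrow> real" and X0 where Q: "pfun M Q" "Q X0 \<noteq> 0"
    and reg: "\<And>X p. Q X \<noteq> 0 \<Longrightarrow> candidate X p \<Longrightarrow> regular X p"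
    using generic_regular by blast
  have "for_generic_games n d (\<lambda>X. \<forall>x \<in> spohn_CI_variety n d E X - special_hyperplanes n d.
      smooth_at I (spohn_CI_variety n d E X) x)"
    by (rule generic_gamesI[OF Q]) (intro ballI CI_smooth_at reg)
  \<comment> \<open>The model has dimension \<open>card \<Theta> - 1\<close>. If this is less than
    the number of Spohn equations, a regular solution would carry more independent equations than
    there are coordinates.\<close>
  moreover have "for_generic_games n d (\<lambda>X. totally_mixed_CI_equilibria n d E X = {})"
    if small: "card \<Theta> < Suc (card K)"
  proof (rule generic_gamesI[OF Q], rule ccontr)
    fix X assume X: "Q X \<noteq> 0" "totally_mixed_CI_equilibria n d E X \<noteq> {}"
    then obtain p where p: "p \<in> open_simplex n d" "candidate X (\<lambda>j. of_real (p j))"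
      using equilibrium_iff by blast
    have "(\<lambda>j. complex_of_real (p j)) \<in> coord_space I" using p(1) by (auto simp: open_simplex_def coord_space_def)
    from CI_local_dimension(1)[OF this p(2) reg[OF X(1) p(2)]] show False
      using small card_profiles by simp
  qed
  \<comment> \<open>The inequality makes the truncated subtraction in \<open>?k\<close> exact: the
    dimension of the model minus the number of Spohn equations.\<close>
  moreover have "for_generic_games n d (\<lambda>X. \<exists>k.
      smooth_submanifold I k (totally_mixed_CI_equilibria n d E X) \<and>
      enat (k + ((\<Sum>i=1..n. d i) - n)) = krull_dim (zariski_proj I) (graphical_model n d E))"
    if large: "Suc (card K) \<le> card \<Theta>"
  proof (rule generic_gamesI[OF Q], intro exI conjI)
    let ?k = "card I - Suc (card (I - \<Theta>) + card K)"
    show "enat (?k + ((\<Sum>i=1..n. d i) - n)) = krull_dim (zariski_proj I) (graphical_model n d E)"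
      unfolding krull_dim_graphical_model card_spohn_index[symmetric] card_profiles using large by simp
    fix X assume X: "Q X \<noteq> 0"
    show "smooth_submanifold I ?k (totally_mixed_CI_equilibria n d E X)"
      unfolding smooth_submanifold_def
      by (intro conjI ballI equilibria_chart reg[OF X])
        (auto simp: totally_mixed_CI_equilibria_def open_simplex_def)
  qed
  ultimately show ?thesis by (meson not_less_eq_eq not_le)
qed

end
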